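(* Let $\mathcal{X}=\mathbb{P}_{fr}^{d-1}(\mathcal{O}_r)$, and let $\mathcal{X}_{m,n}$ be the subgraph of $\mathcal{X}$ induced by the vertices of colors $m$ and $n$, for some $1\le m<n\le d-1$. (1) The complex $\mathcal{X}$ can be reconstructed from $\mathcal{X}_{m,n}$. (2) Every automorphism of $\mathcal{X}_{m,n}$ extends uniquely to an automorphism of $\mathcal{X}$, giving $$\mathrm{Aut}^0(\mathcal{X}_{m,n})=\mathrm{Aut}^0(\mathcal{X}),\qquad \mathrm{Aut}(\mathcal{X}_{m,n})=\begin{cases}\mathrm{Aut}(\mathcal{X}) & \text{if } m+n=d,\\ \mathrm{Aut}^0(\mathcal{X}) & \text{otherwise.}\end{cases}$$
   Context: Let $\mathcal{O}$ be a Dedekind domain, $\mathfrak{p}\trianglelefteq\mathcal{O}$ a prime ideal of finite residue order $q=|\mathcal{O}/\mathfrak{p}|$, $r\ge1$, and $\mathcal{O}_r=\mathcal{O}/\mathfrak{p}^r$, a finite local ring of size $q^r$. The free projective $d$-space $\mathbb{P}_{fr}^{d-1}(\mathcal{O}_r)$ is the simplicial complex whose vertices are the free submodules $0\lneq V\lneq\mathcal{O}_r^d$, and whose cells are the flags (chains under inclusion) of such free submodules. The color of a vertex is the rank of the corresponding submodule. For a complex or graph $Y$ with colored vertices, $\mathrm{Aut}(Y)$ denotes the group of all its (simplicial/graph) automorphisms and $\mathrm{Aut}^0(Y)$ the subgroup of color-preserving ones. In $\mathcal{X}_{m,n}$, a vertex $U$ of color $m$ and a vertex $V$ of color $n$ are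 adjacent iff $U\le V$. The equalities in (2) are via restriction of automorphisms from $\mathcal{X}$ to $\mathcal{X}_{m,n}$. *)

theory Defs
  imports "HOL-Algebra.Algebra"
begin

section \<open>Dedekind domains\<close>

text \<open>
  A domain in which every nonzero proper ideal is a product of prime ideals
  (so that fields count as Dedekind domains).
\<close>

locale dedekind_domain = "domain" R for R (structure) +
  assumes ideal_factorization:
    "\<lbrakk> ideal I R; I \<noteq> {\<zero>}; I \<noteq> carrier R \<rbrakk>
      \<Longrightarrow> \<exists>Ps. (\<forall>P \<in> set Ps. primeideal P R) \<and> I = foldr (ideal_prod R) Ps (carrier R)"

definition residue_ring_pow :: "('a, 'c) ring_scheme \<Rightarrow> 'a set \<Rightarrow> nat \<Rightarrow> 'a set ring" where
  "residue_ring_pow R \<pp> r = R Quot (\<pp> [^]\<^bsub>ideals_set R\<^esub> r)"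


section \<open>Free submodules of a free module\<close>

text \<open>The fields mult and one of the module record play no role for modules.\<close>

definition free_module :: "('a, 'c) ring_scheme \<Rightarrow> nat \<Rightarrow> ('a, nat \<Rightarrow> 'a) module" where
  "free_module K d =
    \<lparr> carrier = {..<d} \<rightarrow>\<^sub>E carrier K,
      monoid.mult = undefined,
      monoid.one = undefined,
      ring.zero = (\<lambda>i\<in>{..<d}. \<zero>\<^bsub>K\<^esub>),
      ring.add = (\<lambda>x y. \<lambda>i\<in>{..<d}. x i \<oplus>\<^bsub>K\<^esub> y i),
      module.smult = (\<lambda>a x. \<lambda>i\<in>{..<d}. a \<otimes>\<^bsub>K\<^esub> x i) \<rparr>"

definition module_basis ::
  "('a, 'c) ring_scheme \<Rightarrow> ('a, 'v, 'e) module_scheme \<Rightarrow> 'v set \<Rightarrow> 'v set \<Rightarrow> bool" where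
  "module_basis K M N B \<longleftrightarrow>
    finite B \<and> B \<subseteq> N \<and>
    (\<forall>x\<in>N. \<exists>!c. c \<in> B \<rightarrow>\<^sub>E carrier K \<and> x = (\<Oplus>\<^bsub>M\<^esub>b\<in>B. c b \<odot>\<^bsub>M\<^esub> b))"

definition module_rank ::
  "('a, 'c) ring_scheme \<Rightarrow> ('a, 'v, 'e) module_scheme \<Rightarrow> 'v set \<Rightarrow> nat" where
  "module_rank K M N = (THE k. \<exists>B. module_basis K M N B \<and> card B = k)"


section \<open>Simplicial complexes and their automorphisms\<close>

text \<open>
  A simplicial complex is given by its set of (nonempty) cells; its vertices are the
  elements of the cells.  A graph is the complex whose cells are the singletons of its
  vertices and its edges.  Isomorphisms are extensional functions, so that they are
  determined by their values on the vertices.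
\<close>

definition simplicial_isos :: "'v set set \<Rightarrow> 'w set set \<Rightarrow> ('v \<Rightarrow> 'w) set" where
  "simplicial_isos C D =
    {f \<in> extensional (\<Union>C).
      bij_betw f (\<Union>C) (\<Union>D) \<and> (\<forall>S. S \<subseteq> \<Union>C \<longrightarrow> (S \<in> C \<longleftrightarrow> f ` S \<in> D))}"

definition Aut :: "'v set set \<Rightarrow> ('v \<Rightarrow> 'v) monoid" where
  "Aut C = BijGroup (\<Union>C) \<lparr> carrier := simplicial_isos C C \<rparr>"

definition Aut0 :: "('v \<Rightarrow> nat) \<Rightarrow> 'v set set \<Rightarrow> ('v \<Rightarrow> 'v) monoid" where
  "Aut0 col C =
    BijGroup (\<Union>C) \<lparr> carrier := {f \<in> simplicial_isos C C. \<forall>v \<in> \<Union>C. col (f v) = col v} \<rparr>"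


section \<open>Free projective spaces\<close>

definition proper_free_submodules :: "('a, 'c) ring_scheme \<Rightarrow> nat \<Rightarrow> (nat \<Rightarrow> 'a) set set" where
  "proper_free_submodules K d =
    {V. submodule V K (free_module K d)
      \<and> V \<noteq> {\<zero>\<^bsub>free_module K d\<^esub>} \<and> V \<noteq> carrier (free_module K d)
      \<and> (\<exists>B. module_basis K (free_module K d) V B)}"

definition free_projective_space :: "('a, 'c) ring_scheme \<Rightarrow> nat \<Rightarrow> (nat \<Rightarrow> 'a) set set set" where
  "free_projective_space K d =
    {S. S \<noteq> {} \<and> finite S \<and> S \<subseteq> proper_free_submodules K d \<and> (\<forall>U\<in>S. \<forall>V\<in>S. U \<subseteq> V \<or> V \<subseteq> U)}"

definition color :: "('a, 'c) ring_scheme \<Rightarrow> nat \<Rightarrow> (nat \<Rightarrow> 'a) set \<Rightarrow> nat" where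
  "color K d V = module_rank K (free_module K d) V"

definition color_vertices :: "('a, 'c) ring_scheme \<Rightarrow> nat \<Rightarrow> nat \<Rightarrow> (nat \<Rightarrow> 'a) set set" where
  "color_vertices K d k = {V \<in> proper_free_submodules K d. color K d V = k}"

definition color_graph ::
  "('a, 'c) ring_scheme \<Rightarrow> nat \<Rightarrow> nat \<Rightarrow> nat \<Rightarrow> (nat \<Rightarrow> 'a) set set set" where
  "color_graph K d m n =
    {{U} | U. U \<in> color_vertices K d m \<union> color_vertices K d n}
    \<union> {{U, V} | U V. U \<in> color_vertices K d m \<and> V \<in> color_vertices K d n \<and> U \<subseteq> V}"

lemma card_module_basis:
  assumes K: "cring K" "finite (carrier K)"
    and N: "submodule N K (free_module K d)" and B: "module_basis K (free_module K d) N B"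
  shows "card N = card (carrier K) ^ card B"
proof -
  let ?M = "free_module K d"
  let ?f = "\<lambda>c. \<Oplus>\<^bsub>?M\<^esub>b\<in>B. c b \<odot>\<^bsub>?M\<^esub> b"
  interpret K: cring K by fact
  interpret M: abelian_group ?M
  proof (rule abelian_groupI)
    fix x assume "x \<in> carrier ?M"
    then show "\<exists>y\<in>carrier ?M. y \<oplus>\<^bsub>?M\<^esub> x = \<zero>\<^bsub>?M\<^esub>"
      by (intro bexI[of _ "\<lambda>i\<in>{..<d}. \<ominus>\<^bsub>K\<^esub> x i"])
         (auto simp: free_module_def PiE_iff K.l_neg intro!: restrict_ext)
  qed (auto simp: free_module_def PiE_iff K.a_ac extensional_def fun_eq_iff)
  have closed: "?f c \<in> N" if "c \<in> B \<rightarrow>\<^sub>E carrier K" for c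
  proof -
    have fin: "finite B" and sub: "B \<subseteq> N" using B by (auto simp: module_basis_def)
    have NM: "N \<subseteq> carrier ?M"
      using N by (auto simp: submodule_def subgroup_def)
    have sm: "c b \<odot>\<^bsub>?M\<^esub> b \<in> N" if "b \<in> B" for b
      using that \<open>c \<in> _\<close> sub N by (auto simp: submodule_def submodule_axioms_def)
    have "finite S \<Longrightarrow> S \<subseteq> B \<Longrightarrow> (\<Oplus>\<^bsub>?M\<^esub>b\<in>S. c b \<odot>\<^bsub>?M\<^esub> b) \<in> N" for S
    proof (induction S rule: finite_induct)
      case empty
      then show ?case using N by (auto simp: submodule_def subgroup_def)
    next
      case (insert x F)
      have "c x \<odot>\<^bsub>?M\<^esub> x \<in> carrier ?M" "(\<lambda>b. c b \<odot>\<^bsub>?M\<^esub> b) \<in> F \<rightarrow> carrier ?M"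
        using insert.prems sm NM by auto
      then have "(\<Oplus>\<^bsub>?M\<^esub>b\<in>insert x F. c b \<odot>\<^bsub>?M\<^esub> b)
          = c x \<odot>\<^bsub>?M\<^esub> x \<oplus>\<^bsub>?M\<^esub> (\<Oplus>\<^bsub>?M\<^esub>b\<in>F. c b \<odot>\<^bsub>?M\<^esub> b)"
        using insert.hyps by (simp add: M.finsum_insert)
      then show ?case
        using insert.prems insert.IH sm N by (auto simp: submodule_def subgroup_def)
    qed
    then show ?thesis using fin by blast
  qed
  have "bij_betw ?f (B \<rightarrow>\<^sub>E carrier K) N"
    unfolding bij_betw_def
  proof
    show "inj_on ?f (B \<rightarrow>\<^sub>E carrier K)"
    proof (rule inj_onI)
      fix c c' assume c: "c \<in> B \<rightarrow>\<^sub>E carrier K" "c' \<in> B \<rightarrow>\<^sub>E carrier K" "?f c = ?f c'"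
      have "\<exists>!e. e \<in> B \<rightarrow>\<^sub>E carrier K \<and> ?f c = ?f e"
        using B closed[OF c(1)] unfolding module_basis_def by blast
      then show "c = c'" using c by blast
    qed
    show "?f ` (B \<rightarrow>\<^sub>E carrier K) = N"
      using B closed unfolding module_basis_def by blast
  qed
  then show ?thesis
    using B by (simp add: bij_betw_same_card[symmetric] card_PiE module_basis_def)
qed

text \<open>The graph of colors m and n is indeed an induced subcomplex: it contains all cells on its vertices.\<close>

lemma color_graph_induced:
  assumes "cring K" "finite (carrier K)" "\<one>\<^bsub>K\<^esub> \<noteq> \<zero>\<^bsub>K\<^esub>" "m < n"
  shows "color_graph K d m n =
    {S \<in> free_projective_space K d. S \<subseteq> color_vertices K d m \<union> color_vertices K d n}"
proof -
  let ?M = "free_module K d"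
  interpret K: cring K by fact
  have "{\<one>\<^bsub>K\<^esub>, \<zero>\<^bsub>K\<^esub>} \<subseteq> carrier K" by auto
  then have q: "1 < card (carrier K)"
    using card_mono[OF assms(2), of "{\<one>\<^bsub>K\<^esub>, \<zero>\<^bsub>K\<^esub>}"] assms(3) by auto
  have card: "card V = card (carrier K) ^ color K d V" if V: "V \<in> proper_free_submodules K d" for V
  proof -
    obtain B where B: "module_basis K ?M V B" and sub: "submodule V K ?M"
      using V by (auto simp: proper_free_submodules_def)
    have "card B' = card B" if "module_basis K ?M V B'" for B'
      using card_module_basis[OF assms(1,2) sub that] card_module_basis[OF assms(1,2) sub B] q
      by simp
    then have "module_rank K ?M V = card B"
      unfolding module_rank_def using B by blast
    then show ?thesis
      using card_module_basis[OF assms(1,2) sub B] by (simp add: color_def)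
  qed
  have fin: "finite V" if "V \<in> proper_free_submodules K d" for V
    using card[OF that] q by (intro card_ge_0_finite) auto
  have eq: "U = V"
    if "U \<in> color_vertices K d k" "V \<in> color_vertices K d k" "U \<subseteq> V" for U V k
    using that card fin by (auto simp: color_vertices_def card_subset_eq)
  have le: "color K d U \<le> color K d V"
    if "U \<in> proper_free_submodules K d" "V \<in> proper_free_submodules K d" "U \<subseteq> V" for U V
    using card_mono[OF fin[OF that(2)] that(3)] card that q by simp
  show ?thesis
  proof (intro equalityI subsetI)
    fix S assume "S \<in> color_graph K d m n"
    then show "S \<in> {S \<in> free_projective_space K d.
        S \<subseteq> color_vertices K d m \<union> color_vertices K d n}"
      by (auto simp: color_graph_def free_projective_space_def color_vertices_def)
  next
    fix S assume "S \<in> {S \<in> free_projective_space K d.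
        S \<subseteq> color_vertices K d m \<union> color_vertices K d n}"
    then have s: "S \<noteq> {}" "\<forall>U\<in>S. \<forall>V\<in>S. U \<subseteq> V \<or> V \<subseteq> U"
      "S \<subseteq> color_vertices K d m \<union> color_vertices K d n"
      by (auto simp: free_projective_space_def)
    have mem: "W \<in> color_vertices K d (color K d W) \<and> color K d W \<in> {m, n}" if "W \<in> S" for W
      using s(3) that by (auto simp: color_vertices_def)
    have one: "U = V" if "U \<in> S" "V \<in> S" "color K d U = color K d V" for U V
      using s(2) that mem[of U] mem[of V] eq[of U _ V] eq[of V _ U] by metis
    show "S \<in> color_graph K d m n"
    proof (cases "\<exists>U\<in>S. \<exists>V\<in>S. color K d U = m \<and> color K d V = n")
      case True
      then obtain U V where UV: "U \<in> S" "V \<in> S" "color K d U = m" "color K d V = n" by auto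
      have UV': "U \<in> color_vertices K d m" "V \<in> color_vertices K d n"
        using UV mem by auto
      have "S = {U, V}"
        using UV one mem by blast
      moreover have "U \<subseteq> V"
        using s(2) UV UV' le[of V U] assms(4) by (auto simp: color_vertices_def)
      ultimately show ?thesis
        unfolding color_graph_def using UV' by blast
    next
      case False
      obtain U where U: "U \<in> S" using s(1) by auto
      have "S = {U}"
        using False U one mem by blast
      then show ?thesis
        unfolding color_graph_def using U s(3) by blast
    qed
  qed
qed

end

theory Submission
  imports Defs
begin

text \<open>
  Over \<open>K = R/\<pp>\<^sup>r\<close>, a finite chain ring, a submodule of \<open>M = K\<^sup>d\<close> is free iff it is complemented, and
  orthogonal complements exchange ranks \<open>k\<close> and \<open>d - k\<close>.  In an isomorphism of graphs
  \<open>\<X>\<^sub>m\<^sub>,\<^sub>n\<close> connectedness forces the two sides to be preserved or exchanged, and composing with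
  orthogonal complements we may assume that they are preserved.

  Every submodule \<open>W\<close> with \<open>U \<le> W \<le> V\<close>, where \<open>U\<close> has rank \<open>m\<close> and \<open>V\<close> has rank \<open>n\<close>, is spanned by
  the free submodules of rank \<open>m\<close> in it and is the intersection of those of rank \<open>n\<close> above it.  So the
  submodule lattice of each interval \<open>[U, V]\<close> is visible in the graph, and with it its complemented
  elements: all ranks between \<open>m\<close> and \<open>n\<close> are recovered.

  To go down from \<open>m\<close> to \<open>m - 1\<close>: two free submodules of rank \<open>m\<close> have a sum of rank \<open>m + 1\<close> iff they have
  exactly one common upper bound of that rank.  A free submodule of rank \<open>m - 1\<close> is the intersection of such
  a pair, and different pairs with the same intersection are linked by triangles, as in the theorem of Chow
  on Grassmannians.  Rank \<open>0\<close> is reached when there is a single submodule left, and duality gives the ranks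
  above \<open>n\<close>.

  Conversely an automorphism of the whole complex preserves or reverses inclusion, because edges with a
  common end and incomparable other ends are oriented alike; on the ranks it is \<open>k \<mapsto> k\<close> or
  \<open>k \<mapsto> d - k\<close>.
\<close>

section \<open>Finite chain rings\<close>

text \<open>Unless \<pi> = 0 (then s = 1 and K is a field), sums and intersections of free
  submodules need not be free, so the free submodules form no lattice and the classical arguments
  for subspaces break down. Two devices repair this. Inside an interval all submodules are used,
  free or not: they form a lattice in which freeness can be recognised. Elsewhere vectors are chosen
  in general position: a vector outside V + \<pi>M extends a free V to a free submodule of rank one
  more, and two proper submodules never cover M, so that two such conditions can be met at once.
  Maps go between two modules over possibly different rings, whose ranks and dimensions are not
  assumed to match. Reconstruction asks for this, and it lets each argument about a map be applied
  to its inverse or to its composite with orthogonal complements. The form is the dot product, which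
  realises the dual of K^d in K^d itself; hence complements act on the vertices of the same
  complex.\<close>

locale chain_ring = cring K for K (structure) +
  fixes \<pi> :: 'a and s :: nat
  assumes finite_ring: "finite (carrier K)"
    and unif_closed [simp, intro]: "\<pi> \<in> carrier K"
    and unit_or_multiple: "a \<in> carrier K \<Longrightarrow> a \<in> Units K \<or> (\<exists>b\<in>carrier K. a = \<pi> \<otimes> b)"
    and unif_pow_eq: "\<pi> [^] s = \<zero>"
    and s_pos: "0 < s"
    and unif_pow_neq: "\<pi> [^] (s - 1) \<noteq> \<zero>"
begin

text \<open>The size of the whole ring K rather than of its residue field, so that free submodules
  of rank k have \<open>q ^ k\<close> elements.\<close>

definition q :: nat where "q = card (carrier K)"

lemma one_neq_zero: "\<one> \<noteq> \<zero>"
proof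
  assume "\<one> = \<zero>"
  then have "carrier K = {\<zero>}" by (simp add: carrier_one_zero)
  then show False using unif_pow_neq by blast
qed

lemma q_gt_1: "1 < q"
  unfolding q_def using card_mono[OF finite_ring, of "{\<one>, \<zero>}"] one_neq_zero by auto

text \<open>Factors \<pi> are split off until the cofactor is a unit; \<pi>^s = 0 stops this before
  s steps. The exponent is the valuation of \<open>a\<close>, and it makes the ideals of K a
  chain.\<close>

lemma unit_times_power:
  assumes a: "a \<in> carrier K" "a \<noteq> \<zero>"
  shows "\<exists>u\<in>Units K. \<exists>i<s. a = u \<otimes> \<pi> [^] i"
proof -
  have *: "(\<exists>u\<in>Units K. \<exists>i<j. a = u \<otimes> \<pi> [^] i) \<or> (\<exists>b\<in>carrier K. a = \<pi> [^] j \<otimes> b)" for j :: nat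
  proof (induction j)
    case 0
    then show ?case using a by (intro disjI2 bexI[of _ a]) auto
  next
    case (Suc j)
    then show ?case
    proof
      assume "\<exists>b\<in>carrier K. a = \<pi> [^] j \<otimes> b"
      then obtain b where b: "b \<in> carrier K" "a = \<pi> [^] j \<otimes> b" by blast
      from unit_or_multiple[OF b(1)] show ?thesis
      proof
        assume "b \<in> Units K"
        then show ?thesis using b
          by (intro disjI1 bexI[of _ b] exI[of _ j]) (auto simp: m_comm)
      next
        assume "\<exists>c\<in>carrier K. b = \<pi> \<otimes> c"
        then obtain c where "c \<in> carrier K" "b = \<pi> \<otimes> c" by blast
        then show ?thesis using b
          by (intro disjI2 bexI[of _ c]) (auto simp: m_assoc)
      qed
    qed (meson less_SucI)
  qed
  show ?thesis
    using *[of s] a unif_pow_eq by auto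
qed

lemma unif_pow_nonzero: "i < s \<Longrightarrow> \<pi> [^] i \<noteq> \<zero>"
proof
  assume i: "i < s" "\<pi> [^] i = \<zero>"
  have "\<pi> [^] (s - 1) = \<pi> [^] i \<otimes> \<pi> [^] (s - 1 - i)"
    using i(1) nat_pow_mult[of \<pi> i "s - 1 - i"] by simp
  then show False using i(2) unif_pow_neq by simp
qed

lemma unit_mult_eq_zero: "\<lbrakk>u \<in> Units K; a \<in> carrier K; u \<otimes> a = \<zero>\<rbrakk> \<Longrightarrow> a = \<zero>"
  by (metis Units_closed Units_l_cancel r_null zero_closed)

text \<open>Valuations add up, so an element killed by \<pi>^i has valuation at least s - i. The
  annihilator of the ideal (\<pi>^i) is thus (\<pi>^(s-i)), the fact behind duality over K.\<close>

lemma unif_pow_mult_zero: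
  assumes a: "a \<in> carrier K" and i: "i \<le> s" and z: "\<pi> [^] i \<otimes> a = \<zero>"
  shows "\<exists>b\<in>carrier K. a = \<pi> [^] (s - i) \<otimes> b"
proof (cases "a = \<zero>")
  case True
  then show ?thesis by (intro bexI[of _ \<zero>]) auto
next
  case False
  then obtain u j where u: "u \<in> Units K" "j < s" "a = u \<otimes> \<pi> [^] j"
    using unit_times_power[OF a] by blast
  then have uc: "u \<in> carrier K" by blast
  have "u \<otimes> \<pi> [^] (i + j) = \<pi> [^] i \<otimes> a"
    using u uc by (simp add: nat_pow_mult[symmetric] m_lcomm)
  then have "\<pi> [^] (i + j) = \<zero>" using unit_mult_eq_zero[OF u(1)] z by simp
  then have "s - i \<le> j" using unif_pow_nonzero[of "i + j"] by fastforce
  then have "\<pi> [^] j = \<pi> [^] (s - i) \<otimes> \<pi> [^] (j - (s - i))"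
    by (simp add: nat_pow_mult)
  then show ?thesis
    using u uc by (intro bexI[of _ "\<pi> [^] (j - (s - i)) \<otimes> u"]) (auto simp: m_ac)
qed

lemma unif_mult_zero:
  assumes "a \<in> carrier K" "\<pi> \<otimes> a = \<zero>"
  shows "\<exists>b\<in>carrier K. a = \<pi> [^] (s - 1) \<otimes> b"
  using unif_pow_mult_zero[of a 1] assms s_pos by auto

lemma unif_pow_pred_mult_zero:
  assumes "a \<in> carrier K" "\<pi> [^] (s - 1) \<otimes> a = \<zero>"
  shows "\<exists>b\<in>carrier K. a = \<pi> \<otimes> b"
proof -
  have "s - (s - 1) = 1" using s_pos by simp
  then show ?thesis using unif_pow_mult_zero[of a "s - 1"] assms by auto
qed

lemma unif_pow_Suc: "\<pi> [^] Suc i = \<pi> \<otimes> \<pi> [^] i"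
  by (simp add: m_comm)

text \<open>The ideal (\<pi>^(s-1)) is the least nonzero ideal of the chain. A claim that no nonzero
  scalar does something is thereby reduced to the single scalar \<pi>^(s-1).\<close>

lemma multiple_into_socle:
  assumes "a \<in> carrier K" "a \<noteq> \<zero>"
  shows "\<exists>e\<in>carrier K. e \<otimes> a = \<pi> [^] (s - 1)"
proof -
  obtain u j where u: "u \<in> Units K" "j < s" "a = u \<otimes> \<pi> [^] j"
    using unit_times_power[OF assms] by blast
  have e: "\<pi> [^] (s - 1) = \<pi> [^] (s - 1 - j) \<otimes> \<pi> [^] j"
    using u(2) by (simp add: nat_pow_mult)
  have "\<pi> [^] (s - 1 - j) \<otimes> inv u \<otimes> a = \<pi> [^] (s - 1 - j) \<otimes> (inv u \<otimes> u) \<otimes> \<pi> [^] j"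
    using u by (simp add: m_assoc Units_closed del: Units_l_inv)
  then show ?thesis using u e
    by (intro bexI[of _ "\<pi> [^] (s - 1 - j) \<otimes> inv u"]) (auto simp: Units_closed)
qed

end

section \<open>Pure submodules\<close>

text \<open>These are the properties of K^d on which the geometry rests: its size, divisibility of
  the \<pi>-torsion by \<pi>^(s-1), and a nondegenerate symmetric bilinear form. Coordinates enter
  only when K^d is shown to be an instance.\<close>

locale free_space = module K M + chain_ring K \<pi> s
  for K (structure) and \<pi> s and M (structure) +
  fixes d :: nat and form :: "'c \<Rightarrow> 'c \<Rightarrow> 'a"
  assumes card_space: "card (carrier M) = card (carrier K) ^ d"
    and socle: "\<lbrakk>x \<in> carrier M; \<pi> \<odot>\<^bsub>M\<^esub> x = \<zero>\<^bsub>M\<^esub>\<rbrakk>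
        \<Longrightarrow> \<exists>y\<in>carrier M. x = (\<pi> [^] (s - 1)) \<odot>\<^bsub>M\<^esub> y"
    and form_closed [simp, intro]:
      "\<lbrakk>x \<in> carrier M; y \<in> carrier M\<rbrakk> \<Longrightarrow> form x y \<in> carrier K"
    and form_sym: "\<lbrakk>x \<in> carrier M; y \<in> carrier M\<rbrakk> \<Longrightarrow> form x y = form y x"
    and form_add: "\<lbrakk>x \<in> carrier M; y \<in> carrier M; z \<in> carrier M\<rbrakk>
      \<Longrightarrow> form (x \<oplus>\<^bsub>M\<^esub> y) z = form x z \<oplus> form y z"
    and form_smult: "\<lbrakk>a \<in> carrier K; x \<in> carrier M; z \<in> carrier M\<rbrakk>
      \<Longrightarrow> form (a \<odot>\<^bsub>M\<^esub> x) z = a \<otimes> form x z"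
    and form_nondeg: "\<lbrakk>x \<in> carrier M; \<forall>y\<in>carrier M. form x y = \<zero>\<rbrakk> \<Longrightarrow> x = \<zero>\<^bsub>M\<^esub>"
begin

lemma finite_space: "finite (carrier M)"
  using card_space q_gt_1 by (intro card_ge_0_finite) (auto simp: q_def)

abbreviation "sub V \<equiv> submodule V K M"

lemma sub_carrier: "\<lbrakk>sub V; x \<in> V\<rbrakk> \<Longrightarrow> x \<in> carrier M"
  using submoduleE(1) by blast

lemma sub_subset: "sub V \<Longrightarrow> V \<subseteq> carrier M"
  using submoduleE(1) by blast

lemma sub_finite: "sub V \<Longrightarrow> finite V"
  using sub_subset finite_space finite_subset by blast

lemma sub_add: "\<lbrakk>sub V; x \<in> V; y \<in> V\<rbrakk> \<Longrightarrow> x \<oplus>\<^bsub>M\<^esub> y \<in> V"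
  using submoduleE(5) by blast

lemma sub_neg: "\<lbrakk>sub V; x \<in> V\<rbrakk> \<Longrightarrow> \<ominus>\<^bsub>M\<^esub> x \<in> V"
  using submoduleE(3) by blast

lemma sub_smult: "\<lbrakk>sub V; a \<in> carrier K; x \<in> V\<rbrakk> \<Longrightarrow> a \<odot>\<^bsub>M\<^esub> x \<in> V"
  using submoduleE(4) by blast

lemma sub_zero: "sub V \<Longrightarrow> \<zero>\<^bsub>M\<^esub> \<in> V"
  using submoduleE(2)[of V] sub_smult[of V \<zero>] sub_carrier by (metis R.zero_closed ex_in_conv smult_l_null)

lemma sub_diff: "\<lbrakk>sub V; x \<in> V; y \<in> V\<rbrakk> \<Longrightarrow> x \<ominus>\<^bsub>M\<^esub> y \<in> V"
  by (simp add: a_minus_def sub_add sub_neg)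

lemma sub_cancel_right:
  assumes "sub V" "x \<oplus>\<^bsub>M\<^esub> y \<in> V" "y \<in> V" "x \<in> carrier M"
  shows "x \<in> V"
proof -
  have "x = (x \<oplus>\<^bsub>M\<^esub> y) \<ominus>\<^bsub>M\<^esub> y"
    using assms sub_carrier by (simp add: a_minus_def M.a_assoc M.r_neg)
  then show ?thesis using assms sub_diff by metis
qed

lemma sub_cancel_left:
  assumes "sub V" "x \<oplus>\<^bsub>M\<^esub> y \<in> V" "x \<in> V" "y \<in> carrier M"
  shows "y \<in> V"
  using sub_cancel_right[of V y x] assms sub_carrier by (simp add: M.a_comm)

lemma sub_unit_smult:
  assumes "sub V" "u \<in> Units K" "x \<in> carrier M" "u \<odot>\<^bsub>M\<^esub> x \<in> V"
  shows "x \<in> V"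
proof -
  have "x = inv u \<odot>\<^bsub>M\<^esub> (u \<odot>\<^bsub>M\<^esub> x)"
    using assms by (simp add: smult_assoc1[symmetric] Units_closed)
  then show ?thesis using assms sub_smult[of V "inv u"] by (metis Units_inv_closed)
qed

lemma sub_Int: "\<lbrakk>sub V; sub W\<rbrakk> \<Longrightarrow> sub (V \<inter> W)"
  by (intro submoduleI) (auto dest: sub_carrier sub_neg sub_add sub_zero sub_smult)

lemma sub_INT:
  assumes "\<And>V. V \<in> \<V> \<Longrightarrow> sub V"
  shows "sub (carrier M \<inter> \<Inter>\<V>)"
  using assms by (intro submoduleI) (auto dest: sub_carrier sub_neg sub_add sub_zero sub_smult)

lemma sub_zero_space: "sub {\<zero>\<^bsub>M\<^esub>}"
  by (intro submoduleI) auto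

definition vsum (infixl \<open>\<boxplus>\<close> 65) where
  "V \<boxplus> W = {v \<oplus>\<^bsub>M\<^esub> w | v w. v \<in> V \<and> w \<in> W}"

definition ray where "ray x = {c \<odot>\<^bsub>M\<^esub> x | c. c \<in> carrier K}"

definition unif_space where "unif_space = {\<pi> \<odot>\<^bsub>M\<^esub> z | z. z \<in> carrier M}"

lemma vsum_iff: "x \<in> V \<boxplus> W \<longleftrightarrow> (\<exists>v\<in>V. \<exists>w\<in>W. x = v \<oplus>\<^bsub>M\<^esub> w)"
  by (auto simp: vsum_def)

lemma sub_vsum:
  assumes V: "sub V" and W: "sub W"
  shows "sub (V \<boxplus> W)"
proof (rule submoduleI)
  show "V \<boxplus> W \<subseteq> carrier M"
    using sub_carrier[OF V] sub_carrier[OF W] by (auto simp: vsum_iff)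
  show "\<zero>\<^bsub>M\<^esub> \<in> V \<boxplus> W" using sub_zero[OF V] sub_zero[OF W]
    by (force simp: vsum_iff)
next
  fix a assume "a \<in> V \<boxplus> W"
  then obtain v w where "v \<in> V" "w \<in> W" "a = v \<oplus>\<^bsub>M\<^esub> w" by (auto simp: vsum_iff)
  moreover from this have "\<ominus>\<^bsub>M\<^esub> a = \<ominus>\<^bsub>M\<^esub> v \<oplus>\<^bsub>M\<^esub> \<ominus>\<^bsub>M\<^esub> w"
    using assms sub_carrier by (simp add: M.minus_add)
  ultimately show "\<ominus>\<^bsub>M\<^esub> a \<in> V \<boxplus> W"
    using assms sub_neg by (metis vsum_iff)
next
  fix a b assume "a \<in> V \<boxplus> W" "b \<in> V \<boxplus> W"
  then obtain v w v' w' where "v \<in> V" "w \<in> W" "a = v \<oplus>\<^bsub>M\<^esub> w"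
    "v' \<in> V" "w' \<in> W" "b = v' \<oplus>\<^bsub>M\<^esub> w'" by (auto simp: vsum_iff)
  moreover from this have "a \<oplus>\<^bsub>M\<^esub> b = (v \<oplus>\<^bsub>M\<^esub> v') \<oplus>\<^bsub>M\<^esub> (w \<oplus>\<^bsub>M\<^esub> w')"
    using sub_carrier[OF V] sub_carrier[OF W] by (simp add: M.a_ac)
  ultimately show "a \<oplus>\<^bsub>M\<^esub> b \<in> V \<boxplus> W"
    using assms sub_add by (metis vsum_iff)
next
  fix c a assume c: "c \<in> carrier K" and "a \<in> V \<boxplus> W"
  then obtain v w where "v \<in> V" "w \<in> W" "a = v \<oplus>\<^bsub>M\<^esub> w" by (auto simp: vsum_iff)
  moreover from this have "c \<odot>\<^bsub>M\<^esub> a = c \<odot>\<^bsub>M\<^esub> v \<oplus>\<^bsub>M\<^esub> c \<odot>\<^bsub>M\<^esub> w"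
    using assms sub_carrier c by (simp add: smult_r_distr)
  ultimately show "c \<odot>\<^bsub>M\<^esub> a \<in> V \<boxplus> W"
    using assms sub_smult c by (metis vsum_iff)
qed

lemma vsum_upper1: "\<lbrakk>sub V; sub W\<rbrakk> \<Longrightarrow> V \<subseteq> V \<boxplus> W"
  using sub_zero[of W] sub_carrier[of V] by (force simp: vsum_iff)

lemma vsum_upper2: "\<lbrakk>sub V; sub W\<rbrakk> \<Longrightarrow> W \<subseteq> V \<boxplus> W"
  using sub_zero[of V] sub_carrier[of W] by (force simp: vsum_iff)

lemma vsum_least: "\<lbrakk>sub Y; V \<subseteq> Y; W \<subseteq> Y\<rbrakk> \<Longrightarrow> V \<boxplus> W \<subseteq> Y"
  using sub_add by (force simp: vsum_iff)

lemma sub_ray: "x \<in> carrier M \<Longrightarrow> sub (ray x)"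
proof (rule submoduleI)
  assume x: "x \<in> carrier M"
  show "ray x \<subseteq> carrier M" using x by (auto simp: ray_def)
  show "\<zero>\<^bsub>M\<^esub> \<in> ray x" using x smult_l_null[OF x] R.zero_closed by (force simp: ray_def)
  fix a assume "a \<in> ray x"
  then obtain c where c: "c \<in> carrier K" "a = c \<odot>\<^bsub>M\<^esub> x" by (auto simp: ray_def)
  then have "\<ominus>\<^bsub>M\<^esub> a = (\<ominus> c) \<odot>\<^bsub>M\<^esub> x" using x by (simp add: smult_l_minus)
  then show "\<ominus>\<^bsub>M\<^esub> a \<in> ray x" using c by (auto simp: ray_def)
  {
    fix b assume "b \<in> ray x"
    then obtain e where e: "e \<in> carrier K" "b = e \<odot>\<^bsub>M\<^esub> x" by (auto simp: ray_def)
    then show "a \<oplus>\<^bsub>M\<^esub> b \<in> ray x" using smult_l_distr[OF c(1) e(1) x] c R.a_closed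
      by (metis (mono_tags, lifting) mem_Collect_eq ray_def)
  next
    fix e assume e: "e \<in> carrier K"
    then show "e \<odot>\<^bsub>M\<^esub> a \<in> ray x" using smult_assoc1[OF e c(1) x] c R.m_closed
      by (metis (mono_tags, lifting) mem_Collect_eq ray_def)
  }
qed

lemma ray_self: "x \<in> carrier M \<Longrightarrow> x \<in> ray x"
  using smult_one[of x] R.one_closed by (force simp: ray_def)

lemma ray_least: "\<lbrakk>sub Y; x \<in> Y\<rbrakk> \<Longrightarrow> ray x \<subseteq> Y"
  using sub_smult by (auto simp: ray_def)

lemma sub_unif_space: "sub unif_space"
proof (rule submoduleI)
  show "unif_space \<subseteq> carrier M" by (auto simp: unif_space_def)
  show "\<zero>\<^bsub>M\<^esub> \<in> unif_space" using smult_r_null[of \<pi>] by (force simp: unif_space_def)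
  fix a assume "a \<in> unif_space"
  then obtain x where x: "x \<in> carrier M" "a = \<pi> \<odot>\<^bsub>M\<^esub> x" by (auto simp: unif_space_def)
  have "\<ominus>\<^bsub>M\<^esub> a = \<pi> \<odot>\<^bsub>M\<^esub> (\<ominus>\<^bsub>M\<^esub> x)" using x by (simp add: smult_r_minus)
  then show "\<ominus>\<^bsub>M\<^esub> a \<in> unif_space" using x by (auto simp: unif_space_def)
  {
    fix b assume "b \<in> unif_space"
    then obtain y where y: "y \<in> carrier M" "b = \<pi> \<odot>\<^bsub>M\<^esub> y" by (auto simp: unif_space_def)
    then have "a \<oplus>\<^bsub>M\<^esub> b = \<pi> \<odot>\<^bsub>M\<^esub> (x \<oplus>\<^bsub>M\<^esub> y)" using x by (simp add: smult_r_distr)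
    then show "a \<oplus>\<^bsub>M\<^esub> b \<in> unif_space" using x y by (auto simp: unif_space_def)
  next
    fix e assume e: "e \<in> carrier K"
    have "e \<odot>\<^bsub>M\<^esub> a = \<pi> \<odot>\<^bsub>M\<^esub> (e \<odot>\<^bsub>M\<^esub> x)"
      using x e by (simp add: smult_assoc1[symmetric] R.m_comm)
    then show "e \<odot>\<^bsub>M\<^esub> a \<in> unif_space" using x e by (auto simp: unif_space_def)
  }
qed

definition ext where "ext V x = V \<boxplus> ray x"
text \<open>The vectors outside \<open>nbhd V\<close>, that is outside \<open>V + \<pi>M\<close>, are those that extend a basis of \<open>V\<close>.\<close>

definition nbhd where "nbhd V = V \<boxplus> unif_space"

lemma ext_iff: "y \<in> ext V x \<longleftrightarrow> (\<exists>v\<in>V. \<exists>c\<in>carrier K. y = v \<oplus>\<^bsub>M\<^esub> c \<odot>\<^bsub>M\<^esub> x)"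
  by (auto simp: ext_def vsum_iff ray_def)

lemma nbhd_iff: "y \<in> nbhd V \<longleftrightarrow> (\<exists>v\<in>V. \<exists>z\<in>carrier M. y = v \<oplus>\<^bsub>M\<^esub> \<pi> \<odot>\<^bsub>M\<^esub> z)"
  by (auto simp: nbhd_def vsum_iff unif_space_def)

lemma sub_ext: "\<lbrakk>sub V; x \<in> carrier M\<rbrakk> \<Longrightarrow> sub (ext V x)"
  by (simp add: ext_def sub_vsum sub_ray)

lemma sub_nbhd: "sub V \<Longrightarrow> sub (nbhd V)"
  by (simp add: nbhd_def sub_vsum sub_unif_space)

lemma ext_upper: "\<lbrakk>sub V; x \<in> carrier M\<rbrakk> \<Longrightarrow> V \<subseteq> ext V x"
  by (simp add: ext_def vsum_upper1 sub_ray)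

lemma ext_self: "\<lbrakk>sub V; x \<in> carrier M\<rbrakk> \<Longrightarrow> x \<in> ext V x"
  using vsum_upper2[of V "ray x"] ray_self[of x] by (auto simp: ext_def sub_ray)

lemma ext_least: "\<lbrakk>sub Y; V \<subseteq> Y; x \<in> Y\<rbrakk> \<Longrightarrow> ext V x \<subseteq> Y"
  by (simp add: ext_def vsum_least ray_least)

lemma ext_mono: "\<lbrakk>sub W; V \<subseteq> W; x \<in> carrier M\<rbrakk> \<Longrightarrow> ext V x \<subseteq> ext W x"
  unfolding ext_iff subset_iff by blast

lemma nbhd_upper: "sub V \<Longrightarrow> V \<subseteq> nbhd V"
  by (simp add: nbhd_def vsum_upper1 sub_unif_space)

lemma nbhd_unif: "\<lbrakk>sub V; z \<in> carrier M\<rbrakk> \<Longrightarrow> \<pi> \<odot>\<^bsub>M\<^esub> z \<in> nbhd V"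
  unfolding nbhd_iff by (intro bexI[of _ "\<zero>\<^bsub>M\<^esub>"] bexI[of _ z]) (auto simp: sub_zero)

lemma nbhd_mono: "V \<subseteq> W \<Longrightarrow> nbhd V \<subseteq> nbhd W"
  unfolding nbhd_iff subset_iff by blast

lemma nbhd_carrier: "sub V \<Longrightarrow> nbhd V \<subseteq> carrier M"
  using sub_nbhd sub_subset by blast

text \<open>If x avoids V and y avoids W, then one of x, y and x + y avoids both. This is the source
  of all choices in general position.\<close>

lemma avoid_two:
  assumes V: "sub V" "V \<noteq> carrier M" and W: "sub W" "W \<noteq> carrier M"
  shows "\<exists>z\<in>carrier M. z \<notin> V \<and> z \<notin> W"
proof -
  obtain x y where x: "x \<in> carrier M" "x \<notin> V" and y: "y \<in> carrier M" "y \<notin> W"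
    using assms sub_subset by blast
  have "x \<oplus>\<^bsub>M\<^esub> y \<notin> V" if "y \<in> V" using that x V sub_cancel_right by blast
  moreover have "x \<oplus>\<^bsub>M\<^esub> y \<notin> W" if "x \<in> W" using that y W sub_cancel_left by blast
  ultimately show ?thesis using x y by blast
qed

text \<open>Over a finite chain ring the pure submodules are exactly the free ones (\<open>basis_pure\<close> and \<open>Fr_basis\<close>
  below), so that purity and cardinality can replace bases.\<close>

definition pure where
  "pure V \<longleftrightarrow> sub V \<and> (\<forall>z\<in>carrier M. \<pi> \<odot>\<^bsub>M\<^esub> z \<in> V \<longrightarrow> (\<exists>v\<in>V. \<pi> \<odot>\<^bsub>M\<^esub> z = \<pi> \<odot>\<^bsub>M\<^esub> v))"

lemma pure_sub: "pure V \<Longrightarrow> sub V"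
  by (simp add: pure_def)

lemma pureD: "\<lbrakk>pure V; z \<in> carrier M; \<pi> \<odot>\<^bsub>M\<^esub> z \<in> V\<rbrakk> \<Longrightarrow> \<exists>v\<in>V. \<pi> \<odot>\<^bsub>M\<^esub> z = \<pi> \<odot>\<^bsub>M\<^esub> v"
  by (simp add: pure_def)

lemma pure_zero: "pure {\<zero>\<^bsub>M\<^esub>}"
  by (auto simp: pure_def sub_zero_space)

lemma pure_carrier: "pure (carrier M)"
  by (auto simp: pure_def carrier_is_submodule)

text \<open>Substituting the hypothesis into itself j times gives W \<subseteq> V + \<pi>^j W, and
  \<pi>^s = 0 ends the process.\<close>

lemma nakayama:
  assumes V: "sub V" and W: "sub W"
    and span: "\<And>w. w \<in> W \<Longrightarrow> \<exists>v\<in>V. \<exists>w'\<in>W. w = v \<oplus>\<^bsub>M\<^esub> \<pi> \<odot>\<^bsub>M\<^esub> w'"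
  shows "W \<subseteq> V"
proof
  fix w assume w: "w \<in> W"
  have "\<exists>v\<in>V. \<exists>w'\<in>W. w = v \<oplus>\<^bsub>M\<^esub> (\<pi> [^] (j::nat)) \<odot>\<^bsub>M\<^esub> w'" for j
  proof (induction j)
    case 0
    then show ?case using w sub_zero[OF V] sub_carrier[OF W] by force
  next
    case (Suc j)
    then obtain v w1 where 1: "v \<in> V" "w1 \<in> W" "w = v \<oplus>\<^bsub>M\<^esub> (\<pi> [^] j) \<odot>\<^bsub>M\<^esub> w1" by blast
    obtain v' w' where 2: "v' \<in> V" "w' \<in> W" "w1 = v' \<oplus>\<^bsub>M\<^esub> \<pi> \<odot>\<^bsub>M\<^esub> w'"
      using span[OF 1(2)] by blast
    have c: "v \<in> carrier M" "v' \<in> carrier M" "w' \<in> carrier M"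
      using 1 2 sub_carrier V W by blast+
    have "w = (v \<oplus>\<^bsub>M\<^esub> (\<pi> [^] j) \<odot>\<^bsub>M\<^esub> v') \<oplus>\<^bsub>M\<^esub> (\<pi> [^] Suc j) \<odot>\<^bsub>M\<^esub> w'"
      using 1 2 c by (simp add: smult_r_distr smult_assoc1 M.a_assoc)
    moreover have "v \<oplus>\<^bsub>M\<^esub> (\<pi> [^] j) \<odot>\<^bsub>M\<^esub> v' \<in> V" using 1 2 V by (simp add: sub_add sub_smult)
    ultimately show ?case using 2 by blast
  qed
  from this[of s] show "w \<in> V"
    using unif_pow_eq sub_carrier V W by auto
qed

text \<open>If \<pi>^(j+1) x lies in V, purity gives v in V with \<pi> (v - \<pi>^j x) = 0. By
  \<open>socle\<close> the difference is a multiple of \<pi>^(s-1), hence of \<pi>^(j+1), so v is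
  \<pi>^j times a vector congruent to x modulo \<pi>M. The exponent has dropped by one.\<close>

lemma pure_pow_mem:
  assumes V: "pure V" and j: "j < s" and x: "x \<in> carrier M"
    and mem: "(\<pi> [^] j) \<odot>\<^bsub>M\<^esub> x \<in> V"
  shows "x \<in> nbhd V"
  using j x mem
proof (induction j arbitrary: x)
  case 0
  then show ?case using nbhd_upper[OF pure_sub[OF V]] by auto
next
  case (Suc j)
  note sV = pure_sub[OF V]
  have "\<pi> \<odot>\<^bsub>M\<^esub> ((\<pi> [^] j) \<odot>\<^bsub>M\<^esub> x) \<in> V"
    using Suc.prems unif_pow_Suc[of j] by (simp add: smult_assoc1[symmetric] del: nat_pow_Suc)
  then obtain v where v: "v \<in> V" "\<pi> \<odot>\<^bsub>M\<^esub> ((\<pi> [^] j) \<odot>\<^bsub>M\<^esub> x) = \<pi> \<odot>\<^bsub>M\<^esub> v"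
    using pureD[OF V, of "(\<pi> [^] j) \<odot>\<^bsub>M\<^esub> x"] Suc.prems by auto
  then have vc: "v \<in> carrier M" using sub_carrier sV by blast
  let ?t = "v \<ominus>\<^bsub>M\<^esub> (\<pi> [^] j) \<odot>\<^bsub>M\<^esub> x"
  have "\<pi> \<odot>\<^bsub>M\<^esub> ?t = \<zero>\<^bsub>M\<^esub>"
    using v(2)[symmetric] vc Suc.prems(2)
    by (simp add: a_minus_def smult_r_distr smult_r_minus M.r_neg)
  then obtain y where y: "y \<in> carrier M" "?t = (\<pi> [^] (s - 1)) \<odot>\<^bsub>M\<^esub> y"
    using socle[of ?t] vc Suc.prems(2) by auto
  define k where "k = s - 1 - Suc j"
  have k: "\<pi> [^] (s - 1) = \<pi> [^] j \<otimes> (\<pi> \<otimes> \<pi> [^] k)"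
  proof -
    have "s - 1 = j + Suc k" using Suc.prems(1) by (simp add: k_def)
    then show ?thesis
      using nat_pow_mult[of \<pi> j "Suc k"] unfolding unif_pow_Suc[symmetric] by simp
  qed
  have "v = (\<pi> [^] j) \<odot>\<^bsub>M\<^esub> x \<oplus>\<^bsub>M\<^esub> ?t"
    using vc Suc.prems(2) by (simp add: a_minus_def M.a_lcomm M.r_neg)
  also have "\<dots> = (\<pi> [^] j) \<odot>\<^bsub>M\<^esub> (x \<oplus>\<^bsub>M\<^esub> \<pi> \<odot>\<^bsub>M\<^esub> ((\<pi> [^] k) \<odot>\<^bsub>M\<^esub> y))"
    unfolding y(2) k using y(1) Suc.prems(2) by (simp add: smult_r_distr smult_assoc1)
  finally have "(\<pi> [^] j) \<odot>\<^bsub>M\<^esub> (x \<oplus>\<^bsub>M\<^esub> \<pi> \<odot>\<^bsub>M\<^esub> ((\<pi> [^] k) \<odot>\<^bsub>M\<^esub> y)) \<in> V" using v by simp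
  then have "x \<oplus>\<^bsub>M\<^esub> \<pi> \<odot>\<^bsub>M\<^esub> ((\<pi> [^] k) \<odot>\<^bsub>M\<^esub> y) \<in> nbhd V"
    using Suc.IH Suc.prems y by simp
  then show ?case
    using sub_cancel_right[OF sub_nbhd[OF sV]] nbhd_unif[OF sV, of "(\<pi> [^] k) \<odot>\<^bsub>M\<^esub> y"] y Suc.prems(2)
    by auto
qed

text \<open>Linear independence of x from V. A nonzero c has a multiple \<pi>^(s-1), and then
  \<open>pure_pow_mem\<close> would put x into V + \<pi>M.\<close>

lemma pure_smult_mem:
  assumes V: "pure V" and x: "x \<in> carrier M" "x \<notin> nbhd V"
    and c: "c \<in> carrier K" "c \<odot>\<^bsub>M\<^esub> x \<in> V"
  shows "c = \<zero>"
proof (rule ccontr)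
  assume "c \<noteq> \<zero>"
  then obtain e where e: "e \<in> carrier K" "e \<otimes> c = \<pi> [^] (s - 1)"
    using multiple_into_socle c by blast
  have "e \<odot>\<^bsub>M\<^esub> (c \<odot>\<^bsub>M\<^esub> x) \<in> V" using sub_smult pure_sub V c e by blast
  then have "(\<pi> [^] (s - 1)) \<odot>\<^bsub>M\<^esub> x \<in> V"
    using e c x by (simp add: smult_assoc1[symmetric])
  then show False using pure_pow_mem[OF V _ x(1), of "s - 1"] x(2) s_pos by simp
qed

text \<open>In \<pi>z = v + cx the scalar c cannot be a unit, since x would then lie in V + \<pi>M.
  So c = \<pi>b, and v = \<pi>(z - bx) falls under the purity of V.\<close>

lemma pure_ext:
  assumes V: "pure V" and x: "x \<in> carrier M" "x \<notin> nbhd V"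
  shows "pure (ext V x)"
  unfolding pure_def
proof (intro conjI ballI impI)
  note sV = pure_sub[OF V]
  show "sub (ext V x)" using sub_ext sV x by blast
  fix z assume z: "z \<in> carrier M" "\<pi> \<odot>\<^bsub>M\<^esub> z \<in> ext V x"
  then obtain v c where v: "v \<in> V" "c \<in> carrier K" "\<pi> \<odot>\<^bsub>M\<^esub> z = v \<oplus>\<^bsub>M\<^esub> c \<odot>\<^bsub>M\<^esub> x"
    by (auto simp: ext_iff)
  have vc: "v \<in> carrier M" using v sub_carrier sV by blast
  have "c \<notin> Units K"
  proof
    assume u: "c \<in> Units K"
    have "v \<oplus>\<^bsub>M\<^esub> c \<odot>\<^bsub>M\<^esub> x \<in> nbhd V" using nbhd_unif[OF sV z(1)] v by simp
    then have "c \<odot>\<^bsub>M\<^esub> x \<in> nbhd V"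
      using sub_cancel_left[OF sub_nbhd[OF sV]] nbhd_upper[OF sV] v x by auto
    then show False using sub_unit_smult[OF sub_nbhd[OF sV] u] x by blast
  qed
  then obtain b where b: "b \<in> carrier K" "c = \<pi> \<otimes> b" using unit_or_multiple v by blast
  have "v = \<pi> \<odot>\<^bsub>M\<^esub> (z \<ominus>\<^bsub>M\<^esub> b \<odot>\<^bsub>M\<^esub> x)"
    using v b z x vc
    by (simp add: a_minus_def smult_r_distr smult_r_minus M.a_assoc M.r_neg smult_assoc1[symmetric])
  then obtain v' where v': "v' \<in> V" "v = \<pi> \<odot>\<^bsub>M\<^esub> v'"
    using pureD[OF V, of "z \<ominus>\<^bsub>M\<^esub> b \<odot>\<^bsub>M\<^esub> x"] z x b v by auto
  have "\<pi> \<odot>\<^bsub>M\<^esub> z = \<pi> \<odot>\<^bsub>M\<^esub> (v' \<oplus>\<^bsub>M\<^esub> b \<odot>\<^bsub>M\<^esub> x)"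
    using v v' b x sub_carrier[OF sV] by (simp add: smult_r_distr smult_assoc1)
  then show "\<exists>v\<in>ext V x. \<pi> \<odot>\<^bsub>M\<^esub> z = \<pi> \<odot>\<^bsub>M\<^esub> v"
    using v' b by (metis ext_iff)
qed

lemma ext_unique:
  assumes V: "pure V" and x: "x \<in> carrier M" "x \<notin> nbhd V"
    and v: "v \<in> V" "v' \<in> V" "c \<in> carrier K" "c' \<in> carrier K"
    and eq: "v \<oplus>\<^bsub>M\<^esub> c \<odot>\<^bsub>M\<^esub> x = v' \<oplus>\<^bsub>M\<^esub> c' \<odot>\<^bsub>M\<^esub> x"
  shows "v = v' \<and> c = c'"
proof -
  note sV = pure_sub[OF V]
  have vc: "v \<in> carrier M" "v' \<in> carrier M" using v sub_carrier sV by blast+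
  have "(c \<ominus> c') \<odot>\<^bsub>M\<^esub> x = c \<odot>\<^bsub>M\<^esub> x \<ominus>\<^bsub>M\<^esub> c' \<odot>\<^bsub>M\<^esub> x"
    using v x by (simp add: a_minus_def smult_l_distr smult_l_minus)
  also have "\<dots> = \<ominus>\<^bsub>M\<^esub> v \<oplus>\<^bsub>M\<^esub> (v \<oplus>\<^bsub>M\<^esub> c \<odot>\<^bsub>M\<^esub> x) \<ominus>\<^bsub>M\<^esub> c' \<odot>\<^bsub>M\<^esub> x"
    using v x vc by (simp add: a_minus_def M.a_assoc M.r_neg1)
  also have "\<dots> = v' \<ominus>\<^bsub>M\<^esub> v"
    unfolding eq using v x vc by (simp add: a_minus_def M.a_ac M.r_neg)
  finally have "(c \<ominus> c') \<odot>\<^bsub>M\<^esub> x \<in> V" using sub_diff sV v by simp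
  then have "c \<ominus> c' = \<zero>" using pure_smult_mem[OF V x] v by simp
  then have "c = c'" using v by simp
  then show ?thesis using eq v x vc by auto
qed

lemma card_ext:
  assumes V: "pure V" and x: "x \<in> carrier M" "x \<notin> nbhd V"
  shows "card (ext V x) = card V * q"
proof -
  have "bij_betw (\<lambda>(v, c). v \<oplus>\<^bsub>M\<^esub> c \<odot>\<^bsub>M\<^esub> x) (V \<times> carrier K) (ext V x)"
    unfolding bij_betw_def
  proof
    show "inj_on (\<lambda>(v, c). v \<oplus>\<^bsub>M\<^esub> c \<odot>\<^bsub>M\<^esub> x) (V \<times> carrier K)"
      using ext_unique[OF V x] by (fastforce simp: inj_on_def)
    show "(\<lambda>(v, c). v \<oplus>\<^bsub>M\<^esub> c \<odot>\<^bsub>M\<^esub> x) ` (V \<times> carrier K) = ext V x"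
      by (auto simp: set_eq_iff ext_iff image_iff split_paired_Bex_Sigma)
  qed
  then show ?thesis
    by (simp add: bij_betw_same_card[symmetric] card_cartesian_product q_def)
qed

text \<open>If W lay in V + \<pi>M, purity would turn the summands from \<pi>M into elements of
  \<pi>W, and Nakayama would give W \<subseteq> V. Every growth of a free submodule inside a larger
  one starts from such an x.\<close>

lemma pure_step:
  assumes V: "sub V" and W: "pure W" and VW: "V \<subseteq> W" "V \<noteq> W"
  shows "\<exists>x\<in>W. x \<notin> nbhd V"
proof (rule ccontr)
  assume "\<not> ?thesis"
  then have n: "\<And>x. x \<in> W \<Longrightarrow> x \<in> nbhd V" by blast
  note sW = pure_sub[OF W]
  have "W \<subseteq> V"
  proof (rule nakayama[OF V sW])
    fix w assume w: "w \<in> W"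
    then obtain v z where v: "v \<in> V" "z \<in> carrier M" "w = v \<oplus>\<^bsub>M\<^esub> \<pi> \<odot>\<^bsub>M\<^esub> z"
      using n nbhd_iff by blast
    then have "\<pi> \<odot>\<^bsub>M\<^esub> z \<in> W" using sub_cancel_left[OF sW, of v] w VW by auto
    then show "\<exists>v\<in>V. \<exists>w'\<in>W. w = v \<oplus>\<^bsub>M\<^esub> \<pi> \<odot>\<^bsub>M\<^esub> w'" using pureD[OF W] v by metis
  qed
  then show False using VW by blast
qed

text \<open>Converse to the construction of pure extensions: for x in V + \<pi>M the whole of V + Kx
  would lie there, which \<open>pure_step\<close> excludes.\<close>

lemma ext_not_mem:
  assumes V: "pure V" and x: "x \<in> carrier M" and e: "pure (ext V x)" "ext V x \<noteq> V"
  shows "x \<notin> nbhd V"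
proof
  assume xn: "x \<in> nbhd V"
  have "ext V x \<subseteq> nbhd V"
    using ext_least[OF sub_nbhd nbhd_upper xn] pure_sub[OF V] by blast
  then show False
    using pure_step[OF pure_sub[OF V] e(1) ext_upper[OF pure_sub[OF V] x]] e(2) by blast
qed

section \<open>Free submodules and orthogonal complements\<close>

lemma extE:
  assumes "y \<in> ext V x"
  obtains v c where "v \<in> V" "c \<in> carrier K" "y = v \<oplus>\<^bsub>M\<^esub> c \<odot>\<^bsub>M\<^esub> x"
  using assms by (auto simp: ext_iff)

text \<open>Unlike the vertices of the complex, the ranks 0 and d are included: the zero module and
  M serve as ends of chains and are exchanged by duality.\<close>

definition Fr :: "nat \<Rightarrow> 'c set set" where
  "Fr k = {V. pure V \<and> card V = q ^ k}"

lemma FrI: "\<lbrakk>pure V; card V = q ^ k\<rbrakk> \<Longrightarrow> V \<in> Fr k"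
  by (simp add: Fr_def)

lemma Fr_pure: "V \<in> Fr k \<Longrightarrow> pure V"
  by (simp add: Fr_def)

lemma Fr_card: "V \<in> Fr k \<Longrightarrow> card V = q ^ k"
  by (simp add: Fr_def)

lemma Fr_sub: "V \<in> Fr k \<Longrightarrow> sub V"
  by (simp add: Fr_pure pure_sub)

lemma Fr_subset: "V \<in> Fr k \<Longrightarrow> V \<subseteq> carrier M"
  by (simp add: Fr_sub sub_subset)

lemma Fr_rank_unique: "\<lbrakk>V \<in> Fr j; V \<in> Fr k\<rbrakk> \<Longrightarrow> j = k"
  using q_gt_1 by (simp add: Fr_def)

lemma zero_in_Fr: "{\<zero>\<^bsub>M\<^esub>} \<in> Fr 0"
  by (simp add: Fr_def pure_zero)

lemma carrier_in_Fr: "carrier M \<in> Fr d"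
  by (simp add: Fr_def pure_carrier card_space q_def)

lemma Fr_rank_mono:
  assumes "V \<in> Fr j" "W \<in> Fr k" "V \<subseteq> W"
  shows "j \<le> k"
proof -
  have "q ^ j \<le> q ^ k" using assms card_mono[OF sub_finite[OF Fr_sub[OF assms(2)]] assms(3)] by (simp add: Fr_def)
  then show ?thesis using q_gt_1 by simp
qed

lemma Fr_eq: "\<lbrakk>V \<in> Fr k; W \<in> Fr k; V \<subseteq> W\<rbrakk> \<Longrightarrow> V = W"
  using card_subset_eq[OF sub_finite[OF Fr_sub], of W k V] by (simp add: Fr_card)

lemma Fr_zero: "V \<in> Fr 0 \<Longrightarrow> V = {\<zero>\<^bsub>M\<^esub>}"
  using Fr_eq[OF zero_in_Fr, of V] sub_zero[OF Fr_sub] by auto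

lemma Fr_full: "V \<in> Fr d \<Longrightarrow> V = carrier M"
  using Fr_eq[OF _ carrier_in_Fr] Fr_subset by blast

lemma Fr_le_dim: "V \<in> Fr k \<Longrightarrow> k \<le> d"
  using Fr_rank_mono[OF _ carrier_in_Fr] Fr_subset by blast

lemma Fr_ext: "\<lbrakk>V \<in> Fr k; x \<in> carrier M; x \<notin> nbhd V\<rbrakk> \<Longrightarrow> ext V x \<in> Fr (Suc k)"
  by (simp add: Fr_def pure_ext card_ext)

lemma nbhd_proper:
  assumes "V \<in> Fr k" "k < d"
  shows "nbhd V \<noteq> carrier M"
proof -
  have "V \<noteq> carrier M" using assms Fr_rank_unique carrier_in_Fr by blast
  then obtain x where "x \<in> carrier M" "x \<notin> nbhd V"
    using pure_step[OF Fr_sub pure_carrier Fr_subset] assms by metis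
  then show ?thesis by blast
qed

lemma Fr_grow:
  assumes V: "V \<in> Fr k" and W: "pure W" and VW: "V \<subseteq> W" "V \<noteq> W"
  shows "\<exists>x\<in>W. x \<notin> nbhd V \<and> ext V x \<in> Fr (Suc k) \<and> ext V x \<subseteq> W"
proof -
  obtain x where x: "x \<in> W" "x \<notin> nbhd V"
    using pure_step[OF Fr_sub[OF V] W VW] by blast
  then have "x \<in> carrier M" using sub_carrier pure_sub W by blast
  then show ?thesis using x Fr_ext[OF V] ext_least[OF pure_sub[OF W] VW(1) x(1)] by blast
qed

text \<open>Read upwards, this is the extension of a basis of V to one of W.
  \<open>pure_step\<close> supplies the next vector, and the gap in cardinality decreases.\<close>

lemma pure_induct_down [consumes 3, case_names top step]:
  assumes V: "pure V" and W: "pure W" and VW: "V \<subseteq> W" and top: "P W"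
    and step: "\<And>V x. \<lbrakk>pure V; V \<subseteq> W; x \<in> W; x \<notin> nbhd V; P (ext V x)\<rbrakk> \<Longrightarrow> P V"
  shows "P V"
  using V VW
proof (induction "card W - card V" arbitrary: V rule: less_induct)
  case less
  show ?case
  proof (cases "V = W")
    case False
    obtain x where x: "x \<in> W" "x \<notin> nbhd V"
      using pure_step[OF pure_sub W less.prems(2) False] less.prems by blast
    then have xc: "x \<in> carrier M" using sub_carrier pure_sub W by blast
    have sub: "ext V x \<subseteq> W" using ext_least[OF pure_sub[OF W] less.prems(2) x(1)] .
    have p: "pure (ext V x)" using pure_ext less.prems x xc by blast
    have "x \<notin> V" using x nbhd_upper pure_sub less.prems by blast
    then have "V \<subset> ext V x"
      using ext_upper ext_self xc pure_sub less.prems by blast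
    moreover have "finite W" using sub_finite pure_sub W by blast
    ultimately have "card V < card (ext V x)" "card (ext V x) \<le> card W"
      using sub by (auto intro!: psubset_card_mono card_mono intro: finite_subset)
    then have "P (ext V x)" using less.hyps[of "ext V x"] p sub by simp
    then show ?thesis using step[OF less.prems x] by blast
  qed (use top in simp)
qed

lemma pure_in_Fr:
  assumes W: "pure W"
  shows "\<exists>k. W \<in> Fr k"
proof -
  \<comment> \<open>The induction descends from W, but the information flows upwards: a rank for V
    is passed on to W. The zero module starts it.\<close>
  have "(\<exists>j. V \<in> Fr j) \<longrightarrow> (\<exists>k. W \<in> Fr k)" if "pure V" "V \<subseteq> W" for V
    using that(1) W that(2)
  proof (induction V rule: pure_induct_down)
    case (step V x)
    then show ?case using Fr_ext sub_carrier pure_sub W by metis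
  qed blast
  moreover have "{\<zero>\<^bsub>M\<^esub>} \<subseteq> W" using sub_zero pure_sub W by auto
  ultimately show ?thesis using zero_in_Fr pure_zero by blast
qed

lemma Fr_between:
  assumes V: "V \<in> Fr j" and W: "W \<in> Fr k" and VW: "V \<subseteq> W" and i: "j \<le> i" "i \<le> k"
  shows "\<exists>Y\<in>Fr i. V \<subseteq> Y \<and> Y \<subseteq> W"
  using i
proof (induction i rule: nat_induct_at_least)
  case base
  then show ?case using V VW by blast
next
  case (Suc i)
  then obtain Y where Y: "Y \<in> Fr i" "V \<subseteq> Y" "Y \<subseteq> W" by auto
  have "Y \<noteq> W" using Y W Fr_rank_unique Suc.prems by (metis Suc_n_not_le_n)
  then obtain x where "ext Y x \<in> Fr (Suc i)" "ext Y x \<subseteq> W" "x \<in> W"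
    using Fr_grow[OF Y(1) Fr_pure[OF W] Y(3)] by blast
  then show ?case
    using ext_upper[OF Fr_sub[OF Y(1)], of x] Y Fr_subset[OF W] by blast
qed

lemma Fr_below: "\<lbrakk>W \<in> Fr k; i \<le> k\<rbrakk> \<Longrightarrow> \<exists>Y\<in>Fr i. Y \<subseteq> W"
  using Fr_between[OF zero_in_Fr, of W k i] sub_zero[OF Fr_sub] by auto

lemma Fr_above: "\<lbrakk>V \<in> Fr k; k \<le> i; i \<le> d\<rbrakk> \<Longrightarrow> \<exists>Y\<in>Fr i. V \<subseteq> Y"
  using Fr_between[OF _ carrier_in_Fr, of V k i] Fr_subset[of V k] by blast

lemma Fr_Suc_ext:
  assumes V: "V \<in> Fr k" and W: "W \<in> Fr (Suc k)" and VW: "V \<subseteq> W"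
  shows "\<exists>x\<in>W. x \<notin> nbhd V \<and> W = ext V x"
proof -
  have "V \<noteq> W" using V W Fr_rank_unique by (metis n_not_Suc_n)
  then obtain x where x: "x \<in> W" "x \<notin> nbhd V" "ext V x \<in> Fr (Suc k)" "ext V x \<subseteq> W"
    using Fr_grow[OF V Fr_pure[OF W] VW] by blast
  then show ?thesis using Fr_eq W by blast
qed

text \<open>For W = V the complement is U. When a vector x is dropped from W + Kx, it is added to
  the complement instead; independence of x from W keeps the intersection equal to U.\<close>

lemma complement_exists:
  assumes W: "pure W" and V: "pure V" and WV: "W \<subseteq> V" and U: "sub U" "U \<subseteq> W"
  shows "\<exists>W'. sub W' \<and> U \<subseteq> W' \<and> W \<inter> W' = U \<and> W \<boxplus> W' = V"
  using W V WV U(2)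
proof (induction W rule: pure_induct_down)
  case top
  have "V \<boxplus> U = V"
    using top vsum_least[OF pure_sub[OF V], of V U] vsum_upper1[OF pure_sub[OF V] U(1)] by blast
  then show ?case using U top by blast
next
  case (step W x)
  have sW: "sub W" and sV: "sub V" using step V pure_sub by blast+
  have x: "x \<in> carrier M" using step sV sub_carrier by blast
  have We: "W \<subseteq> ext W x" using ext_upper sW x by blast
  obtain W' where W': "sub W'" "U \<subseteq> W'" "ext W x \<inter> W' = U" "ext W x \<boxplus> W' = V"
    using step We by blast
  have se: "sub (ext W' x)" using W' x sub_ext by blast
  have "W \<inter> ext W' x = U"
  proof
    show "U \<subseteq> W \<inter> ext W' x"
      using W'(2) ext_upper[OF W'(1) x] step.prems by blast
    show "W \<inter> ext W' x \<subseteq> U"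
    proof
      fix w assume w: "w \<in> W \<inter> ext W' x"
      then obtain w' c where c: "w' \<in> W'" "c \<in> carrier K" "w = w' \<oplus>\<^bsub>M\<^esub> c \<odot>\<^bsub>M\<^esub> x"
        by (blast elim: extE)
      have w'c: "w' \<in> carrier M" using c W' sub_carrier by blast
      have "w' \<in> ext W x"
        using sub_cancel_right[of "ext W x" w' "c \<odot>\<^bsub>M\<^esub> x"] w c w'c We sub_ext[OF sW x]
          sub_smult[OF sub_ext[OF sW x] c(2) ext_self[OF sW x]] by blast
      then have w'U: "w' \<in> U" using W' c by blast
      then have "c \<odot>\<^bsub>M\<^esub> x \<in> W"
        using sub_cancel_left[OF sW, of w' "c \<odot>\<^bsub>M\<^esub> x"] w c x step.prems by blast
      then have "c = \<zero>" using pure_smult_mem[OF step.hyps(1) x step.hyps(4) c(2)] by blast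
      then show "w \<in> U" using c w'U x w'c by simp
    qed
  qed
  moreover have "W \<boxplus> ext W' x = V"
  proof
    have "W' \<subseteq> V" using W' vsum_upper2[of "ext W x" W'] sub_ext[OF sW x] by blast
    then show "W \<boxplus> ext W' x \<subseteq> V" using step.hyps sV by (intro vsum_least ext_least)
    have "W \<subseteq> W \<boxplus> ext W' x" "ext W' x \<subseteq> W \<boxplus> ext W' x"
      using vsum_upper1 vsum_upper2 sW se by blast+
    moreover have "W' \<subseteq> ext W' x" "x \<in> ext W' x" using ext_upper ext_self W' x by blast+
    ultimately have "ext W x \<boxplus> W' \<subseteq> W \<boxplus> ext W' x"
      by (intro vsum_least ext_least sub_vsum sW se) auto
    then show "V \<subseteq> W \<boxplus> ext W' x" using W' by simp
  qed
  ultimately show ?case using se W'(2) ext_upper[OF W'(1) x] by blast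
qed

text \<open>A vector \<pi>z in W is \<pi>w + \<pi>w' with w in W and w' in W'. Then \<pi>w' lies in
  W \<inter> W' = U, where purity replaces w' by an element of U \<subseteq> W. Together with
  \<open>complement_exists\<close> this characterises freeness within the lattice of an
  interval.\<close>

lemma complemented_pure:
  assumes U: "pure U" and V: "pure V" and W: "sub W" and W': "sub W'"
    and int: "W \<inter> W' = U" and sum: "W \<boxplus> W' = V"
  shows "pure W"
  unfolding pure_def
proof (intro conjI W ballI impI)
  fix z assume z: "z \<in> carrier M" "\<pi> \<odot>\<^bsub>M\<^esub> z \<in> W"
  have "\<pi> \<odot>\<^bsub>M\<^esub> z \<in> V" using z sum vsum_upper1[OF W W'] by blast
  then obtain w w' where w: "w \<in> W" "w' \<in> W'" "\<pi> \<odot>\<^bsub>M\<^esub> z = \<pi> \<odot>\<^bsub>M\<^esub> (w \<oplus>\<^bsub>M\<^esub> w')"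
    using pureD[OF V z(1)] sum by (auto simp: vsum_iff)
  have c: "w \<in> carrier M" "w' \<in> carrier M" using w W W' sub_carrier by blast+
  have eq: "\<pi> \<odot>\<^bsub>M\<^esub> z = \<pi> \<odot>\<^bsub>M\<^esub> w \<oplus>\<^bsub>M\<^esub> \<pi> \<odot>\<^bsub>M\<^esub> w'" using w c by (simp add: smult_r_distr)
  then have "\<pi> \<odot>\<^bsub>M\<^esub> w' \<in> W"
    using sub_cancel_left[OF W, of "\<pi> \<odot>\<^bsub>M\<^esub> w" "\<pi> \<odot>\<^bsub>M\<^esub> w'"] z w c sub_smult[OF W] by auto
  then have "\<pi> \<odot>\<^bsub>M\<^esub> w' \<in> U" using int w W' sub_smult by blast
  then obtain u where u: "u \<in> U" "\<pi> \<odot>\<^bsub>M\<^esub> w' = \<pi> \<odot>\<^bsub>M\<^esub> u" using pureD[OF U c(2)] by blast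
  have "u \<in> W" using u int by blast
  moreover from this have "\<pi> \<odot>\<^bsub>M\<^esub> z = \<pi> \<odot>\<^bsub>M\<^esub> (w \<oplus>\<^bsub>M\<^esub> u)"
    using eq u c sub_carrier[OF W] by (simp add: smult_r_distr)
  ultimately show "\<exists>v\<in>W. \<pi> \<odot>\<^bsub>M\<^esub> z = \<pi> \<odot>\<^bsub>M\<^esub> v" using w sub_add[OF W] by blast
qed

text \<open>Take U0 of rank m - 1 inside U. A vector x of W outside U0 + \<pi>M lies in the free
  submodule U0 + Kx of W; any other vector of W is a difference of two such vectors.\<close>

lemma spanned_by_Fr:
  assumes U: "U \<in> Fr m" "0 < m" "U \<subseteq> W" and W: "sub W" and Y: "sub Y"
    and below: "\<And>U'. \<lbrakk>U' \<in> Fr m; U' \<subseteq> W\<rbrakk> \<Longrightarrow> U' \<subseteq> Y"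
  shows "W \<subseteq> Y"
proof
  fix w assume w: "w \<in> W"
  then have wc: "w \<in> carrier M" using W sub_carrier by blast
  obtain k where m: "m = Suc k" using U by (cases m) auto
  obtain U0 where U0: "U0 \<in> Fr k" "U0 \<subseteq> U" using Fr_below U m by (metis le_SucI le_refl)
  obtain u where u: "u \<in> U" "u \<notin> nbhd U0" using Fr_Suc_ext[OF U0(1) _ U0(2)] U m by blast
  have uc: "u \<in> carrier M" using u U Fr_subset by blast
  have *: "x \<in> Y" if "x \<in> W" "x \<notin> nbhd U0" for x
  proof -
    have xc: "x \<in> carrier M" using that W sub_carrier by blast
    have "ext U0 x \<in> Fr m" using Fr_ext[OF U0(1) xc that(2)] m by simp
    moreover have "ext U0 x \<subseteq> W" using ext_least[OF W _ that(1)] U0 U by blast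
    ultimately show ?thesis using below ext_self[OF Fr_sub[OF U0(1)] xc] by blast
  qed
  show "w \<in> Y"
  proof (cases "w \<in> nbhd U0")
    case True
    have "w \<oplus>\<^bsub>M\<^esub> u \<notin> nbhd U0"
      using sub_cancel_left[OF sub_nbhd[OF Fr_sub[OF U0(1)]] _ True uc] u by blast
    then have "w \<oplus>\<^bsub>M\<^esub> u \<in> Y" using * sub_add[OF W w] u U by blast
    moreover have "u \<in> Y" using * u U by blast
    ultimately show ?thesis using sub_cancel_right[OF Y] wc by blast
  qed (use * w in blast)
qed

section \<open>Orthogonal complements and biduality\<close>

definition perp where
  "perp W = {x \<in> carrier M. \<forall>w\<in>W. form x w = \<zero>}"

lemma form_add_right: "\<lbrakk>x \<in> carrier M; y \<in> carrier M; z \<in> carrier M\<rbrakk>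
      \<Longrightarrow> form x (y \<oplus>\<^bsub>M\<^esub> z) = form x y \<oplus> form x z"
  using form_add[of y z x] form_sym by simp

lemma form_smult_right: "\<lbrakk>a \<in> carrier K; x \<in> carrier M; z \<in> carrier M\<rbrakk>
      \<Longrightarrow> form x (a \<odot>\<^bsub>M\<^esub> z) = a \<otimes> form x z"
  using form_smult[of a z x] form_sym by simp

lemma form_zero: "x \<in> carrier M \<Longrightarrow> form \<zero>\<^bsub>M\<^esub> x = \<zero>"
  using form_smult[of \<zero> "\<zero>\<^bsub>M\<^esub>" x] by simp

lemma form_zero_right: "x \<in> carrier M \<Longrightarrow> form x \<zero>\<^bsub>M\<^esub> = \<zero>"
  using form_zero form_sym by simp

lemma form_neg: "\<lbrakk>x \<in> carrier M; y \<in> carrier M\<rbrakk> \<Longrightarrow> form (\<ominus>\<^bsub>M\<^esub> x) y = \<ominus> form x y"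
  using form_smult[of "\<ominus> \<one>" x y] smult_l_minus[of \<one> x] by (simp add: R.l_minus)

lemma form_diff: "\<lbrakk>x \<in> carrier M; y \<in> carrier M; z \<in> carrier M\<rbrakk>
    \<Longrightarrow> form (x \<ominus>\<^bsub>M\<^esub> y) z = form x z \<ominus> form y z"
  by (simp add: a_minus_def form_add form_neg)

lemma sub_perp:
  assumes "W \<subseteq> carrier M"
  shows "sub (perp W)"
  using assms
  by (intro submoduleI)
     (auto simp: perp_def form_zero form_neg form_add form_smult subset_iff)

lemma perp_anti: "V \<subseteq> W \<Longrightarrow> perp W \<subseteq> perp V"
  by (auto simp: perp_def)

lemma perp_perp_upper: "W \<subseteq> carrier M \<Longrightarrow> W \<subseteq> perp (perp W)"
  by (auto simp: perp_def form_sym subset_iff)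

lemma perp_zero: "perp {\<zero>\<^bsub>M\<^esub>} = carrier M"
  by (auto simp: perp_def form_zero_right)

lemma perp_carrier: "perp (carrier M) = {\<zero>\<^bsub>M\<^esub>}"
  using form_nondeg by (auto simp: perp_def form_zero)

text \<open>Here the added vector is arbitrary, so that all submodules are reached and not only the
  pure ones. Biduality is wanted in this generality, for meets and sums.\<close>

lemma sub_induct [consumes 1, case_names zero ext]:
  assumes W: "sub W" and zero: "P {\<zero>\<^bsub>M\<^esub>}"
    and ext: "\<And>V x. \<lbrakk>sub V; x \<in> carrier M; P V\<rbrakk> \<Longrightarrow> P (ext V x)"
  shows "P W"
proof -
  have "P W" if "sub V" "V \<subseteq> W" "P V" for V
    using that
  proof (induction "card W - card V" arbitrary: V rule: less_induct)
    case less
    show ?case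
    proof (cases "V = W")
      case False
      then obtain x where x: "x \<in> W" "x \<notin> V" using less.prems by blast
      then have xc: "x \<in> carrier M" using W sub_carrier by blast
      have "V \<subset> ext V x" using ext_upper ext_self less.prems x xc by blast
      moreover have "ext V x \<subseteq> W" using ext_least[OF W] less.prems x by blast
      moreover have "finite W" using W sub_finite by blast
      ultimately have "card V < card (ext V x)" "card (ext V x) \<le> card W"
        by (auto intro!: psubset_card_mono card_mono intro: finite_subset)
      then show ?thesis
        using less.hyps[of "ext V x"] \<open>ext V x \<subseteq> W\<close> sub_ext less.prems xc ext by simp
    qed (use less in simp)
  qed
  then show ?thesis using sub_zero_space zero sub_zero[OF W] by blast
qed

text \<open>The values of \<open>form x\<close> on N form an ideal of a chain ring, which is
  generated by a value of least valuation.\<close>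

lemma form_image_generator:
  assumes N: "sub N" and x: "x \<in> carrier M"
  shows "\<exists>y0\<in>N. \<forall>y\<in>N. \<exists>a\<in>carrier K. form x y = a \<otimes> form x y0"
proof (cases "\<forall>y\<in>N. form x y = \<zero>")
  case True
  then show ?thesis
    by (intro bexI[of _ "\<zero>\<^bsub>M\<^esub>"] ballI bexI[of _ \<zero>]) (auto simp: sub_zero[OF N])
next
  case False
  define I where "I = {i. \<exists>y\<in>N. \<exists>u\<in>Units K. form x y = u \<otimes> \<pi> [^] (i::nat)}"
  have fc: "form x y \<in> carrier K" if "y \<in> N" for y using that x N sub_carrier by blast
  obtain y where y: "y \<in> N" "form x y \<noteq> \<zero>" using False by blast
  then have "\<exists>i. i \<in> I" using unit_times_power[OF fc[OF y(1)] y(2)] unfolding I_def by blast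
  then have "(LEAST i. i \<in> I) \<in> I" by (meson LeastI)
  then obtain i y0 u where i: "i = (LEAST i. i \<in> I)" "y0 \<in> N" "u \<in> Units K" "form x y0 = u \<otimes> \<pi> [^] i"
    unfolding I_def by blast
  have "\<exists>a\<in>carrier K. form x y = a \<otimes> form x y0" if y: "y \<in> N" for y
  proof (cases "form x y = \<zero>")
    case True
    then show ?thesis using fc[OF i(2)] by (intro bexI[of _ \<zero>]) auto
  next
    case False
    then obtain v j where v: "v \<in> Units K" "form x y = v \<otimes> \<pi> [^] (j::nat)"
      using unit_times_power[OF fc[OF y]] by blast
    then have "j \<in> I" using y unfolding I_def by blast
    then have "i \<le> j" unfolding i by (rule Least_le)
    then have p: "\<pi> [^] j = \<pi> [^] (j - i) \<otimes> \<pi> [^] i" by (simp add: nat_pow_mult)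
    have uc: "u \<in> carrier K" "v \<in> carrier K" "inv u \<in> carrier K" using i v by auto
    have "(v \<otimes> \<pi> [^] (j - i) \<otimes> inv u) \<otimes> (u \<otimes> \<pi> [^] i)
        = v \<otimes> \<pi> [^] (j - i) \<otimes> (inv u \<otimes> u) \<otimes> \<pi> [^] i"
      using uc by (simp add: R.m_assoc del: Units_l_inv)
    also have "\<dots> = form x y" unfolding v(2) p using i uc by (simp add: R.m_assoc)
    finally show ?thesis unfolding i(4) using uc
      by (intro bexI[of _ "v \<otimes> \<pi> [^] (j - i) \<otimes> inv u"]) auto
  qed
  then show ?thesis using i by blast
qed

text \<open>Let N be the complement of V. If z is orthogonal to the complement of V + Kx, then on N
  the functional of z vanishes wherever that of x does. This makes it a multiple c of the latter, so
  z - cx is orthogonal to N and lies in V by induction.\<close>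

lemma perp_perp:
  assumes "sub W"
  shows "perp (perp W) = W"
  using assms
proof (induction W rule: sub_induct)
  case zero
  then show ?case by (simp add: perp_zero perp_carrier)
next
  case (ext V x)
  note sV = ext(1) and x = ext(2) and IH = ext(3)
  define N where "N = perp V"
  have Vc: "V \<subseteq> carrier M" using sub_subset sV by blast
  have sN: "sub N" unfolding N_def using sub_perp Vc by blast
  have se: "sub (ext V x)" using sub_ext sV x by blast
  have N': "y \<in> perp (ext V x)" if y: "y \<in> N" "form x y = \<zero>" for y
  proof -
    have yc: "y \<in> carrier M" using y sN sub_carrier by blast
    have "form y w = \<zero>" if w: "w \<in> ext V x" for w
    proof -
      obtain v c where "v \<in> V" "c \<in> carrier K" "w = v \<oplus>\<^bsub>M\<^esub> c \<odot>\<^bsub>M\<^esub> x" using w by (rule extE)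
      moreover from this have "form y v = \<zero>" "v \<in> carrier M"
        using y(1) Vc unfolding N_def perp_def by blast+
      ultimately show ?thesis
        using x yc y(2) form_sym[OF x yc] by (simp add: form_add_right form_smult_right)
    qed
    then show ?thesis using yc by (simp add: perp_def)
  qed
  show ?case
  proof
    show "ext V x \<subseteq> perp (perp (ext V x))" using perp_perp_upper sub_subset se by blast
    show "perp (perp (ext V x)) \<subseteq> ext V x"
    proof
      fix z assume z: "z \<in> perp (perp (ext V x))"
      have zc: "z \<in> carrier M" using z by (simp add: perp_def)
      have z0: "form z y = \<zero>" if "y \<in> N" "form x y = \<zero>" for y
        using z N'[OF that] by (simp add: perp_def)
      obtain y0 where y0: "y0 \<in> N" "\<forall>y\<in>N. \<exists>a\<in>carrier K. form x y = a \<otimes> form x y0"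
        using form_image_generator[OF sN x] by blast
      have y0c: "y0 \<in> carrier M" using y0 sN sub_carrier by blast
      \<comment> \<open>The scalar c is found at the generator y0. If \<open>form x y0\<close> has
        valuation i, then \<pi>^(s-i) y0 is orthogonal to x, hence to z; so \<pi>^(s-i) kills
        \<open>form z y0\<close>, which is therefore divisible by \<pi>^i.\<close>
      have "\<exists>c\<in>carrier K. form z y0 = c \<otimes> form x y0"
      proof (cases "form x y0 = \<zero>")
        case True
        then show ?thesis using z0[OF y0(1)] by (intro bexI[of _ \<zero>]) auto
      next
        case False
        then obtain u i where u: "u \<in> Units K" "i < s" "form x y0 = u \<otimes> \<pi> [^] i"
          using unit_times_power[OF form_closed[OF x y0c]] by blast
        have uc: "u \<in> carrier K" "inv u \<in> carrier K" using u by auto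
        have "form x ((\<pi> [^] (s - i)) \<odot>\<^bsub>M\<^esub> y0) = u \<otimes> (\<pi> [^] (s - i) \<otimes> \<pi> [^] i)"
          using x y0c u uc by (simp add: form_smult_right R.m_lcomm)
        also have "\<dots> = \<zero>" using u uc by (simp add: nat_pow_mult unif_pow_eq)
        finally have "form z ((\<pi> [^] (s - i)) \<odot>\<^bsub>M\<^esub> y0) = \<zero>"
          using z0 sub_smult[OF sN _ y0(1)] by simp
        then have "\<pi> [^] (s - i) \<otimes> form z y0 = \<zero>" using zc y0c by (simp add: form_smult_right)
        then obtain b where b: "b \<in> carrier K" "form z y0 = \<pi> [^] i \<otimes> b"
          using unif_pow_mult_zero[of "form z y0" "s - i"] zc y0c u by auto
        have "(b \<otimes> inv u) \<otimes> (u \<otimes> \<pi> [^] i) = b \<otimes> (inv u \<otimes> u) \<otimes> \<pi> [^] i"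
          using b uc by (simp add: R.m_assoc del: Units_l_inv)
        also have "\<dots> = form z y0" using b u by (simp add: R.m_comm)
        finally show ?thesis unfolding u(3) using b uc by (intro bexI[of _ "b \<otimes> inv u"]) auto
      qed
      then obtain c where c: "c \<in> carrier K" "form z y0 = c \<otimes> form x y0" by blast
      \<comment> \<open>With \<open>form x y\<close> = a \<open>form x y0\<close>, the vector y - a
        y0 is orthogonal to x and hence to z, which transfers c from y0 to all of N.\<close>
      have "form (z \<ominus>\<^bsub>M\<^esub> c \<odot>\<^bsub>M\<^esub> x) y = \<zero>" if y: "y \<in> N" for y
      proof -
        have yc: "y \<in> carrier M" using y sN sub_carrier by blast
        obtain a where a: "a \<in> carrier K" "form x y = a \<otimes> form x y0" using y0 y by blast
        have fc: "form x y0 \<in> carrier K" using x y0c by blast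
        have "(\<ominus> a) \<odot>\<^bsub>M\<^esub> y0 \<oplus>\<^bsub>M\<^esub> y \<in> N" using sub_add[OF sN] sub_smult[OF sN] y y0 a by simp
        moreover have "form x ((\<ominus> a) \<odot>\<^bsub>M\<^esub> y0 \<oplus>\<^bsub>M\<^esub> y) = \<zero>"
          using x yc y0c a fc by (simp add: form_add_right form_smult_right R.l_minus R.l_neg)
        ultimately have "form z ((\<ominus> a) \<odot>\<^bsub>M\<^esub> y0 \<oplus>\<^bsub>M\<^esub> y) = \<zero>" using z0 by blast
        then have "\<ominus> (a \<otimes> form z y0) \<oplus> form z y = \<zero>"
          using zc yc y0c a by (simp add: form_add_right form_smult_right R.l_minus)
        then have "form z y = a \<otimes> form z y0"
          using zc yc y0c a by (metis R.add.inv_solve_left R.m_closed R.r_zero form_closed R.zero_closed)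
        moreover have "form (z \<ominus>\<^bsub>M\<^esub> c \<odot>\<^bsub>M\<^esub> x) y = form z y \<ominus> c \<otimes> form x y"
          using zc yc x c by (simp add: form_diff form_smult)
        ultimately show ?thesis
          using c a fc by (simp add: R.m_lcomm R.r_neg a_minus_def)
      qed
      then have "z \<ominus>\<^bsub>M\<^esub> c \<odot>\<^bsub>M\<^esub> x \<in> perp N" using zc x c by (simp add: perp_def)
      then have "z \<ominus>\<^bsub>M\<^esub> c \<odot>\<^bsub>M\<^esub> x \<in> V" using IH N_def by simp
      moreover have "z = (z \<ominus>\<^bsub>M\<^esub> c \<odot>\<^bsub>M\<^esub> x) \<oplus>\<^bsub>M\<^esub> c \<odot>\<^bsub>M\<^esub> x"
        using zc x c by (simp add: a_minus_def M.a_assoc M.l_neg)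
      ultimately show "z \<in> ext V x" unfolding ext_iff using c by blast
    qed
  qed
qed

lemma perp_subset_iff: "\<lbrakk>sub V; sub W\<rbrakk> \<Longrightarrow> perp V \<subseteq> perp W \<longleftrightarrow> W \<subseteq> V"
  by (metis perp_anti perp_perp)

lemma perp_sub: "sub W \<Longrightarrow> sub (perp W)"
  by (simp add: sub_perp sub_subset)

lemma perp_vsum:
  assumes "sub V" "sub W"
  shows "perp (V \<boxplus> W) = perp V \<inter> perp W"
proof
  show "perp (V \<boxplus> W) \<subseteq> perp V \<inter> perp W"
    using perp_anti[OF vsum_upper1[OF assms]] perp_anti[OF vsum_upper2[OF assms]] by blast
  show "perp V \<inter> perp W \<subseteq> perp (V \<boxplus> W)"
    using sub_carrier[OF assms(1)] sub_carrier[OF assms(2)]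
    by (auto simp: perp_def vsum_def form_add_right)
qed

lemma perp_Int:
  assumes "sub V" "sub W"
  shows "perp (V \<inter> W) = perp V \<boxplus> perp W"
proof -
  have "V \<inter> W = perp (perp V \<boxplus> perp W)"
    using assms by (simp add: perp_vsum perp_sub perp_perp)
  then show ?thesis using assms by (simp add: perp_perp perp_sub sub_vsum)
qed

text \<open>Complementation exchanges sums and intersections, so a complement of W yields one of
  \<open>perp W\<close>, and complemented submodules are pure.\<close>

lemma perp_pure:
  assumes "pure W"
  shows "pure (perp W)"
proof -
  have sW: "sub W" using assms pure_sub by blast
  obtain W' where W': "sub W'" "W \<inter> W' = {\<zero>\<^bsub>M\<^esub>}" "W \<boxplus> W' = carrier M"
    using complement_exists[OF assms pure_carrier sub_subset[OF sW] sub_zero_space] sub_zero[OF sW] by auto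
  have "perp W \<boxplus> perp W' = carrier M" using W' perp_Int[OF sW W'(1)] perp_zero by simp
  moreover have "perp W \<inter> perp W' = {\<zero>\<^bsub>M\<^esub>}" using W' perp_vsum[OF sW W'(1)] perp_carrier by simp
  ultimately show ?thesis
    using complemented_pure[OF pure_zero pure_carrier] perp_sub sW W' by blast
qed

text \<open>Dropping a basis vector lowers the rank of V by one and raises that of
  \<open>perp V\<close> by at least one, since \<open>perp\<close> is injective. So the sum of the
  ranks cannot fall on the way down from M, where it is d.\<close>

lemma perp_rank_add:
  assumes V: "V \<in> Fr k" and P: "perp V \<in> Fr l"
  shows "k + l \<ge> d"
proof -
  have "\<forall>k l. V \<in> Fr k \<longrightarrow> perp V \<in> Fr l \<longrightarrow> k + l \<ge> d"
    using Fr_pure[OF V] pure_carrier Fr_subset[OF V]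
  proof (induction V rule: pure_induct_down)
    case top
    then show ?case using carrier_in_Fr Fr_rank_unique by fastforce
  next
    case (step V x)
    show ?case
    proof (intro allI impI)
      fix k l assume k: "V \<in> Fr k" and l: "perp V \<in> Fr l"
      have e: "ext V x \<in> Fr (Suc k)" using Fr_ext k step by blast
      obtain l' where l': "perp (ext V x) \<in> Fr l'" using pure_in_Fr perp_pure Fr_pure e by blast
      have "perp (ext V x) \<subseteq> perp V" using perp_anti ext_upper pure_sub step by blast
      moreover have "perp (ext V x) \<noteq> perp V"
        using perp_perp Fr_sub e k Fr_rank_unique by (metis n_not_Suc_n)
      ultimately have "l' < l" using Fr_rank_mono l l' Fr_eq by (metis le_neq_implies_less)
      moreover have "Suc k + l' \<ge> d" using step e l' by blast
      ultimately show "k + l \<ge> d" by simp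
    qed
  qed
  then show ?thesis using V P by blast
qed

text \<open>Continuing the descent from V to the zero module, the sum of the two ranks still cannot
  fall, and there it is d again. This bounds it from above at V.\<close>

lemma perp_Fr:
  assumes V: "V \<in> Fr k"
  shows "perp V \<in> Fr (d - k)"
proof -
  have "\<forall>k l. V \<in> Fr k \<longrightarrow> perp V \<in> Fr l \<longrightarrow> (\<exists>k' l'. W \<in> Fr k' \<and> perp W \<in> Fr l' \<and> k + l \<le> k' + l')"
    if W: "pure W" "W \<subseteq> V" for W
  proof -
    show ?thesis using W(1) Fr_pure[OF V] W(2)
    proof (induction W rule: pure_induct_down)
      case (step W x)
      show ?case
      proof (intro allI impI)
        fix k l assume kl: "V \<in> Fr k" "perp V \<in> Fr l"
        obtain k' l' where *: "ext W x \<in> Fr k'" "perp (ext W x) \<in> Fr l'" "k + l \<le> k' + l'"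
          using step kl by blast
        obtain j where j: "W \<in> Fr j" using pure_in_Fr step by blast
        have xc: "x \<in> carrier M" using step Fr_subset[OF V] by blast
        have e: "ext W x \<in> Fr (Suc j)" using Fr_ext j step xc by blast
        then have k': "k' = Suc j" using * Fr_rank_unique by blast
        obtain l'' where l'': "perp W \<in> Fr l''" using pure_in_Fr perp_pure step by blast
        have "perp (ext W x) \<subseteq> perp W" using perp_anti ext_upper pure_sub step xc by blast
        moreover have "perp (ext W x) \<noteq> perp W"
          using perp_perp Fr_sub e j Fr_rank_unique by (metis n_not_Suc_n)
        ultimately have "l' < l''" using Fr_rank_mono l'' * Fr_eq by (metis le_neq_implies_less)
        then show "\<exists>k' l'. W \<in> Fr k' \<and> perp W \<in> Fr l' \<and> k + l \<le> k' + l'"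
          using j l'' * k' by (intro exI[of _ j] exI[of _ l'']) auto
      qed
    qed blast
  qed
  moreover have "{\<zero>\<^bsub>M\<^esub>} \<subseteq> V" using sub_zero Fr_sub V by auto
  moreover obtain l where l: "perp V \<in> Fr l" using pure_in_Fr perp_pure Fr_pure V by blast
  ultimately obtain k' l' where "{\<zero>\<^bsub>M\<^esub>} \<in> Fr k'" "carrier M \<in> Fr l'" "k + l \<le> k' + l'"
    using V perp_zero pure_zero by metis
  then have "k + l \<le> d" using Fr_rank_unique zero_in_Fr carrier_in_Fr by (metis add_0)
  then show ?thesis using l perp_rank_add[OF V l] by (metis add_diff_cancel_left' le_antisym)
qed

lemma perp_Fr_iff:
  assumes "sub V" "k \<le> d"
  shows "perp V \<in> Fr (d - k) \<longleftrightarrow> V \<in> Fr k"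
  using perp_Fr[of V k] perp_Fr[of "perp V" "d - k"] assms by (auto simp: perp_perp)

text \<open>The dual of \<open>spanned_by_Fr\<close>; the condition n < d becomes 0 < d - n.\<close>

lemma cospanned_by_Fr:
  assumes V: "V \<in> Fr n" "n < d" "W \<subseteq> V" and W: "sub W" and Y: "sub Y"
    and above: "\<And>V'. \<lbrakk>V' \<in> Fr n; W \<subseteq> V'\<rbrakk> \<Longrightarrow> Y \<subseteq> V'"
  shows "Y \<subseteq> W"
proof -
  have "perp W \<subseteq> perp Y"
  proof (rule spanned_by_Fr[OF perp_Fr[OF V(1)] _ perp_anti[OF V(3)] perp_sub[OF W] perp_sub[OF Y]])
    fix U assume U: "U \<in> Fr (d - n)" "U \<subseteq> perp W"
    then have "perp U \<in> Fr n" using perp_Fr[of U "d - n"] V by simp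
    moreover have "W \<subseteq> perp U" using perp_anti[OF U(2)] W by (simp add: perp_perp)
    ultimately have "Y \<subseteq> perp U" using above by blast
    then show "U \<subseteq> perp Y" using perp_anti[of Y "perp U"] Fr_sub[OF U(1)] by (simp add: perp_perp)
  qed (use V in simp)
  then show ?thesis using perp_subset_iff W Y by blast
qed

section \<open>Joins, meets and connectedness\<close>

lemma ext_ext_vsum:
  assumes W: "sub W" and x: "x \<in> carrier M" and y: "y \<in> carrier M"
  shows "ext (ext W x) y = ext W x \<boxplus> ext W y"
proof
  note sx = sub_ext[OF W x] and sy = sub_ext[OF W y]
  show "ext (ext W x) y \<subseteq> ext W x \<boxplus> ext W y"
    using ext_least[OF sub_vsum[OF sx sy] vsum_upper1[OF sx sy], of y]
      vsum_upper2[OF sx sy] ext_self[OF W y] by blast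
  show "ext W x \<boxplus> ext W y \<subseteq> ext (ext W x) y"
    by (rule vsum_least[OF sub_ext[OF sx y] ext_upper[OF sx y] ext_mono[OF sx ext_upper[OF W x] y]])
qed

lemma vsum_comm:
  assumes "sub V" "sub W"
  shows "V \<boxplus> W = W \<boxplus> V"
  using vsum_least[OF sub_vsum[OF assms(2,1)] vsum_upper2[OF assms(2,1)] vsum_upper1[OF assms(2,1)]]
    vsum_least[OF sub_vsum[OF assms] vsum_upper2[OF assms] vsum_upper1[OF assms]]
  by blast

lemma not_nbhd_mono: "\<lbrakk>y \<notin> nbhd W; V \<subseteq> W\<rbrakk> \<Longrightarrow> y \<notin> nbhd V"
  using nbhd_mono by blast

lemma ext_Int_ext:
  assumes W: "W \<in> Fr k" and x: "x \<in> carrier M" "x \<notin> nbhd W"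
    and y: "y \<in> carrier M" "y \<notin> nbhd (ext W x)"
  shows "ext W x \<inter> ext W y = W"
proof
  note sW = Fr_sub[OF W]
  show "W \<subseteq> ext W x \<inter> ext W y" using ext_upper[OF sW] x y by blast
  show "ext W x \<inter> ext W y \<subseteq> W"
  proof
    fix t assume t: "t \<in> ext W x \<inter> ext W y"
    then have "t \<in> ext W y" by blast
    then obtain v c where v: "v \<in> W" "c \<in> carrier K" "t = v \<oplus>\<^bsub>M\<^esub> c \<odot>\<^bsub>M\<^esub> y" by (rule extE)
    have p: "pure (ext W x)" using pure_ext[OF Fr_pure[OF W] x] .
    have "v \<in> ext W x" using v ext_upper[OF sW x(1)] by blast
    then have "c \<odot>\<^bsub>M\<^esub> y \<in> ext W x"
      using sub_cancel_left[OF pure_sub[OF p], of v "c \<odot>\<^bsub>M\<^esub> y"] t v y by auto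
    then have "c = \<zero>" using pure_smult_mem[OF p y v(2)] by blast
    then show "t \<in> W" using v y sub_carrier[OF sW] by simp
  qed
qed

text \<open>Freeness of the sum is what makes the intersection free. Some x in V lies outside U +
  \<pi>M, and U + V = U + Kx by rank. The modular law gives V = (U \<inter> V) + Kx, a direct sum,
  so U \<inter> V is complemented in V.\<close>

lemma Fr_meet:
  assumes U: "U \<in> Fr (Suc k)" and V: "V \<in> Fr (Suc k)" and sum: "U \<boxplus> V \<in> Fr (Suc (Suc k))"
  shows "U \<inter> V \<in> Fr k"
proof -
  note sU = Fr_sub[OF U] and sV = Fr_sub[OF V]
  have "\<not> V \<subseteq> nbhd U"
  proof
    assume "V \<subseteq> nbhd U"
    then have le: "U \<boxplus> V \<subseteq> nbhd U" by (rule vsum_least[OF sub_nbhd[OF sU] nbhd_upper[OF sU]])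
    have "U \<boxplus> V \<noteq> U" using U sum Fr_rank_unique by (metis n_not_Suc_n)
    then show False
      using pure_step[OF sU Fr_pure[OF sum] vsum_upper1[OF sU sV]] le by blast
  qed
  then obtain x where x: "x \<in> V" "x \<notin> nbhd U" by blast
  have xc: "x \<in> carrier M" using x(1) sub_carrier[OF sV] by blast
  have "ext U x \<subseteq> U \<boxplus> V"
    using vsum_upper1[OF sU sV] vsum_upper2[OF sU sV] x(1) by (intro ext_least sub_vsum sU sV) auto
  then have e: "ext U x = U \<boxplus> V" using Fr_eq[OF Fr_ext[OF U xc x(2)] sum] by blast
  have sI: "sub (U \<inter> V)" using sub_Int sU sV by blast
  have Vx: "ext (U \<inter> V) x = V"
  proof
    show "ext (U \<inter> V) x \<subseteq> V" using ext_least[OF sV _ x(1)] by blast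
    show "V \<subseteq> ext (U \<inter> V) x"
    proof
      fix v assume v: "v \<in> V"
      then have "v \<in> ext U x" using e vsum_upper2[OF sU sV] by blast
      then obtain u c where u: "u \<in> U" "c \<in> carrier K" "v = u \<oplus>\<^bsub>M\<^esub> c \<odot>\<^bsub>M\<^esub> x" by (rule extE)
      have "u \<in> V"
        using sub_cancel_right[OF sV, of u "c \<odot>\<^bsub>M\<^esub> x"] sub_smult[OF sV u(2) x(1)] u v sub_carrier[OF sU]
        by blast
      then show "v \<in> ext (U \<inter> V) x" using u by (auto simp: ext_iff)
    qed
  qed
  have "(U \<inter> V) \<inter> ray x = {\<zero>\<^bsub>M\<^esub>}"
  proof
    show "{\<zero>\<^bsub>M\<^esub>} \<subseteq> (U \<inter> V) \<inter> ray x" using sub_zero sI sub_ray[OF xc] by blast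
    show "(U \<inter> V) \<inter> ray x \<subseteq> {\<zero>\<^bsub>M\<^esub>}"
    proof
      fix t assume t: "t \<in> (U \<inter> V) \<inter> ray x"
      then obtain c where c: "c \<in> carrier K" "t = c \<odot>\<^bsub>M\<^esub> x" by (auto simp: ray_def)
      then have "c = \<zero>" using pure_smult_mem[OF Fr_pure[OF U] xc x(2)] t by blast
      then show "t \<in> {\<zero>\<^bsub>M\<^esub>}" using c xc by simp
    qed
  qed
  then have p: "pure (U \<inter> V)"
    using complemented_pure[OF pure_zero Fr_pure[OF V] sI sub_ray[OF xc]] Vx by (simp add: ext_def)
  have "x \<notin> nbhd (U \<inter> V)" using not_nbhd_mono[OF x(2)] by blast
  then have "card V = card (U \<inter> V) * q" using card_ext[OF p xc] Vx by simp
  then have "card (U \<inter> V) = q ^ k" using Fr_card[OF V] q_gt_1 by simp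
  then show ?thesis using p FrI by blast
qed

definition unique_join :: "nat \<Rightarrow> 'c set \<Rightarrow> 'c set \<Rightarrow> bool" where
  "unique_join k U V \<longleftrightarrow> (\<exists>!T. T \<in> Fr (Suc k) \<and> U \<subseteq> T \<and> V \<subseteq> T)"

definition unique_meet :: "nat \<Rightarrow> 'c set \<Rightarrow> 'c set \<Rightarrow> bool" where
  "unique_meet k U V \<longleftrightarrow> (\<exists>!T. T \<in> Fr k \<and> T \<subseteq> U \<and> T \<subseteq> V)"

text \<open>If the sum \<open>S\<close> is smaller than the join \<open>T = ext U x\<close>, then \<open>S\<close> lies in \<open>U + \<pi>T\<close>, so that
  perturbing \<open>x\<close> by a socle element outside \<open>T\<close> gives another upper bound.\<close>

lemma unique_join_sum:
  assumes U: "U \<in> Fr k" and V: "V \<in> Fr k" and kd: "Suc k < d" and uj: "unique_join k U V"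
  shows "U \<boxplus> V \<in> Fr (Suc k)"
proof -
  note sU = Fr_sub[OF U] and sV = Fr_sub[OF V]
  obtain T where T: "T \<in> Fr (Suc k)" "U \<subseteq> T" "V \<subseteq> T"
    using uj unfolding unique_join_def by blast
  have uniq: "T' = T" if "T' \<in> Fr (Suc k)" "U \<subseteq> T'" "V \<subseteq> T'" for T'
    using uj that T unfolding unique_join_def by blast
  obtain x where x: "x \<in> T" "x \<notin> nbhd U" "T = ext U x" using Fr_Suc_ext[OF U T(1,2)] by blast
  note sT = Fr_sub[OF T(1)]
  have xc: "x \<in> carrier M" using x(1) sub_carrier[OF sT] by blast
  define S where "S = U \<boxplus> V"
  have sS: "sub S" and ST: "S \<subseteq> T" and US: "U \<subseteq> S" and VS: "V \<subseteq> S"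
    unfolding S_def using sub_vsum[OF sU sV] vsum_least[OF sT T(2,3)]
      vsum_upper1[OF sU sV] vsum_upper2[OF sU sV] by blast+
  have "S = T"
  proof (rule ccontr)
    assume ne: "S \<noteq> T"
    have "x \<notin> S" using ext_least[OF sS US, of x] x(3) ST ne by blast
    obtain z where z: "z \<in> carrier M" "z \<notin> nbhd T"
      using nbhd_proper[OF T(1) kd] nbhd_carrier[OF sT] by blast
    define t where "t = (\<pi> [^] (s - 1)) \<odot>\<^bsub>M\<^esub> z"
    have tc: "t \<in> carrier M" using z by (simp add: t_def)
    have tT: "t \<notin> T"
      using pure_pow_mem[OF Fr_pure[OF T(1)] _ z(1), of "s - 1"] z(2) s_pos by (auto simp: t_def)
    have pt: "\<pi> \<odot>\<^bsub>M\<^esub> t = \<zero>\<^bsub>M\<^esub>"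
    proof -
      have "\<pi> \<odot>\<^bsub>M\<^esub> t = (\<pi> \<otimes> \<pi> [^] (s - 1)) \<odot>\<^bsub>M\<^esub> z" using z unfolding t_def by (simp add: smult_assoc1)
      also have "\<pi> \<otimes> \<pi> [^] (s - 1) = \<zero>" using unif_pow_Suc[of "s - 1"] s_pos unif_pow_eq by simp
      finally show ?thesis using z by simp
    qed
    define x' where "x' = x \<oplus>\<^bsub>M\<^esub> t"
    have x'c: "x' \<in> carrier M" using xc tc by (simp add: x'_def)
    have "x' \<notin> nbhd U"
    proof
      assume a: "x' \<in> nbhd U"
      show False
      \<comment> \<open>For s > 1 the perturbation t lies in \<pi>M and does not affect membership
        in U + \<pi>M. For s = 1 it is z itself, and the choice of z outside T + \<pi>M is used
        instead.\<close>
      proof (cases "s = 1")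
        case True
        then have "t = z" using z by (simp add: t_def)
        moreover have "x' \<in> nbhd T" using a nbhd_mono[OF T(2)] by blast
        ultimately show False
          using sub_cancel_left[OF sub_nbhd[OF sT], of x z] x(1) nbhd_upper[OF sT] z by (auto simp: x'_def)
      next
        case False
        then have "s - 1 = Suc (s - 2)" using s_pos by simp
        then have "t = \<pi> \<odot>\<^bsub>M\<^esub> ((\<pi> [^] (s - 2)) \<odot>\<^bsub>M\<^esub> z)"
          using z unfolding t_def by (simp only: unif_pow_Suc smult_assoc1 unif_closed nat_pow_closed)
        then have "t \<in> nbhd U" using nbhd_unif[OF sU] z by simp
        then show False
          using sub_cancel_right[OF sub_nbhd[OF sU], of x t] a x(2) xc by (simp add: x'_def)
      qed
    qed
    then have T': "ext U x' \<in> Fr (Suc k)" using Fr_ext U x'c by blast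
    have "S \<subseteq> ext U x'"
    proof
      fix y assume y: "y \<in> S"
      then have "y \<in> ext U x" using ST x(3) by blast
      then obtain u c where u: "u \<in> U" "c \<in> carrier K" "y = u \<oplus>\<^bsub>M\<^esub> c \<odot>\<^bsub>M\<^esub> x" by (rule extE)
      have "c \<odot>\<^bsub>M\<^esub> x \<in> S" using sub_cancel_left[OF sS, of u "c \<odot>\<^bsub>M\<^esub> x"] u y US xc by auto
      then have "c \<notin> Units K" using sub_unit_smult[OF sS _ xc] \<open>x \<notin> S\<close> by blast
      then obtain b where b: "b \<in> carrier K" "c = \<pi> \<otimes> b" using unit_or_multiple u by blast
      have "c \<odot>\<^bsub>M\<^esub> x' = c \<odot>\<^bsub>M\<^esub> x \<oplus>\<^bsub>M\<^esub> b \<odot>\<^bsub>M\<^esub> (\<pi> \<odot>\<^bsub>M\<^esub> t)"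
        unfolding x'_def b(2) using b(1) xc tc
        by (simp add: smult_r_distr smult_assoc1[symmetric] R.m_comm)
      then have "c \<odot>\<^bsub>M\<^esub> x' = c \<odot>\<^bsub>M\<^esub> x" using pt b u xc by simp
      then have "y = u \<oplus>\<^bsub>M\<^esub> c \<odot>\<^bsub>M\<^esub> x'" using u by simp
      then show "y \<in> ext U x'" unfolding ext_iff using u by blast
    qed
    then have "ext U x' = T" using uniq[OF T'] US VS by blast
    then have "x' \<in> T" using ext_self[OF sU x'c] by blast
    then show False using sub_cancel_left[OF sT _ x(1) tc] tT by (simp add: x'_def)
  qed
  then show ?thesis using T S_def by simp
qed

text \<open>Complementation turns the unique lower bound into a unique upper bound of rank d - k,
  and \<open>unique_join_sum\<close> applies because 0 < k means d - k < d.\<close>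

lemma unique_meet_Int:
  assumes U: "U \<in> Fr (Suc k)" and V: "V \<in> Fr (Suc k)" and k: "0 < k" and um: "unique_meet k U V"
  shows "U \<inter> V \<in> Fr k"
proof -
  have kd: "Suc k \<le> d" using Fr_le_dim U by blast
  note sU = Fr_sub[OF U] and sV = Fr_sub[OF V]
  have dk: "d - k = Suc (d - Suc k)" using kd by simp
  obtain W where W: "W \<in> Fr k" "W \<subseteq> U" "W \<subseteq> V" using um unfolding unique_meet_def by blast
  have uniq: "W' = W" if "W' \<in> Fr k" "W' \<subseteq> U" "W' \<subseteq> V" for W'
    using um that W unfolding unique_meet_def by blast
  have "unique_join (d - Suc k) (perp U) (perp V)"
    unfolding unique_join_def
  proof (rule ex1I[of _ "perp W"])
    show "perp W \<in> Fr (Suc (d - Suc k)) \<and> perp U \<subseteq> perp W \<and> perp V \<subseteq> perp W"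
      using perp_Fr[OF W(1)] dk perp_anti W by simp
    fix T assume T: "T \<in> Fr (Suc (d - Suc k)) \<and> perp U \<subseteq> T \<and> perp V \<subseteq> T"
    then have "perp T \<in> Fr k" using perp_Fr[of T "d - k"] dk kd by simp
    moreover have "perp T \<subseteq> U" "perp T \<subseteq> V"
      using T perp_anti[of "perp U" T] perp_anti[of "perp V" T] sU sV by (simp_all add: perp_perp)
    ultimately have "perp T = W" using uniq by blast
    then show "T = perp W" using perp_perp[of T] T Fr_sub by blast
  qed
  then have "perp U \<boxplus> perp V \<in> Fr (Suc (d - Suc k))"
    using unique_join_sum[OF perp_Fr[OF U] perp_Fr[OF V]] k kd by simp
  then have "perp (U \<inter> V) \<in> Fr (d - k)" using dk sU sV by (simp add: perp_Int)
  then show ?thesis using perp_Fr_iff[OF sub_Int[OF sU sV]] kd by simp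
qed

lemma unique_meet_ext:
  assumes W: "W \<in> Fr k" and x: "x \<in> carrier M" "x \<notin> nbhd W"
    and y: "y \<in> carrier M" "y \<notin> nbhd (ext W x)"
  shows "unique_meet k (ext W x) (ext W y)"
proof -
  have "ext W x \<inter> ext W y = W" using ext_Int_ext assms by blast
  then have "T = W" if "T \<in> Fr k" "T \<subseteq> ext W x" "T \<subseteq> ext W y" for T
    using Fr_eq[OF that(1) W] that by blast
  moreover have "W \<subseteq> ext W x" "W \<subseteq> ext W y" using ext_upper Fr_sub W x y by blast+
  ultimately show ?thesis unfolding unique_meet_def using W by blast
qed

lemma avoid_two_nbhds:
  assumes "V \<in> Fr j" "W \<in> Fr k" "j < d" "k < d"
  shows "\<exists>z\<in>carrier M. z \<notin> nbhd V \<and> z \<notin> nbhd W"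
  using avoid_two[OF sub_nbhd nbhd_proper sub_nbhd nbhd_proper] assms Fr_sub by metis

text \<open>The sum of two free submodules may fail to be free, so they are linked through common
  submodules, by induction on m - j for a W of rank j inside both. W is enlarged by x within U, by y
  within U', and by a z in general position to both enlargements. Members A and B of rank m above W
  + Kx + Kz and W + Kz + Ky then make U, A, B, U' a path whose neighbours share rank j + 1.\<close>

lemma Fr_connected:
  assumes md: "m < d"
    and step: "\<And>U U'. \<lbrakk>U \<in> Fr m; U' \<in> Fr m; U \<boxplus> U' \<in> Fr (Suc m); Q U\<rbrakk> \<Longrightarrow> Q U'"
    and U: "U \<in> Fr m" "U' \<in> Fr m" "Q U"
  shows "Q U'"
proof -
  have "Q U'" if "W \<in> Fr j" "j \<le> m" "U \<in> Fr m" "U' \<in> Fr m" "W \<subseteq> U" "W \<subseteq> U'" "Q U" for W U U' j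
    using that
  proof (induction "m - j" arbitrary: W U U' j)
    case 0
    then have "W = U" "W = U'" using Fr_eq by (metis diff_is_0_eq le_antisym)+
    then show ?case using 0 by blast
  next
    case (Suc i)
    note W = \<open>W \<in> Fr j\<close> and sW = Fr_sub[OF \<open>W \<in> Fr j\<close>]
    have jm: "Suc j \<le> m" and i: "i = m - Suc j" using Suc.hyps by auto
    obtain x where x: "x \<in> carrier M" "x \<notin> nbhd W" "ext W x \<in> Fr (Suc j)" "ext W x \<subseteq> U"
    proof -
      have "W \<noteq> U" using W Suc.prems(3) jm Fr_rank_unique by (metis Suc_n_not_le_n)
      then show ?thesis
        using Fr_grow[OF W Fr_pure[OF Suc.prems(3)] Suc.prems(5)] that Fr_subset[OF Suc.prems(3)]
        by blast
    qed
    obtain y where y: "y \<in> carrier M" "y \<notin> nbhd W" "ext W y \<in> Fr (Suc j)" "ext W y \<subseteq> U'"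
    proof -
      have "W \<noteq> U'" using W Suc.prems(4) jm Fr_rank_unique by (metis Suc_n_not_le_n)
      then show ?thesis
        using Fr_grow[OF W Fr_pure[OF Suc.prems(4)] Suc.prems(6)] that Fr_subset[OF Suc.prems(4)]
        by blast
    qed
    obtain z where z: "z \<in> carrier M" "z \<notin> nbhd (ext W x)" "z \<notin> nbhd (ext W y)"
      using avoid_two_nbhds[OF x(3) y(3)] jm md by auto
    have zW: "z \<notin> nbhd W" using not_nbhd_mono[OF z(2) ext_upper[OF sW x(1)]] .
    have ez: "ext W z \<in> Fr (Suc j)" using Fr_ext[OF W z(1) zW] .
    have sx: "ext W x \<boxplus> ext W z \<in> Fr (Suc (Suc j))"
      using Fr_ext[OF x(3) z(1,2)] ext_ext_vsum[OF sW x(1) z(1)] by simp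
    have sy: "ext W z \<boxplus> ext W y \<in> Fr (Suc (Suc j))"
      using Fr_ext[OF y(3) z(1,3)] ext_ext_vsum[OF sW y(1) z(1)]
        vsum_comm[OF sub_ext[OF sW y(1)] sub_ext[OF sW z(1)]] by simp
    show ?case
    proof (cases "Suc j = m")
      case True
      have "ext W x = U" "ext W y = U'"
        using Fr_eq[OF x(3)] Fr_eq[OF y(3)] x(4) y(4) Suc.prems(3,4) True by blast+
      then have "Q (ext W z)" using step[of U "ext W z"] Suc.prems ez sx True by blast
      then show ?thesis using step[of "ext W z" U'] \<open>ext W y = U'\<close> ez Suc.prems sy True by blast
    next
      case False
      then have jm': "Suc (Suc j) \<le> m" using jm by simp
      have md': "m \<le> d" using md by simp
      obtain A where A: "A \<in> Fr m" "ext W x \<boxplus> ext W z \<subseteq> A" using Fr_above[OF sx jm' md'] by blast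
      obtain B where B: "B \<in> Fr m" "ext W z \<boxplus> ext W y \<subseteq> B" using Fr_above[OF sy jm' md'] by blast
      have sub3: "sub (ext W x)" "sub (ext W y)" "sub (ext W z)" using x y ez Fr_sub by blast+
      have "ext W x \<subseteq> A" "ext W z \<subseteq> A" "ext W z \<subseteq> B" "ext W y \<subseteq> B"
        using A B vsum_upper1[of "ext W x" "ext W z"] vsum_upper2[of "ext W x" "ext W z"]
          vsum_upper1[of "ext W z" "ext W y"] vsum_upper2[of "ext W z" "ext W y"] sub3 by blast+
      then have "Q A" using Suc.hyps(1)[OF i x(3) jm Suc.prems(3) A(1) x(4)] Suc.prems(7) by blast
      then have "Q B" using Suc.hyps(1)[OF i ez jm A(1) B(1)] \<open>ext W z \<subseteq> A\<close> \<open>ext W z \<subseteq> B\<close> by blast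
      then show ?thesis using Suc.hyps(1)[OF i y(3) jm B(1) Suc.prems(4)] \<open>ext W y \<subseteq> B\<close> y(4) by blast
    qed
  qed
  moreover have "{\<zero>\<^bsub>M\<^esub>} \<subseteq> U" "{\<zero>\<^bsub>M\<^esub>} \<subseteq> U'" using sub_zero Fr_sub U by blast+
  ultimately show ?thesis using zero_in_Fr U by blast
qed

section \<open>Ranges of ranks, adjacency and triangles\<close>

definition Fr_range :: "nat \<Rightarrow> nat \<Rightarrow> 'c set set" where
  "Fr_range a b = (\<Union>k\<in>{a..b}. Fr k)"

lemma Fr_rangeI: "\<lbrakk>V \<in> Fr k; a \<le> k; k \<le> b\<rbrakk> \<Longrightarrow> V \<in> Fr_range a b"
  by (auto simp: Fr_range_def)

lemma Fr_rangeE: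
  assumes "V \<in> Fr_range a b"
  obtains k where "V \<in> Fr k" "a \<le> k" "k \<le> b"
  using assms that unfolding Fr_range_def by (metis UN_E atLeastAtMost_iff)

lemma Fr_range_iff: "V \<in> Fr k \<Longrightarrow> V \<in> Fr_range a b \<longleftrightarrow> a \<le> k \<and> k \<le> b"
  unfolding Fr_range_def by (metis UN_iff atLeastAtMost_iff Fr_rank_unique)

lemma Fr_range_sub: "V \<in> Fr_range a b \<Longrightarrow> sub V"
  using Fr_sub by (auto simp: Fr_range_def)

lemma perp_Fr_range:
  assumes "V \<in> Fr_range a b"
  shows "perp V \<in> Fr_range (d - b) (d - a)"
proof -
  obtain k where k: "V \<in> Fr k" "a \<le> k" "k \<le> b" using assms by (rule Fr_rangeE)
  then show ?thesis using perp_Fr[OF k(1)] by (auto intro!: Fr_rangeI)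
qed

text \<open>Over a field this is the Grassmann graph. Over K, asking for a free sum also forces a
  free intersection of rank k - 1 when 0 < k, by \<open>Fr_meet\<close>.\<close>

definition adj :: "nat \<Rightarrow> 'c set \<Rightarrow> 'c set \<Rightarrow> bool" where
  "adj k U V \<longleftrightarrow> U \<in> Fr k \<and> V \<in> Fr k \<and> U \<boxplus> V \<in> Fr (Suc k)"

lemma adj_Fr: "adj k U V \<Longrightarrow> U \<in> Fr k" "adj k U V \<Longrightarrow> V \<in> Fr k" "adj k U V \<Longrightarrow> U \<boxplus> V \<in> Fr (Suc k)"
  by (auto simp: adj_def)

lemma adj_ext:
  assumes W: "W \<in> Fr k" and x: "x \<in> carrier M" "x \<notin> nbhd W"
    and y: "y \<in> carrier M" "y \<notin> nbhd (ext W x)"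
  shows "adj (Suc k) (ext W x) (ext W y)" "ext W x \<inter> ext W y = W"
proof -
  have "y \<notin> nbhd W" using not_nbhd_mono[OF y(2) ext_upper[OF Fr_sub[OF W] x(1)]] .
  then have "ext W x \<in> Fr (Suc k)" "ext W y \<in> Fr (Suc k)" using Fr_ext W x y by blast+
  then show "adj (Suc k) (ext W x) (ext W y)"
    using Fr_ext[OF _ y] ext_ext_vsum[OF Fr_sub[OF W] x(1) y(1)] by (auto simp: adj_def)
  show "ext W x \<inter> ext W y = W" by (rule ext_Int_ext[OF assms])
qed

lemma adj_exists:
  assumes W: "W \<in> Fr k" and U: "U \<in> Fr (Suc k)" "W \<subseteq> U" and kd: "Suc k < d"
  shows "\<exists>V. adj (Suc k) U V \<and> U \<inter> V = W"
proof -
  obtain x where x: "x \<in> U" "x \<notin> nbhd W" "U = ext W x" using Fr_Suc_ext[OF W U] by blast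
  obtain y where y: "y \<in> carrier M" "y \<notin> nbhd U"
    using nbhd_proper[OF U(1) kd] nbhd_carrier[OF Fr_sub[OF U(1)]] by blast
  then show ?thesis using adj_ext[OF W _ x(2) y(1)] x Fr_subset[OF U(1)] by blast
qed

lemma adj_basis:
  assumes a: "adj (Suc k) U V"
  obtains x y where "x \<in> carrier M" "x \<notin> nbhd (U \<inter> V)" "U = ext (U \<inter> V) x"
    "y \<in> carrier M" "y \<notin> nbhd U" "V = ext (U \<inter> V) y" "U \<boxplus> V = ext U y"
proof -
  note U = adj_Fr(1)[OF a] and V = adj_Fr(2)[OF a] and S = adj_Fr(3)[OF a]
  have W: "U \<inter> V \<in> Fr k" using Fr_meet[OF U V S] .
  obtain x where x: "x \<in> U" "x \<notin> nbhd (U \<inter> V)" "U = ext (U \<inter> V) x"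
    using Fr_Suc_ext[OF W U] by blast
  obtain y where y: "y \<in> V" "y \<notin> nbhd (U \<inter> V)" "V = ext (U \<inter> V) y"
    using Fr_Suc_ext[OF W V] by blast
  have c: "x \<in> carrier M" "y \<in> carrier M" using x y Fr_subset U V by blast+
  have e: "U \<boxplus> V = ext U y" using ext_ext_vsum[OF Fr_sub[OF W] c] x(3) y(3) by simp
  have "y \<notin> nbhd U"
    using ext_not_mem[OF Fr_pure[OF U] c(2)] S e Fr_pure[OF S] Fr_rank_unique[OF U] by (metis n_not_Suc_n)
  then show ?thesis using that[OF c(1) x(2,3) c(2) _ y(3) e] by blast
qed

text \<open>Triangles of the Grassmann graph either share their meet or lie in a common join. The
  third vertex is chosen through U \<inter> V and outside the sum, which gives the first kind; the
  unique meet of the sums U + V and U + Z records this kind using only the ranks k + 1 and k +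
  2.\<close>

lemma triangle:
  assumes a: "adj (Suc k) U V" and z: "z \<in> carrier M" "z \<notin> nbhd (U \<boxplus> V)"
  defines "Z \<equiv> ext (U \<inter> V) z"
  shows "adj (Suc k) U Z" "adj (Suc k) V Z" "U \<inter> Z = U \<inter> V" "V \<inter> Z = U \<inter> V"
    "unique_meet (Suc k) (U \<boxplus> V) (U \<boxplus> Z)"
proof -
  note U = adj_Fr(1)[OF a] and V = adj_Fr(2)[OF a] and S = adj_Fr(3)[OF a]
  define W where "W = U \<inter> V"
  have W: "W \<in> Fr k" unfolding W_def using Fr_meet[OF U V S] .
  obtain x y where x: "x \<in> carrier M" "x \<notin> nbhd W" "U = ext W x"
    and y: "y \<in> carrier M" "y \<notin> nbhd U" "V = ext W y" "U \<boxplus> V = ext U y"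
    using adj_basis[OF a] unfolding W_def by metis
  have yW: "y \<notin> nbhd W" using not_nbhd_mono[OF y(2)] W_def by blast
  have zU: "z \<notin> nbhd U" using not_nbhd_mono[OF z(2)] vsum_upper1 Fr_sub U V by blast
  have zV: "z \<notin> nbhd V" using not_nbhd_mono[OF z(2)] vsum_upper2 Fr_sub U V by blast
  show "adj (Suc k) U Z" "U \<inter> Z = U \<inter> V"
    using adj_ext[OF W x(1,2) z(1)] zU x(3) unfolding Z_def W_def by auto
  show "adj (Suc k) V Z" "V \<inter> Z = U \<inter> V"
    using adj_ext[OF W y(1) yW z(1)] zV y(3) unfolding Z_def W_def by auto
  have "U \<boxplus> Z = ext U z"
    using ext_ext_vsum[OF Fr_sub[OF W] x(1) z(1)] unfolding Z_def W_def[symmetric] x(3)[symmetric] by simp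
  then show "unique_meet (Suc k) (U \<boxplus> V) (U \<boxplus> Z)"
    using unique_meet_ext[OF U y(1,2) z(1)] z(2) y(4) by simp
qed

text \<open>The unique meet makes (U + V) \<inter> (U + Z) equal to U, so V \<inter> Z lies in U.
  The three pairwise meets have equal rank and hence coincide.\<close>

lemma triangle_meet:
  assumes UV: "adj (Suc k) U V" and UZ: "adj (Suc k) U Z" and VZ: "adj (Suc k) V Z"
    and um: "unique_meet (Suc k) (U \<boxplus> V) (U \<boxplus> Z)"
  shows "U \<inter> V = U \<inter> Z" "U \<inter> V = V \<inter> Z"
proof -
  note U = adj_Fr(1)[OF UV] and V = adj_Fr(2)[OF UV] and Z = adj_Fr(2)[OF UZ]
  note sU = Fr_sub[OF U] and sV = Fr_sub[OF V] and sZ = Fr_sub[OF Z]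
  have i: "(U \<boxplus> V) \<inter> (U \<boxplus> Z) \<in> Fr (Suc k)"
    using unique_meet_Int[OF adj_Fr(3)[OF UV] adj_Fr(3)[OF UZ] _ um] by simp
  have "U \<subseteq> (U \<boxplus> V) \<inter> (U \<boxplus> Z)" using vsum_upper1 sU sV sZ by blast
  then have "(U \<boxplus> V) \<inter> (U \<boxplus> Z) = U" using Fr_eq[OF U i] by blast
  then have "V \<inter> Z \<subseteq> U" using vsum_upper2[OF sU sV] vsum_upper2[OF sU sZ] by blast
  moreover have "U \<inter> V \<in> Fr k" "U \<inter> Z \<in> Fr k" "V \<inter> Z \<in> Fr k"
    using Fr_meet adj_Fr UV UZ VZ by blast+
  ultimately have "V \<inter> Z = U \<inter> V" "V \<inter> Z = U \<inter> Z"
    using Fr_eq[of "V \<inter> Z" k "U \<inter> V"] Fr_eq[of "V \<inter> Z" k "U \<inter> Z"] by blast+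
  then show "U \<inter> V = U \<inter> Z" "U \<inter> V = V \<inter> Z" by auto
qed

text \<open>Serves to recognise rank 0, where there is only one submodule.\<close>

lemma two_Fr:
  assumes "0 < k" "k < d"
  shows "\<exists>U\<in>Fr k. \<exists>V\<in>Fr k. U \<noteq> V"
proof -
  obtain j where j: "k = Suc j" using assms(1) by (cases k) auto
  obtain U where U: "U \<in> Fr k" using Fr_below[OF carrier_in_Fr] assms by (metis less_imp_le)
  obtain W where W: "W \<in> Fr j" "W \<subseteq> U" using Fr_below[OF U] j by (metis le_SucI le_refl)
  obtain V where V: "adj k U V" "U \<inter> V = W" using adj_exists W U j assms(2) by blast
  have "U \<noteq> V" using V(2) W(1) U Fr_rank_unique j by (metis Int_absorb n_not_Suc_n)
  then show ?thesis using U adj_Fr(2)[OF V(1)] by blast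
qed

section \<open>Orientation of maps that keep comparability\<close>

lemma incomparable_above:
  assumes U: "U \<in> Fr k" and V: "V \<in> Fr j" "U \<subset> V" "j < d" and V': "V' \<in> Fr j'" "U \<subset> V'" "j' < d"
  shows "\<exists>Y\<in>Fr (Suc k). U \<subset> Y \<and> \<not> Y \<subseteq> V \<and> \<not> V \<subseteq> Y \<and> \<not> Y \<subseteq> V' \<and> \<not> V' \<subseteq> Y"
proof -
  obtain z where z: "z \<in> carrier M" "z \<notin> nbhd V" "z \<notin> nbhd V'"
    using avoid_two_nbhds[OF V(1) V'(1) V(3) V'(3)] by blast
  define Y where "Y = ext U z"
  have Y: "Y \<in> Fr (Suc k)" unfolding Y_def using Fr_ext[OF U z(1)] not_nbhd_mono[OF z(2)] V(2) by blast
  have zY: "z \<in> Y" "U \<subseteq> Y" unfolding Y_def using ext_self ext_upper Fr_sub[OF U] z(1) by blast+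
  have zV: "z \<notin> V" "z \<notin> V'" using z nbhd_upper Fr_sub V V' by blast+
  \<comment> \<open>Y has rank one more than U, so a free Z with U \<subset> Z \<subseteq> Y equals
    Y and contains z. Since z avoids V and V', neither of them lies in Y.\<close>
  have *: "\<not> Z \<subseteq> Y" if Z: "Z \<in> Fr i" "U \<subset> Z" "z \<notin> Z" for Z i
  proof
    assume XY: "Z \<subseteq> Y"
    have "k \<le> i" using Fr_rank_mono[OF U Z(1)] Z(2) by blast
    moreover have "k \<noteq> i" using Fr_eq[OF U] Z by blast
    moreover have "i \<le> Suc k" using Fr_rank_mono[OF Z(1) Y XY] .
    ultimately have "i = Suc k" by simp
    then show False using Fr_eq[OF Z(1)] Y XY Z(3) zY by blast
  qed
  show ?thesis using Y zY zV *[OF V(1,2) zV(1)] *[OF V'(1,2) zV(2)] V(2) by (intro bexI[of _ Y]) auto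
qed

lemma perp_psubset: "\<lbrakk>sub V; sub W; V \<subset> W\<rbrakk> \<Longrightarrow> perp W \<subset> perp V"
  by (metis perp_anti perp_perp psubsetE psubsetI)

lemma incomparable_below:
  assumes U: "U \<in> Fr k" and V: "V \<in> Fr j" "V \<subset> U" "0 < j" and V': "V' \<in> Fr j'" "V' \<subset> U" "0 < j'"
  shows "\<exists>Y\<in>Fr (k - 1). Y \<subset> U \<and> \<not> Y \<subseteq> V \<and> \<not> V \<subseteq> Y \<and> \<not> Y \<subseteq> V' \<and> \<not> V' \<subseteq> Y"
proof -
  note s = Fr_sub[OF U] Fr_sub[OF V(1)] Fr_sub[OF V'(1)]
  have d: "j \<le> k" "j' \<le> k" "k \<le> d" using Fr_rank_mono V V' U Fr_le_dim[OF U] by blast+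
  have lt: "d - j < d" "d - j' < d" using d V(3) V'(3) by auto
  obtain Y where Y: "Y \<in> Fr (Suc (d - k))" "perp U \<subset> Y" "\<not> Y \<subseteq> perp V" "\<not> perp V \<subseteq> Y"
     "\<not> Y \<subseteq> perp V'" "\<not> perp V' \<subseteq> Y"
    using incomparable_above[OF perp_Fr[OF U] perp_Fr[OF V(1)] perp_psubset[OF s(2,1) V(2)] lt(1)
        perp_Fr[OF V'(1)] perp_psubset[OF s(3,1) V'(2)] lt(2)] by blast
  note sY = Fr_sub[OF Y(1)]
  have "d - Suc (d - k) = k - 1" using d V by simp
  then have "perp Y \<in> Fr (k - 1)" using perp_Fr[OF Y(1)] by simp
  moreover have "perp Y \<subset> U" using perp_psubset[OF perp_sub[OF s(1)] sY Y(2)] s by (simp add: perp_perp)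
  moreover have "\<not> perp Y \<subseteq> V" "\<not> V \<subseteq> perp Y" "\<not> perp Y \<subseteq> V'" "\<not> V' \<subseteq> perp Y"
    using Y(3-6) perp_subset_iff[of Y "perp V"] perp_subset_iff[of "perp V" Y]
      perp_subset_iff[of Y "perp V'"] perp_subset_iff[of "perp V'" Y] s sY
    by (auto simp: perp_perp perp_sub)
  ultimately show ?thesis by blast
qed

text \<open>Two edges with a common lower (or upper) vertex and incomparable other ends are oriented
  alike, and incomparable ends can always be interpolated; hence a single orientation.\<close>

lemma comparability_orientation:
  fixes g :: "'c set \<Rightarrow> 'v set"
  assumes d: "2 < d" and inj: "inj_on g (Fr_range 1 (d - 1))"
    and comp: "\<And>U V. \<lbrakk>U \<in> Fr_range 1 (d - 1); V \<in> Fr_range 1 (d - 1)\<rbrakk>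
      \<Longrightarrow> (g U \<subseteq> g V \<or> g V \<subseteq> g U) \<longleftrightarrow> (U \<subseteq> V \<or> V \<subseteq> U)"
  shows "(\<forall>U\<in>Fr_range 1 (d - 1). \<forall>V\<in>Fr_range 1 (d - 1). U \<subseteq> V \<longrightarrow> g U \<subseteq> g V) \<or>
    (\<forall>U\<in>Fr_range 1 (d - 1). \<forall>V\<in>Fr_range 1 (d - 1). U \<subseteq> V \<longrightarrow> g V \<subseteq> g U)"
proof -
  let ?S = "Fr_range 1 (d - 1)"
  \<comment> \<open>If instead g Y \<subseteq> g U, transitivity with g U \<subseteq> g V would make
    Y and V comparable.\<close>
  have via_up: "g U \<subseteq> g Y" if "U \<in> ?S" "V \<in> ?S" "Y \<in> ?S" "U \<subseteq> Y" "\<not> Y \<subseteq> V" "\<not> V \<subseteq> Y" "g U \<subseteq> g V" for U V Y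
    using comp[of U Y] comp[of V Y] that by blast
  have via_down: "g Y \<subseteq> g V" if "U \<in> ?S" "V \<in> ?S" "Y \<in> ?S" "Y \<subseteq> V" "\<not> Y \<subseteq> U" "\<not> U \<subseteq> Y" "g U \<subseteq> g V" for U V Y
    using comp[of V Y] comp[of U Y] that by blast
  have up: "g U \<subseteq> g V'" if U: "U \<in> ?S" and V: "V \<in> ?S" "U \<subset> V" and V': "V' \<in> ?S" "U \<subset> V'"
    and g: "g U \<subseteq> g V" for U V V'
  proof -
    obtain k where k: "U \<in> Fr k" "1 \<le> k" using U by (rule Fr_rangeE)
    obtain j where j: "V \<in> Fr j" "j \<le> d - 1" using V by (auto elim: Fr_rangeE)
    obtain j' where j': "V' \<in> Fr j'" "j' \<le> d - 1" using V' by (auto elim: Fr_rangeE)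
    have lt: "j < d" "j' < d" using j j' d by auto
    obtain Y where Y: "Y \<in> Fr (Suc k)" "U \<subset> Y" "\<not> Y \<subseteq> V" "\<not> V \<subseteq> Y" "\<not> Y \<subseteq> V'" "\<not> V' \<subseteq> Y"
      using incomparable_above[OF k(1) j(1) V(2) lt(1) j'(1) V'(2) lt(2)] by blast
    have "k \<le> j" "k \<noteq> j" using Fr_rank_mono[OF k(1) j(1)] Fr_eq[OF k(1)] j(1) V(2) by blast+
    then have YS: "Y \<in> ?S" using j by (intro Fr_rangeI[OF Y(1)]) auto
    have "g U \<subseteq> g Y" using via_up[OF U V(1) YS _ Y(3,4) g] Y(2) by blast
    then show ?thesis using via_up[OF U YS V'(1)] V'(2) Y(5,6) by blast
  qed
  have down: "g U' \<subseteq> g V" if V: "V \<in> ?S" and U: "U \<in> ?S" "U \<subset> V" and U': "U' \<in> ?S" "U' \<subset> V"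
    and g: "g U \<subseteq> g V" for U V U'
  proof -
    obtain k where k: "V \<in> Fr k" "k \<le> d - 1" using V by (auto elim: Fr_rangeE)
    obtain j where j: "U \<in> Fr j" "1 \<le> j" using U by (auto elim: Fr_rangeE)
    obtain j' where j': "U' \<in> Fr j'" "1 \<le> j'" using U' by (auto elim: Fr_rangeE)
    have lt: "0 < j" "0 < j'" using j j' by auto
    obtain Y where Y: "Y \<in> Fr (k - 1)" "Y \<subset> V" "\<not> Y \<subseteq> U" "\<not> U \<subseteq> Y" "\<not> Y \<subseteq> U'" "\<not> U' \<subseteq> Y"
      using incomparable_below[OF k(1) j(1) U(2) lt(1) j'(1) U'(2) lt(2)] by blast
    have "j \<le> k" "k \<noteq> j" using Fr_rank_mono[OF j(1) k(1)] Fr_eq[OF j(1)] k(1) U(2) by blast+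
    then have YS: "Y \<in> ?S" using j k by (intro Fr_rangeI[OF Y(1)]) auto
    have "g Y \<subseteq> g V" using via_down[OF U(1) V YS _ Y(3,4) g] Y(2) by blast
    then show ?thesis using via_down[OF YS V U'(1)] U'(2) Y(5,6) by blast
  qed
  \<comment> \<open>\<open>Q p\<close> says that all edges from the rank-one submodule p upwards
    keep their direction. It spreads from p to p' through p + p', hence by connectedness to all of
    rank one.\<close>
  define Q where "Q p \<longleftrightarrow> (\<forall>V\<in>?S. p \<subset> V \<longrightarrow> g p \<subseteq> g V)" for p
  have pS: "p \<in> ?S" if "p \<in> Fr 1" for p using d by (intro Fr_rangeI[OF that]) auto
  have point: "\<exists>p\<in>Fr 1. p \<subseteq> U" if "U \<in> ?S" for U
    using that Fr_below by (auto elim!: Fr_rangeE)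
  have Qstep: "Q p'" if p: "p \<in> Fr 1" "p' \<in> Fr 1" "p \<boxplus> p' \<in> Fr (Suc 1)" "Q p" for p p'
  proof -
    have T: "p \<boxplus> p' \<in> ?S" using d by (intro Fr_rangeI[OF p(3)]) auto
    have sub: "p \<subset> p \<boxplus> p'" "p' \<subset> p \<boxplus> p'"
      using vsum_upper1[OF Fr_sub Fr_sub] vsum_upper2[OF Fr_sub Fr_sub] p Fr_rank_unique[OF p(3)]
      by (metis n_not_Suc_n psubsetI)+
    have "g p \<subseteq> g (p \<boxplus> p')" using p(4) T sub unfolding Q_def by blast
    then have "g p' \<subseteq> g (p \<boxplus> p')" using down[OF T pS[OF p(1)] sub(1) pS[OF p(2)] sub(2)] by blast
    then show ?thesis unfolding Q_def using up[OF pS[OF p(2)] T sub(2)] by blast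
  qed
  show ?thesis
  proof (cases "\<exists>p\<in>Fr 1. Q p")
    case True
    then obtain p0 where p0: "p0 \<in> Fr 1" "Q p0" by blast
    have Q: "Q p" if "p \<in> Fr 1" for p
    proof (rule Fr_connected[where m = 1 and Q = Q and U = p0])
      show "1 < d" using d by simp
    qed (fact Qstep p0 that)+
    have "g U \<subseteq> g V" if U: "U \<in> ?S" and V: "V \<in> ?S" "U \<subseteq> V" for U V
    proof (cases "U = V")
      case False
      obtain p where p: "p \<in> Fr 1" "p \<subseteq> U" using point U by blast
      then have "p \<subset> V" using V False by blast
      then have "g p \<subseteq> g V" using Q[OF p(1)] V(1) unfolding Q_def by blast
      then show ?thesis using down[OF V(1) pS[OF p(1)] \<open>p \<subset> V\<close> U] V(2) False by blast
    qed simp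
    then show ?thesis by blast
  next
    case False
    have "g V \<subseteq> g U" if U: "U \<in> ?S" and V: "V \<in> ?S" "U \<subseteq> V" for U V
    proof (cases "U = V")
      case False
      obtain p where p: "p \<in> Fr 1" "p \<subseteq> U" using point U by blast
      then have pV: "p \<subset> V" using V False by blast
      have "\<not> Q p" using p \<open>\<not> (\<exists>p\<in>Fr 1. Q p)\<close> by blast
      then obtain V' where V': "V' \<in> ?S" "p \<subset> V'" "\<not> g p \<subseteq> g V'" unfolding Q_def by blast
      have "\<not> g p \<subseteq> g V" using up[OF pS[OF p(1)] V(1) pV V'(1,2)] V'(3) by blast
      then have "\<not> g U \<subseteq> g V" using down[OF V(1) U _ pS[OF p(1)] pV] V(2) False by blast
      then show ?thesis using comp[OF U V(1)] V(2) by blast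
    qed simp
    then show ?thesis by blast
  qed
qed

lemma perp_bij_Fr:
  assumes "k \<le> d"
  shows "bij_betw perp (Fr k) (Fr (d - k))"
  by (rule bij_betw_byWitness[of _ perp])
     (use assms perp_Fr perp_Fr[of _ "d - k"] Fr_sub in \<open>auto simp: perp_perp\<close>)

lemma perp_bij_range:
  assumes "a \<le> d" "b \<le> d"
  shows "bij_betw perp (Fr_range a b) (Fr_range (d - b) (d - a))"
  by (rule bij_betw_byWitness[of _ perp])
     (use assms perp_Fr_range[of _ a b] perp_Fr_range[of _ "d - b" "d - a"] Fr_range_sub
       in \<open>auto simp: perp_perp\<close>)

end

section \<open>Order isomorphisms between ranges of ranks\<close>

text \<open>The inverse is carried along as a second map, so that results on F apply to G by
  interchanging the two spaces.\<close>

definition order_iso_on :: "('v set \<Rightarrow> 'w set) \<Rightarrow> ('w set \<Rightarrow> 'v set) \<Rightarrow> 'v set set \<Rightarrow> 'w set set \<Rightarrow> bool" where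
  "order_iso_on F G S T \<longleftrightarrow>
    (\<forall>V\<in>S. F V \<in> T \<and> G (F V) = V) \<and> (\<forall>W\<in>T. G W \<in> S \<and> F (G W) = W) \<and>
    (\<forall>U\<in>S. \<forall>V\<in>S. F U \<subseteq> F V \<longleftrightarrow> U \<subseteq> V)"

lemma order_iso_onD:
  assumes "order_iso_on F G S T"
  shows "\<And>V. V \<in> S \<Longrightarrow> F V \<in> T" "\<And>V. V \<in> S \<Longrightarrow> G (F V) = V"
    "\<And>W. W \<in> T \<Longrightarrow> G W \<in> S" "\<And>W. W \<in> T \<Longrightarrow> F (G W) = W"
    "\<And>U V. \<lbrakk>U \<in> S; V \<in> S\<rbrakk> \<Longrightarrow> F U \<subseteq> F V \<longleftrightarrow> U \<subseteq> V"
  using assms by (auto simp: order_iso_on_def)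

lemma order_iso_on_sym: "order_iso_on F G S T \<Longrightarrow> order_iso_on G F T S"
  unfolding order_iso_on_def by metis

text \<open>The intersection of the images of all members of S above W. It is the forced candidate
  when W is itself the intersection of those members; C gives the intersection a value when there
  are none.\<close>

definition hull_map :: "'v set set \<Rightarrow> 'w set \<Rightarrow> ('v set \<Rightarrow> 'w set) \<Rightarrow> 'v set \<Rightarrow> 'w set" where
  "hull_map S C f W = {x \<in> C. \<forall>V\<in>S. W \<subseteq> V \<longrightarrow> x \<in> f V}"

lemma hull_map_mono: "W \<subseteq> W' \<Longrightarrow> hull_map S C f W \<subseteq> hull_map S C f W'"
  by (auto simp: hull_map_def)

lemma hull_map_upper: "\<lbrakk>V \<in> S; W \<subseteq> V\<rbrakk> \<Longrightarrow> hull_map S C f W \<subseteq> f V"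
  by (auto simp: hull_map_def)

section \<open>From two ranks to the interval between them\<close>

locale two_spaces = A: free_space K \<pi> s M d form + B: free_space K' \<pi>' s' M' d' form'
  for K \<pi> s M d form K' \<pi>' s' M' d' form'

text \<open>The oriented case: f sends the lower rank to the lower and the upper to the upper, and g
  inverts it there.\<close>

locale incidence_iso = two_spaces +
  fixes f g and m n m' n' :: nat
  assumes ranks: "0 < m" "m < n" "n < d" "0 < m'" "m' < n'" "n' < d'"
    and f_low: "U \<in> A.Fr m \<Longrightarrow> f U \<in> B.Fr m' \<and> g (f U) = U"
    and f_high: "U \<in> A.Fr n \<Longrightarrow> f U \<in> B.Fr n' \<and> g (f U) = U"
    and g_low: "U' \<in> B.Fr m' \<Longrightarrow> g U' \<in> A.Fr m \<and> f (g U') = U'"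
    and g_high: "U' \<in> B.Fr n' \<Longrightarrow> g U' \<in> A.Fr n \<and> f (g U') = U'"
    and f_incident: "\<lbrakk>U \<in> A.Fr m; V \<in> A.Fr n\<rbrakk> \<Longrightarrow> f U \<subseteq> f V \<longleftrightarrow> U \<subseteq> V"
begin

lemma reverse: "incidence_iso K' \<pi>' s' M' d' form' K \<pi> s M d form g f m' n' m n"
proof unfold_locales
  fix U V assume "U \<in> B.Fr m'" "V \<in> B.Fr n'"
  then show "g U \<subseteq> g V \<longleftrightarrow> U \<subseteq> V"
    using f_incident[of "g U" "g V"] g_low g_high by simp
qed (simp_all add: ranks f_low f_high g_low g_high)

abbreviation "lift \<equiv> hull_map (A.Fr n) (carrier M') f"
abbreviation "colift \<equiv> hull_map (B.Fr n') (carrier M) g"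

definition between where
  "between U W V \<longleftrightarrow> U \<in> A.Fr m \<and> V \<in> A.Fr n \<and> A.sub W \<and> U \<subseteq> W \<and> W \<subseteq> V"

lemma sub_lift: "B.sub (lift W)"
proof -
  have "lift W = carrier M' \<inter> \<Inter>(f ` {V \<in> A.Fr n. W \<subseteq> V})"
    by (auto simp: hull_map_def)
  then show ?thesis using B.sub_INT[of "f ` {V \<in> A.Fr n. W \<subseteq> V}"] f_high B.Fr_sub by fastforce
qed

lemma lift_lower:
  assumes "U \<in> A.Fr m" "U \<subseteq> W"
  shows "f U \<subseteq> lift W"
proof -
  have "f U \<subseteq> f V" if "V \<in> A.Fr n" "W \<subseteq> V" for V
    using f_incident that assms by blast
  moreover have "f U \<subseteq> carrier M'" using f_low[OF assms(1)] B.Fr_subset by blast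
  ultimately show ?thesis unfolding hull_map_def by blast
qed

text \<open>Although \<open>lift\<close> looks only at rank n above W, it also contains f U' for
  every U' of rank m below W. If \<open>lift W\<close> lies in f V', all these U' lie in V', and
  they span W.\<close>

lemma lift_le_iff:
  assumes W: "between U W V" and V': "V' \<in> A.Fr n"
  shows "lift W \<subseteq> f V' \<longleftrightarrow> W \<subseteq> V'"
proof
  assume le: "lift W \<subseteq> f V'"
  show "W \<subseteq> V'"
  proof (rule A.spanned_by_Fr[of U m])
    fix U' assume "U' \<in> A.Fr m" "U' \<subseteq> W"
    then show "U' \<subseteq> V'" using lift_lower[of U' W] le f_incident[OF _ V'] by blast
  qed (use W V' ranks A.Fr_sub in \<open>auto simp: between_def\<close>)
qed (rule hull_map_upper[OF V'])

text \<open>By \<open>lift_le_iff\<close> the members of rank n' above \<open>lift W\<close> are the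
  f V' with V' above W. Applying g returns the V', whose intersection is W.\<close>

lemma colift_lift:
  assumes W: "between U W V"
  shows "colift (lift W) = W"
proof
  have le: "colift (lift W) \<subseteq> V'" if V': "V' \<in> A.Fr n" "W \<subseteq> V'" for V'
  proof -
    have "colift (lift W) \<subseteq> g (f V')"
    proof (rule hull_map_upper)
      show "f V' \<in> B.Fr n'" using f_high[OF V'(1)] by blast
      show "lift W \<subseteq> f V'" by (rule hull_map_upper[OF V'])
    qed
    then show ?thesis using f_high[OF V'(1)] by simp
  qed
  interpret rev: incidence_iso K' \<pi>' s' M' d' form' K \<pi> s M d form g f m' n' m n by (rule reverse)
  show "colift (lift W) \<subseteq> W"
    by (rule A.cospanned_by_Fr[of V n, OF _ ranks(3) _ _ rev.sub_lift le])
       (use W in \<open>auto simp: between_def\<close>)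
  have "W \<subseteq> g V'" if V': "V' \<in> B.Fr n'" "lift W \<subseteq> V'" for V'
    using lift_le_iff[OF W, of "g V'"] g_high[OF V'(1)] V'(2) by simp
  moreover have "W \<subseteq> carrier M" using W A.sub_subset by (auto simp: between_def)
  ultimately show "W \<subseteq> colift (lift W)" unfolding hull_map_def[of "B.Fr n'"] by blast
qed

lemma lift_low: "U \<in> A.Fr m \<Longrightarrow> lift U = f U"
proof
  assume U: "U \<in> A.Fr m"
  then show "f U \<subseteq> lift U" using lift_lower by blast
  have fU: "f U \<in> B.Fr m'" using f_low U by blast
  obtain V where V: "V \<in> B.Fr n'" "f U \<subseteq> V"
    using B.Fr_above[OF fU, of n'] ranks by auto
  show "lift U \<subseteq> f U"
  proof (rule B.cospanned_by_Fr[of V n', OF V(1) ranks(6) V(2) B.Fr_sub[OF fU] sub_lift])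
    fix V' assume V': "V' \<in> B.Fr n'" "f U \<subseteq> V'"
    then have "U \<subseteq> g V'" using f_incident[OF U, of "g V'"] g_high by simp
    then show "lift U \<subseteq> V'" using hull_map_upper[of "g V'" "A.Fr n" U "carrier M'" f] g_high V' by simp
  qed
qed

lemma lift_high: "V \<in> A.Fr n \<Longrightarrow> lift V = f V"
proof
  assume V: "V \<in> A.Fr n"
  then show "lift V \<subseteq> f V" by (simp add: hull_map_upper)
  have fV: "f V \<in> B.Fr n'" using f_high V by blast
  obtain U where U: "U \<in> B.Fr m'" "U \<subseteq> f V"
    using B.Fr_below[OF fV, of m'] ranks by auto
  show "f V \<subseteq> lift V"
  proof (rule B.spanned_by_Fr[of U m', OF U(1) ranks(4) U(2) B.Fr_sub[OF fV] sub_lift])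
    fix U' assume U': "U' \<in> B.Fr m'" "U' \<subseteq> f V"
    then have "g U' \<subseteq> V" using f_incident[OF _ V, of "g U'"] g_low by simp
    then show "U' \<subseteq> lift V" using lift_lower[of "g U'" V] g_low U' by simp
  qed
qed

lemma between_lift:
  assumes "between U W V"
  shows "f U \<in> B.Fr m'" "f V \<in> B.Fr n'" "B.sub (lift W)" "f U \<subseteq> lift W" "lift W \<subseteq> f V"
proof -
  have b: "U \<in> A.Fr m" "V \<in> A.Fr n" "U \<subseteq> W" "W \<subseteq> V" using assms by (auto simp: between_def)
  show "f U \<in> B.Fr m'" "f V \<in> B.Fr n'" using f_low f_high b by blast+
  show "B.sub (lift W)" "f U \<subseteq> lift W" "lift W \<subseteq> f V"
    by (rule sub_lift lift_lower[OF b(1,3)] hull_map_upper[OF b(2,4)])+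
qed

text \<open>Free submodules are the complemented elements of an interval, which is a lattice-theoretic notion.\<close>

lemma lift_pure:
  assumes W: "between U W V" "A.pure W"
  shows "B.pure (lift W)"
proof -
  interpret rev: incidence_iso K' \<pi>' s' M' d' form' K \<pi> s M d form g f m' n' m n by (rule reverse)
  have UV: "U \<in> A.Fr m" "V \<in> A.Fr n" "A.sub W" "U \<subseteq> W" "W \<subseteq> V" using W by (auto simp: between_def)
  obtain W' where W': "A.sub W'" "U \<subseteq> W'" "W \<inter> W' = U" "A.vsum W W' = V"
    using A.complement_exists[OF W(2) A.Fr_pure[OF UV(2)] UV(5) A.Fr_sub[OF UV(1)] UV(4)] by blast
  have bW': "between U W' V"
    using UV W' A.vsum_upper2[OF UV(3) W'(1)] by (auto simp: between_def)
  note l = between_lift[OF W(1)] and l' = between_lift[OF bW']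
  have revb: "rev.between (f U) Y (f V)" if "B.sub Y" "f U \<subseteq> Y" "Y \<subseteq> f V" for Y
    using that l by (simp add: rev.between_def)
  \<comment> \<open>On the image interval \<open>colift\<close> is monotone with inverse
    \<open>lift\<close>. So the meet is pulled back below W \<inter> W' = U and pushed forward
    again; the sum below is treated in the same way.\<close>
  have "lift W \<inter> lift W' \<subseteq> f U"
  proof -
    let ?Y = "lift W \<inter> lift W'"
    have Y: "rev.between (f U) ?Y (f V)"
      using revb[of ?Y] B.sub_Int l l' by blast
    have "colift ?Y \<subseteq> W \<inter> W'"
      using hull_map_mono[of ?Y "lift W" "B.Fr n'" "carrier M" g]
        hull_map_mono[of ?Y "lift W'" "B.Fr n'" "carrier M" g] colift_lift W(1) bW' by auto
    then have "lift (colift ?Y) \<subseteq> lift U" using W'(3) hull_map_mono by metis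
    then show ?thesis using rev.colift_lift[OF Y] lift_low UV by simp
  qed
  then have int: "lift W \<inter> lift W' = f U" using l l' by blast
  let ?S = "B.vsum (lift W) (lift W')"
  have "f V \<subseteq> ?S"
  proof -
    have up: "lift W \<subseteq> ?S" "lift W' \<subseteq> ?S" using B.vsum_upper1 B.vsum_upper2 l l' by blast+
    have S: "rev.between (f U) ?S (f V)"
      using revb[of ?S] B.sub_vsum[OF l(3) l'(3)] B.vsum_least[OF B.Fr_sub[OF l(2)] l(5) l'(5)] l(4) up
      by blast
    have "W \<subseteq> colift ?S" "W' \<subseteq> colift ?S"
      using hull_map_mono[OF up(1), of "B.Fr n'" "carrier M" g]
        hull_map_mono[OF up(2), of "B.Fr n'" "carrier M" g] colift_lift W(1) bW' by auto
    then have "V \<subseteq> colift ?S" using A.vsum_least[OF rev.sub_lift] W'(4) by blast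
    then have "lift V \<subseteq> lift (colift ?S)" by (rule hull_map_mono)
    then show ?thesis using rev.colift_lift[OF S] lift_high UV by simp
  qed
  then have sum: "?S = f V" using B.vsum_least[OF B.Fr_sub[OF l(2)] l(5) l'(5)] by blast
  show ?thesis
    using B.complemented_pure[OF B.Fr_pure[OF l(1)] B.Fr_pure[OF l(2)] l(3) l'(3) int sum] .
qed

lemma between_exists:
  assumes "W \<in> A.Fr_range m n"
  shows "\<exists>U V. between U W V"
proof -
  obtain k where k: "W \<in> A.Fr k" "m \<le> k" "k \<le> n" using assms by (rule A.Fr_rangeE)
  then show ?thesis
    using A.Fr_below[OF k(1,2)] A.Fr_above[OF k(1,3)] ranks A.Fr_sub[OF k(1)]
    by (auto simp: between_def)
qed

lemma lift_range:
  assumes "W \<in> A.Fr_range m n"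
  shows "lift W \<in> B.Fr_range m' n'"
proof -
  obtain U V where b: "between U W V" using between_exists assms by blast
  have "A.pure W" using assms A.Fr_pure by (auto elim: A.Fr_rangeE)
  then obtain k where k: "lift W \<in> B.Fr k" using B.pure_in_Fr lift_pure[OF b] by blast
  note l = between_lift[OF b]
  show ?thesis using B.Fr_rangeI[OF k] B.Fr_rank_mono[OF l(1) k l(4)] B.Fr_rank_mono[OF k l(2,5)] by blast
qed

lemma lift_order_iso: "order_iso_on lift colift (A.Fr_range m n) (B.Fr_range m' n')"
proof -
  interpret rev: incidence_iso K' \<pi>' s' M' d' form' K \<pi> s M d form g f m' n' m n by (rule reverse)
  have 1: "colift (lift W) = W" if "W \<in> A.Fr_range m n" for W
    using between_exists[OF that] colift_lift by blast
  moreover have "lift (colift W) = W" if "W \<in> B.Fr_range m' n'" for W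
    using rev.between_exists[OF that] rev.colift_lift by blast
  moreover have "lift U \<subseteq> lift V \<longleftrightarrow> U \<subseteq> V" if "U \<in> A.Fr_range m n" "V \<in> A.Fr_range m n" for U V
    using that 1 hull_map_mono[of "lift U" "lift V" "B.Fr n'" "carrier M" g]
      hull_map_mono[of U V "A.Fr n" "carrier M'" f] by auto
  ultimately show ?thesis
    unfolding order_iso_on_def by (simp add: lift_range rev.lift_range)
qed

end

section \<open>Rank under isomorphisms of ranges\<close>

locale range_iso = two_spaces +
  fixes F G and a b a' b' :: nat
  assumes iso: "order_iso_on F G (A.Fr_range a b) (B.Fr_range a' b')"
begin

lemmas isoD = order_iso_onD[OF iso]

lemma reverse: "range_iso K' \<pi>' s' M' d' form' K \<pi> s M d form G F a' b' a b"
  by unfold_locales (rule order_iso_on_sym[OF iso])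

text \<open>Strict chains go to strict chains, so the height above the bottom rank cannot drop.
  Ranks are counted from the bottoms a and a', which are not known to agree; the inverse map turns
  the inequality into equality.\<close>

lemma rank_ge:
  "\<lbrakk>W \<in> A.Fr (a + i); a + i \<le> b\<rbrakk> \<Longrightarrow> \<exists>j\<ge>i. F W \<in> B.Fr (a' + j) \<and> a' + j \<le> b'"
proof (induction i arbitrary: W)
  case 0
  then have "F W \<in> B.Fr_range a' b'" using isoD(1) A.Fr_rangeI by simp
  then obtain k where "F W \<in> B.Fr k" "a' \<le> k" "k \<le> b'" by (rule B.Fr_rangeE)
  then show ?case by (intro exI[of _ "k - a'"]) auto
next
  case (Suc i)
  obtain Y where Y: "Y \<in> A.Fr (a + i)" "Y \<subseteq> W"
    using A.Fr_below[OF Suc.prems(1), of "a + i"] by auto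
  obtain j where j: "i \<le> j" "F Y \<in> B.Fr (a' + j)" using Suc.IH[OF Y(1)] Suc.prems(2) by auto
  have r: "Y \<in> A.Fr_range a b" "W \<in> A.Fr_range a b"
    using A.Fr_rangeI[OF Y(1)] A.Fr_rangeI[OF Suc.prems(1)] Suc.prems(2) by auto
  obtain k where k: "F W \<in> B.Fr k" "a' \<le> k" "k \<le> b'" using isoD(1)[OF r(2)] by (rule B.Fr_rangeE)
  have le: "F Y \<subseteq> F W" using isoD(5)[OF r] Y(2) by blast
  have "F Y \<noteq> F W"
  proof
    assume "F Y = F W"
    then have "Y = W" using isoD(2) r by metis
    then show False using A.Fr_rank_unique[OF Y(1)] Suc.prems(1) by fastforce
  qed
  then have "a' + j \<noteq> k" using B.Fr_eq[OF j(2) _ le] k(1) by blast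
  moreover have "a' + j \<le> k" using B.Fr_rank_mono[OF j(2) k(1) le] .
  ultimately show ?case using k j(1) by (intro exI[of _ "k - a'"]) auto
qed

lemma rank_eq:
  assumes W: "W \<in> A.Fr (a + i)" "a + i \<le> b"
  shows "F W \<in> B.Fr (a' + i)" "a' + i \<le> b'"
proof -
  interpret rev: range_iso K' \<pi>' s' M' d' form' K \<pi> s M d form G F a' b' a b by (rule reverse)
  obtain j where j: "i \<le> j" "F W \<in> B.Fr (a' + j)" "a' + j \<le> b'" using rank_ge[OF W] by blast
  obtain l where l: "j \<le> l" "G (F W) \<in> A.Fr (a + l)" using rev.rank_ge[OF j(2,3)] by blast
  have "G (F W) = W" using isoD(2) A.Fr_rangeI[OF W(1)] W(2) by simp
  then have "W \<in> A.Fr (a + l)" using l(2) by simp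
  then have "a + l = a + i" using A.Fr_rank_unique W(1) by blast
  then have "j = i" using l(1) j(1) by linarith
  then show "F W \<in> B.Fr (a' + i)" "a' + i \<le> b'" using j by auto
qed

end

text \<open>The chosen pair does not matter, by \<open>F_cap_unique\<close> below.\<close>

definition cap_map :: "('v set \<Rightarrow> 'v set \<Rightarrow> bool) \<Rightarrow> ('v set \<Rightarrow> 'w set) \<Rightarrow> 'v set \<Rightarrow> 'w set" where
  "cap_map adj F W = (SOME Y. \<exists>U V. adj U V \<and> U \<inter> V = W \<and> Y = F U \<inter> F V)"

section \<open>One step down in rank\<close>

locale down_step = range_iso K \<pi> s M d form K' \<pi>' s' M' d' form' F G "Suc c" b "Suc c'" b'
  for K \<pi> s M d form K' \<pi>' s' M' d' form' F G c b c' b' +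
  assumes ranks: "Suc c < b" "Suc (Suc c) < d" "Suc c' < b'" "Suc (Suc c') < d'"
begin

lemma reverse_step: "down_step K' \<pi>' s' M' d' form' K \<pi> s M d form G F c' b' c b"
  using ranks reverse by (simp add: down_step_def down_step_axioms_def)

lemma F_low: "U \<in> A.Fr (Suc c) \<Longrightarrow> F U \<in> B.Fr (Suc c')"
  using rank_eq(1)[of U 0] ranks by simp

lemma F_mid: "U \<in> A.Fr (Suc (Suc c)) \<Longrightarrow> F U \<in> B.Fr (Suc (Suc c'))"
  using rank_eq(1)[of U 1] ranks by simp

lemma low_range: "U \<in> A.Fr (Suc c) \<Longrightarrow> U \<in> A.Fr_range (Suc c) b"
  using A.Fr_rangeI[of U "Suc c"] ranks by simp

lemma mid_range: "U \<in> A.Fr (Suc (Suc c)) \<Longrightarrow> U \<in> A.Fr_range (Suc c) b"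
  using A.Fr_rangeI[of U "Suc (Suc c)"] ranks by simp

text \<open>Freeness of the sum is not part of the order, but uniqueness of an upper bound of rank c
  + 2 is: any upper bound of the images is pulled back by G. On the other side
  \<open>unique_join_sum\<close> recovers freeness.\<close>

lemma F_adj:
  assumes UV: "A.adj (Suc c) U V"
  shows "B.adj (Suc c') (F U) (F V)" "F (A.vsum U V) = B.vsum (F U) (F V)"
proof -
  interpret rev: down_step K' \<pi>' s' M' d' form' K \<pi> s M d form G F c' b' c b by (rule reverse_step)
  note U = A.adj_Fr(1)[OF UV] and V = A.adj_Fr(2)[OF UV] and S = A.adj_Fr(3)[OF UV]
  let ?S = "A.vsum U V"
  note r = low_range[OF U] low_range[OF V] mid_range[OF S]
  have le: "F U \<subseteq> F ?S" "F V \<subseteq> F ?S"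
    using isoD(5)[OF r(1,3)] isoD(5)[OF r(2,3)] A.vsum_upper1 A.vsum_upper2 A.Fr_sub U V by blast+
  have "B.unique_join (Suc c') (F U) (F V)"
    unfolding B.unique_join_def
  proof (rule ex1I[of _ "F ?S"])
    show "F ?S \<in> B.Fr (Suc (Suc c')) \<and> F U \<subseteq> F ?S \<and> F V \<subseteq> F ?S" using F_mid[OF S] le by blast
    fix T assume T: "T \<in> B.Fr (Suc (Suc c')) \<and> F U \<subseteq> T \<and> F V \<subseteq> T"
    then have GT: "G T \<in> A.Fr (Suc (Suc c))" "F (G T) = T"
      using rev.F_mid isoD(4) rev.mid_range by blast+
    then have "U \<subseteq> G T" "V \<subseteq> G T"
      using isoD(5)[OF r(1) mid_range[OF GT(1)]] isoD(5)[OF r(2) mid_range[OF GT(1)]] T by auto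
    then have "?S \<subseteq> G T" using A.vsum_least[OF A.Fr_sub[OF GT(1)]] by blast
    then have "?S = G T" using A.Fr_eq[OF S GT(1)] by blast
    then show "T = F ?S" using GT(2) by simp
  qed
  then have S': "B.vsum (F U) (F V) \<in> B.Fr (Suc (Suc c'))"
    using B.unique_join_sum[OF F_low[OF U] F_low[OF V] ranks(4)] by blast
  then show "B.adj (Suc c') (F U) (F V)" using F_low U V by (simp add: B.adj_def)
  show "F ?S = B.vsum (F U) (F V)"
    using B.Fr_eq[OF S' F_mid[OF S]] B.vsum_least[OF B.Fr_sub[OF F_mid[OF S]] le] by blast
qed

lemma F_meet:
  assumes U: "U \<in> A.Fr (Suc (Suc c))" and V: "V \<in> A.Fr (Suc (Suc c))" and um: "A.unique_meet (Suc c) U V"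
  shows "B.unique_meet (Suc c') (F U) (F V)"
proof -
  interpret rev: down_step K' \<pi>' s' M' d' form' K \<pi> s M d form G F c' b' c b by (rule reverse_step)
  obtain W where W: "W \<in> A.Fr (Suc c)" "W \<subseteq> U" "W \<subseteq> V" using um unfolding A.unique_meet_def by blast
  have uniq: "W' = W" if "W' \<in> A.Fr (Suc c)" "W' \<subseteq> U" "W' \<subseteq> V" for W'
    using um that W unfolding A.unique_meet_def by blast
  note r = low_range[OF W(1)] mid_range[OF U] mid_range[OF V]
  show ?thesis
    unfolding B.unique_meet_def
  proof (rule ex1I[of _ "F W"])
    show "F W \<in> B.Fr (Suc c') \<and> F W \<subseteq> F U \<and> F W \<subseteq> F V"
      using F_low[OF W(1)] isoD(5)[OF r(1,2)] isoD(5)[OF r(1,3)] W by blast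
    fix T assume T: "T \<in> B.Fr (Suc c') \<and> T \<subseteq> F U \<and> T \<subseteq> F V"
    then have GT: "G T \<in> A.Fr (Suc c)" "F (G T) = T"
      using rev.F_low isoD(4) rev.low_range by blast+
    then have "G T \<subseteq> U" "G T \<subseteq> V"
      using isoD(5)[OF low_range[OF GT(1)] r(2)] isoD(5)[OF low_range[OF GT(1)] r(3)] T by auto
    then have "G T = W" using uniq[OF GT(1)] by blast
    then show "T = F W" using GT(2) by simp
  qed
qed

text \<open>The triangle and the unique meet of its sums are transported by F, and
  \<open>triangle_meet\<close> reads off the common intersection among the images.\<close>

lemma F_triangle:
  assumes UV: "A.adj (Suc c) U V" and z: "z \<in> carrier M" "z \<notin> A.nbhd (A.vsum U V)"
  defines "Z \<equiv> A.ext (U \<inter> V) z"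
  shows "F U \<inter> F V = F U \<inter> F Z" "F U \<inter> F V = F V \<inter> F Z"
proof -
  note t = A.triangle[OF UV z, folded Z_def]
  have um: "B.unique_meet (Suc c') (B.vsum (F U) (F V)) (B.vsum (F U) (F Z))"
    using F_meet[OF A.adj_Fr(3)[OF UV] A.adj_Fr(3)[OF t(1)] t(5)] F_adj(2)[OF UV] F_adj(2)[OF t(1)] by simp
  show "F U \<inter> F V = F U \<inter> F Z" "F U \<inter> F V = F V \<inter> F Z"
    by (rule B.triangle_meet[OF F_adj(1)[OF UV] F_adj(1)[OF t(1)] F_adj(1)[OF t(2)] um])+
qed

text \<open>Both pairs are joined to one vertex Z through their common meet and outside both sums.
  The vertices U and U' need not be adjacent, so a further vertex, given by y, links the triangles
  on U, Z and on U', Z.\<close>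

lemma F_cap_unique:
  assumes UV: "A.adj (Suc c) U V" and UV': "A.adj (Suc c) U' V'" and W: "U \<inter> V = U' \<inter> V'"
  shows "F U \<inter> F V = F U' \<inter> F V'"
proof -
  obtain z where z: "z \<in> carrier M" "z \<notin> A.nbhd (A.vsum U V)" "z \<notin> A.nbhd (A.vsum U' V')"
    using A.avoid_two_nbhds[OF A.adj_Fr(3)[OF UV] A.adj_Fr(3)[OF UV'] ranks(2) ranks(2)] by blast
  define Z where "Z = A.ext (U \<inter> V) z"
  note t = A.triangle[OF UV z(1,2), folded Z_def]
  note t' = A.triangle[OF UV' z(1,3), folded W, folded Z_def]
  obtain y where y: "y \<in> carrier M" "y \<notin> A.nbhd (A.vsum U Z)" "y \<notin> A.nbhd (A.vsum U' Z)"
    using A.avoid_two_nbhds[OF A.adj_Fr(3)[OF t(1)] A.adj_Fr(3)[OF t'(1)] ranks(2) ranks(2)] by blast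
  have "F U \<inter> F V = F U \<inter> F Z" using F_triangle(1)[OF UV z(1,2)] Z_def by simp
  also have "\<dots> = F Z \<inter> F (A.ext (U \<inter> V) y)" using F_triangle(2)[OF t(1) y(1,2)] t(3) by simp
  also have "\<dots> = F U' \<inter> F Z" using F_triangle(2)[OF t'(1) y(1,3)] t'(3) by simp
  also have "\<dots> = F U' \<inter> F V'" using F_triangle(1)[OF UV' z(1,3)] Z_def W by simp
  finally show ?thesis .
qed

abbreviation "cap \<equiv> cap_map (A.adj (Suc c)) F"
abbreviation "cocap \<equiv> cap_map (B.adj (Suc c')) G"

lemma cap_eq:
  assumes "A.adj (Suc c) U V"
  shows "cap (U \<inter> V) = F U \<inter> F V"
  unfolding cap_map_def
proof (rule some_equality)
  show "\<exists>U' V'. A.adj (Suc c) U' V' \<and> U' \<inter> V' = U \<inter> V \<and> F U \<inter> F V = F U' \<inter> F V'"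
    using assms by blast
  fix Y assume "\<exists>U' V'. A.adj (Suc c) U' V' \<and> U' \<inter> V' = U \<inter> V \<and> Y = F U' \<inter> F V'"
  then show "Y = F U \<inter> F V" using F_cap_unique assms by blast
qed

lemma cap_at:
  assumes W: "W \<in> A.Fr c" and U: "U \<in> A.Fr (Suc c)" "W \<subseteq> U"
  obtains V where "A.adj (Suc c) U V" "U \<inter> V = W" "cap W = F U \<inter> F V"
  using A.adj_exists[OF W U] ranks cap_eq by fastforce

lemma above_low:
  assumes "W \<in> A.Fr c"
  obtains U where "U \<in> A.Fr (Suc c)" "W \<subseteq> U"
  using A.Fr_above[OF assms, of "Suc c"] ranks by auto

lemma cap_Fr:
  assumes W: "W \<in> A.Fr c"
  shows "cap W \<in> B.Fr c'"
proof -
  obtain U where U: "U \<in> A.Fr (Suc c)" "W \<subseteq> U" using above_low[OF W] by blast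
  obtain V where V: "A.adj (Suc c) U V" "U \<inter> V = W" "cap W = F U \<inter> F V" using cap_at[OF W U] by blast
  show ?thesis using B.Fr_meet B.adj_Fr[OF F_adj(1)[OF V(1)]] V(3) by simp
qed

lemma cocap_cap:
  assumes W: "W \<in> A.Fr c"
  shows "cocap (cap W) = W"
proof -
  interpret rev: down_step K' \<pi>' s' M' d' form' K \<pi> s M d form G F c' b' c b by (rule reverse_step)
  obtain U where U: "U \<in> A.Fr (Suc c)" "W \<subseteq> U" using above_low[OF W] by blast
  obtain V where V: "A.adj (Suc c) U V" "U \<inter> V = W" "cap W = F U \<inter> F V" using cap_at[OF W U] by blast
  have "cocap (F U \<inter> F V) = G (F U) \<inter> G (F V)" using rev.cap_eq[OF F_adj(1)[OF V(1)]] .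
  also have "\<dots> = W" using isoD(2)[OF low_range] A.adj_Fr[OF V(1)] V(2) by simp
  finally show ?thesis using V(3) by simp
qed

text \<open>The pair defining \<open>cap W\<close> may start with any U of rank c + 1 above W, in
  particular with one between W and V.\<close>

lemma cap_le:
  assumes W: "W \<in> A.Fr c" and V: "V \<in> A.Fr_range (Suc c) b" "W \<subseteq> V"
  shows "cap W \<subseteq> F V"
proof -
  obtain k where k: "V \<in> A.Fr k" "Suc c \<le> k" using V(1) by (rule A.Fr_rangeE)
  obtain U where U: "U \<in> A.Fr (Suc c)" "W \<subseteq> U" "U \<subseteq> V"
    using A.Fr_between[OF W k(1) V(2), of "Suc c"] k(2) by auto
  obtain U' where "cap W = F U \<inter> F U'" using cap_at[OF W U(1,2)] by blast
  moreover have "F U \<subseteq> F V" using isoD(5)[OF low_range[OF U(1)] V(1)] U(3) by blast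
  ultimately show ?thesis by blast
qed

definition "extF W = (if W \<in> A.Fr c then cap W else F W)"
definition "extG W = (if W \<in> B.Fr c' then cocap W else G W)"

lemma range_cases: "V \<in> A.Fr_range c b \<longleftrightarrow> V \<in> A.Fr c \<or> V \<in> A.Fr_range (Suc c) b"
proof -
  have "{c..b} = insert c {Suc c..b}" using ranks by auto
  then show ?thesis by (simp add: A.Fr_range_def)
qed

lemma range_disjoint: "V \<in> A.Fr_range (Suc c) b \<Longrightarrow> V \<notin> A.Fr c"
  using A.Fr_range_iff by (metis Suc_n_not_le_n)

lemma ext_iso: "order_iso_on extF extG (A.Fr_range c b) (B.Fr_range c' b')"
proof -
  interpret rev: down_step K' \<pi>' s' M' d' form' K \<pi> s M d form G F c' b' c b by (rule reverse_step)
  have FR: "F V \<in> B.Fr_range (Suc c') b'" "F V \<notin> B.Fr c'" "extF V = F V" if "V \<in> A.Fr_range (Suc c) b" for V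
    using isoD(1)[OF that] rev.range_disjoint range_disjoint[OF that] by (auto simp: extF_def)
  have GR: "G V \<in> A.Fr_range (Suc c) b" "G V \<notin> A.Fr c" "extG V = G V" if "V \<in> B.Fr_range (Suc c') b'" for V
    using isoD(3)[OF that] range_disjoint rev.range_disjoint[OF that] by (auto simp: extG_def)
  have FL: "extF V \<in> B.Fr c'" "extF V = cap V" if "V \<in> A.Fr c" for V
    using that cap_Fr by (auto simp: extF_def)
  have GL: "extG V \<in> A.Fr c" "extG V = cocap V" if "V \<in> B.Fr c'" for V
    using that rev.cap_Fr by (auto simp: extG_def)
  show ?thesis
    unfolding order_iso_on_def
  proof (intro conjI ballI)
    fix V assume V: "V \<in> A.Fr_range c b"
    show "extF V \<in> B.Fr_range c' b'"
      using V FR FL(1) unfolding range_cases rev.range_cases by auto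
    show "extG (extF V) = V"
      using V unfolding range_cases
    proof
      assume "V \<in> A.Fr c"
      then show ?thesis using FL[of V] GL(2)[of "extF V"] cocap_cap by simp
    next
      assume "V \<in> A.Fr_range (Suc c) b"
      then show ?thesis using FR[of V] GR(3)[of "F V"] isoD(2) by simp
    qed
  next
    fix V assume V: "V \<in> B.Fr_range c' b'"
    show "extG V \<in> A.Fr_range c b"
      using V GR GL(1) unfolding range_cases rev.range_cases by auto
    show "extF (extG V) = V"
      using V unfolding rev.range_cases
    proof
      assume "V \<in> B.Fr c'"
      then show ?thesis using GL[of V] FL(2)[of "extG V"] rev.cocap_cap by simp
    next
      assume "V \<in> B.Fr_range (Suc c') b'"
      then show ?thesis using GR[of V] FR(3)[of "G V"] isoD(4) by simp
    qed
  next
    fix U V assume U: "U \<in> A.Fr_range c b" and V: "V \<in> A.Fr_range c b"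
    have rank: "\<not> V' \<subseteq> U'" if "U' \<in> A.Fr c" "V' \<in> A.Fr_range (Suc c) b" for U' V'
      using that A.Fr_rank_mono by (metis A.Fr_rangeE Suc_n_not_le_n le_trans)
    have rank': "\<not> V' \<subseteq> U'" if "U' \<in> B.Fr c'" "V' \<in> B.Fr_range (Suc c') b'" for U' V'
      using that B.Fr_rank_mono by (metis B.Fr_rangeE Suc_n_not_le_n le_trans)
    consider "U \<in> A.Fr c" "V \<in> A.Fr c" | "U \<in> A.Fr c" "V \<in> A.Fr_range (Suc c) b"
      | "U \<in> A.Fr_range (Suc c) b" "V \<in> A.Fr c"
      | "U \<in> A.Fr_range (Suc c) b" "V \<in> A.Fr_range (Suc c) b"
      using U V range_cases by blast
    then show "extF U \<subseteq> extF V \<longleftrightarrow> U \<subseteq> V"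
    proof cases
      case 1
      have "U = V" if "extF U \<subseteq> extF V"
        using B.Fr_eq[OF FL(1)[OF 1(1)] FL(1)[OF 1(2)] that] FL(2) cocap_cap 1 by metis
      then show ?thesis using A.Fr_eq[OF 1] by blast
    next
      case 2
      have "U \<subseteq> V" if "cap U \<subseteq> F V"
        using rev.cap_le[OF cap_Fr[OF 2(1)] FR(1)[OF 2(2)] that] cocap_cap[OF 2(1)] isoD(2)[OF 2(2)] by simp
      then show ?thesis using cap_le 2 FL(2) FR(3) by auto
    next
      case 3
      then show ?thesis using rank[OF 3(2,1)] rank'[OF FL(1)[OF 3(2)] FR(1)[OF 3(1)]] FR(3)[OF 3(1)] by simp
    next
      case 4
      then show ?thesis using FR(3) isoD(5) by simp
    qed
  qed
qed

lemma ext_agrees: "V \<in> A.Fr_range (Suc c) b \<Longrightarrow> extF V = F V"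
  using range_disjoint by (simp add: extF_def)

end

section \<open>Extension of isomorphisms\<close>

text \<open>The action on vertices of an isomorphism of flag complexes: the direction of an
  inclusion is not part of the structure and may be reversed.\<close>

definition comparability_map :: "('v set \<Rightarrow> 'w set) \<Rightarrow> 'v set set \<Rightarrow> 'w set set \<Rightarrow> bool" where
  "comparability_map f S T \<longleftrightarrow> bij_betw f S T \<and>
    (\<forall>U\<in>S. \<forall>V\<in>S. (f U \<subseteq> f V \<or> f V \<subseteq> f U) \<longleftrightarrow> (U \<subseteq> V \<or> V \<subseteq> U))"

lemma comparability_mapD:
  assumes "comparability_map f S T"
  shows "bij_betw f S T" "inj_on f S" "\<And>U. U \<in> S \<Longrightarrow> f U \<in> T"
    "\<And>U V. \<lbrakk>U \<in> S; V \<in> S\<rbrakk> \<Longrightarrow> (f U \<subseteq> f V \<or> f V \<subseteq> f U) \<longleftrightarrow> (U \<subseteq> V \<or> V \<subseteq> U)"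
  using assms by (auto simp: comparability_map_def bij_betw_def)

text \<open>If f U \<subseteq> f V while V \<subseteq> U, monotonicity gives f U = f V, against
  injectivity. So inclusion is reflected as well.\<close>

lemma monotone_comparability_map:
  assumes f: "comparability_map f S T"
    and mono: "\<And>U V. \<lbrakk>U \<in> S; V \<in> S; U \<subseteq> V\<rbrakk> \<Longrightarrow> f U \<subseteq> f V"
  shows "order_iso_on f (inv_into S f) S T"
proof -
  note D = comparability_mapD[OF f]
  have "U \<subseteq> V" if UV: "U \<in> S" "V \<in> S" "f U \<subseteq> f V" for U V
  proof (rule ccontr)
    assume n: "\<not> U \<subseteq> V"
    then have "V \<subseteq> U" using D(4)[OF UV(1,2)] UV(3) by blast
    then have "f V = f U" using mono UV by blast
    then show False using D(2) UV n by (metis inj_onD order_refl)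
  qed
  then have "f U \<subseteq> f V \<longleftrightarrow> U \<subseteq> V" if "U \<in> S" "V \<in> S" for U V using mono that by blast
  moreover have "inv_into S f W \<in> S" "f (inv_into S f W) = W" if "W \<in> T" for W
    using that D(1) by (auto simp: bij_betw_def inv_into_into f_inv_into_f)
  ultimately show ?thesis
    unfolding order_iso_on_def using D(2,3) by simp
qed

lemma order_iso_on_comparability_map:
  assumes "order_iso_on F G S T"
  shows "comparability_map F S T"
proof -
  note D = order_iso_onD[OF assms]
  have "bij_betw F S T"
    by (rule bij_betw_byWitness[of S G]) (use D in auto)
  then show ?thesis using D(5) by (simp add: comparability_map_def)
qed

context two_spaces
begin

lemma swap: "two_spaces K' \<pi>' s' M' d' form' K \<pi> s M d form"
  by unfold_locales

lemma comparability_perp: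
  assumes f: "comparability_map f S T" and T: "\<And>V. V \<in> T \<Longrightarrow> B.sub V"
    and bij: "bij_betw B.perp T T'"
  shows "comparability_map (B.perp \<circ> f) S T'"
  unfolding comparability_map_def
proof (intro conjI ballI)
  note D = comparability_mapD[OF f]
  show "bij_betw (B.perp \<circ> f) S T'" using bij_betw_trans[OF D(1) bij] .
  fix U V assume "U \<in> S" "V \<in> S"
  then show "((B.perp \<circ> f) U \<subseteq> (B.perp \<circ> f) V \<or> (B.perp \<circ> f) V \<subseteq> (B.perp \<circ> f) U) \<longleftrightarrow> (U \<subseteq> V \<or> V \<subseteq> U)"
    using D(4)[of U V] D(3) T B.perp_subset_iff by auto
qed

text \<open>The two lower ends descend together and reach 0 together: strictly between 0 and the
  dimension a rank has at least two free submodules, whereas rank 0 has one. In this way equality of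
  the lower ends is found rather than assumed.\<close>

lemma down_all:
  assumes "order_iso_on F G (A.Fr_range a b) (B.Fr_range a' b')"
    "a < b" "Suc a < d" "a' < b'" "Suc a' < d'"
  shows "\<exists>F2 G2. order_iso_on F2 G2 (A.Fr_range 0 b) (B.Fr_range 0 b') \<and> (\<forall>W\<in>A.Fr_range a b. F2 W = F W)"
  using assms
proof (induction a arbitrary: a' F G)
  case 0
  interpret R: range_iso K \<pi> s M d form K' \<pi>' s' M' d' form' F G 0 b a' b'
    using 0 by unfold_locales
  interpret rev: range_iso K' \<pi>' s' M' d' form' K \<pi> s M d form G F a' b' 0 b by (rule R.reverse)
  have "a' = 0"
  proof (rule ccontr)
    assume "a' \<noteq> 0"
    then obtain U V where UV: "U \<in> B.Fr a'" "V \<in> B.Fr a'" "U \<noteq> V"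
      using B.two_Fr[of a'] 0 by auto
    then have "G U \<in> A.Fr 0" "G V \<in> A.Fr 0" using rev.rank_eq(1)[of U 0] rev.rank_eq(1)[of V 0] 0 by auto
    then have "G U = G V" using A.Fr_zero by metis
    moreover have "U \<in> B.Fr_range a' b'" "V \<in> B.Fr_range a' b'" using UV B.Fr_rangeI 0 by auto
    ultimately show False using R.isoD(4) UV(3) by metis
  qed
  then show ?case using 0 by blast
next
  case (Suc c)
  interpret R: range_iso K \<pi> s M d form K' \<pi>' s' M' d' form' F G "Suc c" b a' b'
    using Suc by unfold_locales
  have "a' \<noteq> 0"
  proof
    assume a': "a' = 0"
    obtain U V where UV: "U \<in> A.Fr (Suc c)" "V \<in> A.Fr (Suc c)" "U \<noteq> V"
      using A.two_Fr[of "Suc c"] Suc.prems by auto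
    then have "F U \<in> B.Fr 0" "F V \<in> B.Fr 0"
      using R.rank_eq(1)[of U 0] R.rank_eq(1)[of V 0] Suc.prems a' by auto
    then have "F U = F V" using B.Fr_zero by metis
    moreover have "U \<in> A.Fr_range (Suc c) b" "V \<in> A.Fr_range (Suc c) b"
      using UV A.Fr_rangeI Suc.prems by auto
    ultimately show False using R.isoD(2) UV(3) by metis
  qed
  then obtain c' where c': "a' = Suc c'" by (cases a') auto
  interpret S: down_step K \<pi> s M d form K' \<pi>' s' M' d' form' F G c b c' b'
    using Suc.prems c' by unfold_locales auto
  obtain F2 G2 where F2: "order_iso_on F2 G2 (A.Fr_range 0 b) (B.Fr_range 0 b')"
      "\<forall>W\<in>A.Fr_range c b. F2 W = S.extF W"
    using Suc.IH[OF S.ext_iso] Suc.prems c' by auto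
  have "F2 W = F W" if "W \<in> A.Fr_range (Suc c) b" for W
    using F2(2) S.ext_agrees[OF that] S.range_cases that by simp
  then show ?case using F2(1) by blast
qed

lemma dual_iso:
  assumes F: "order_iso_on F G (A.Fr_range a b) (B.Fr_range a' b')"
    and le: "a \<le> d" "b \<le> d" "a' \<le> d'" "b' \<le> d'"
  shows "order_iso_on (B.perp \<circ> F \<circ> A.perp) (A.perp \<circ> G \<circ> B.perp)
    (A.Fr_range (d - b) (d - a)) (B.Fr_range (d' - b') (d' - a'))"
proof -
  note D = order_iso_onD[OF F]
  have pA: "A.perp V \<in> A.Fr_range a b" if "V \<in> A.Fr_range (d - b) (d - a)" for V
    using A.perp_Fr_range[OF that] le by simp
  have pB: "B.perp V \<in> B.Fr_range a' b'" if "V \<in> B.Fr_range (d' - b') (d' - a')" for V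
    using B.perp_Fr_range[OF that] le by simp
  show ?thesis
    unfolding order_iso_on_def comp_def
  proof (intro conjI ballI)
    fix V assume V: "V \<in> A.Fr_range (d - b) (d - a)"
    show "B.perp (F (A.perp V)) \<in> B.Fr_range (d' - b') (d' - a')"
      using B.perp_Fr_range D(1) pA V by blast
    show "A.perp (G (B.perp (B.perp (F (A.perp V))))) = V"
      using D(1,2)[OF pA[OF V]] B.perp_perp[OF B.Fr_range_sub] A.perp_perp[OF A.Fr_range_sub[OF V]] by simp
  next
    fix V assume V: "V \<in> B.Fr_range (d' - b') (d' - a')"
    show "A.perp (G (B.perp V)) \<in> A.Fr_range (d - b) (d - a)"
      using A.perp_Fr_range D(3) pB V by blast
    show "B.perp (F (A.perp (A.perp (G (B.perp V))))) = V"
      using D(3,4)[OF pB[OF V]] A.perp_perp[OF A.Fr_range_sub] B.perp_perp[OF B.Fr_range_sub[OF V]] by simp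
  next
    fix U V assume U: "U \<in> A.Fr_range (d - b) (d - a)" and V: "V \<in> A.Fr_range (d - b) (d - a)"
    show "B.perp (F (A.perp U)) \<subseteq> B.perp (F (A.perp V)) \<longleftrightarrow> U \<subseteq> V"
      using B.perp_subset_iff[OF B.Fr_range_sub B.Fr_range_sub, OF D(1)[OF pA[OF U]] D(1)[OF pA[OF V]]]
        D(5)[OF pA[OF V] pA[OF U]] A.perp_subset_iff[OF A.Fr_range_sub[OF V] A.Fr_range_sub[OF U]] by simp
  qed
qed

lemma extend_full:
  assumes F: "order_iso_on F G (A.Fr_range m n) (B.Fr_range m' n')"
    and r: "0 < m" "m < n" "n < d" "0 < m'" "m' < n'" "n' < d'"
  shows "\<exists>F2 G2. order_iso_on F2 G2 (A.Fr_range 0 d) (B.Fr_range 0 d') \<and> (\<forall>W\<in>A.Fr_range m n. F2 W = F W)"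
proof -
  obtain F1 G1 where F1: "order_iso_on F1 G1 (A.Fr_range 0 n) (B.Fr_range 0 n')"
      "\<forall>W\<in>A.Fr_range m n. F1 W = F W"
    using down_all[OF F] r by auto
  have "order_iso_on (B.perp \<circ> F1 \<circ> A.perp) (A.perp \<circ> G1 \<circ> B.perp)
      (A.Fr_range (d - n) d) (B.Fr_range (d' - n') d')"
    using dual_iso[OF F1(1)] r by simp
  moreover have "d - n < d" "Suc (d - n) < d" "d' - n' < d'" "Suc (d' - n') < d'" using r by auto
  \<comment> \<open>After dualising, the ranks missing above n have become those below d - n, so the
    descent applies a second time; dualising back completes the map.\<close>
  ultimately obtain F3 G3 where F3: "order_iso_on F3 G3 (A.Fr_range 0 d) (B.Fr_range 0 d')"
      "\<forall>W\<in>A.Fr_range (d - n) d. F3 W = B.perp (F1 (A.perp W))"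
    using down_all[of "B.perp \<circ> F1 \<circ> A.perp" "A.perp \<circ> G1 \<circ> B.perp" "d - n" d "d' - n'" d'] by auto
  have F4: "order_iso_on (B.perp \<circ> F3 \<circ> A.perp) (A.perp \<circ> G3 \<circ> B.perp) (A.Fr_range 0 d) (B.Fr_range 0 d')"
    using dual_iso[OF F3(1)] by simp
  have "B.perp (F3 (A.perp W)) = F W" if W: "W \<in> A.Fr_range m n" for W
  proof -
    have W0: "W \<in> A.Fr_range 0 n" using W by (auto elim!: A.Fr_rangeE intro: A.Fr_rangeI)
    then have "A.perp W \<in> A.Fr_range (d - n) d" using A.perp_Fr_range[of W 0 n] by simp
    then have "F3 (A.perp W) = B.perp (F1 W)" using F3(2) A.perp_perp[OF A.Fr_range_sub[OF W]] by simp
    then show ?thesis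
      using B.perp_perp[OF B.Fr_range_sub[OF order_iso_onD(1)[OF F1(1) W0]]] F1(2) W by simp
  qed
  then show ?thesis using F4 by auto
qed

lemma full_rank:
  assumes F: "order_iso_on F G (A.Fr_range 0 d) (B.Fr_range 0 d')"
  shows "d = d'" "V \<in> A.Fr k \<Longrightarrow> F V \<in> B.Fr k"
proof -
  interpret R: range_iso K \<pi> s M d form K' \<pi>' s' M' d' form' F G 0 d 0 d'
    using F by unfold_locales
  interpret rev: range_iso K' \<pi>' s' M' d' form' K \<pi> s M d form G F 0 d' 0 d by (rule R.reverse)
  have "d \<le> d'" using R.rank_eq(2)[of "carrier M" d] A.carrier_in_Fr by simp
  moreover have "d' \<le> d" using rev.rank_eq(2)[of "carrier M'" d'] B.carrier_in_Fr by simp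
  ultimately show "d = d'" by simp
  show "F V \<in> B.Fr k" if "V \<in> A.Fr k" using R.rank_eq(1)[of V k] that A.Fr_le_dim[OF that] by simp
qed

lemma extend_oriented:
  assumes f: "comparability_map f (A.Fr m \<union> A.Fr n) (B.Fr m' \<union> B.Fr n')"
    and r: "0 < m" "m < n" "n < d" "0 < m'" "m' < n'" "n' < d'"
    and side: "\<And>U. U \<in> A.Fr m \<Longrightarrow> f U \<in> B.Fr m'" "\<And>V. V \<in> A.Fr n \<Longrightarrow> f V \<in> B.Fr n'"
  shows "\<exists>F G. order_iso_on F G (A.Fr_range 0 d) (B.Fr_range 0 d') \<and> (\<forall>W\<in>A.Fr m \<union> A.Fr n. F W = f W)"
proof -
  let ?S = "A.Fr m \<union> A.Fr n"
  note D = comparability_mapD[OF f]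
  define g where "g = inv_into ?S f"
  have gf: "g (f U) = U" if "U \<in> ?S" for U using that D(2) by (simp add: g_def)
  have fg: "g W \<in> ?S" "f (g W) = W" if "W \<in> B.Fr m' \<union> B.Fr n'" for W
    using that D(1) unfolding g_def bij_betw_def by (metis inv_into_into, metis f_inv_into_f)
  have disj: "W \<in> B.Fr m' \<Longrightarrow> W \<notin> B.Fr n'" for W using B.Fr_rank_unique r by blast
  interpret I: incidence_iso K \<pi> s M d form K' \<pi>' s' M' d' form' f g m n m' n'
  proof unfold_locales
    show "f U \<in> B.Fr m' \<and> g (f U) = U" if "U \<in> A.Fr m" for U using side gf that by blast
    show "f U \<in> B.Fr n' \<and> g (f U) = U" if "U \<in> A.Fr n" for U using side gf that by blast
    show "g W \<in> A.Fr m \<and> f (g W) = W" if "W \<in> B.Fr m'" for W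
      using fg[of W] that disj[of W] side(2)[of "g W"] by auto
    show "g W \<in> A.Fr n \<and> f (g W) = W" if "W \<in> B.Fr n'" for W
      using fg[of W] that disj[of W] side(1)[of "g W"] by auto
    show "f U \<subseteq> f V \<longleftrightarrow> U \<subseteq> V" if U: "U \<in> A.Fr m" and V: "V \<in> A.Fr n" for U V
    proof -
      have "\<not> V \<subseteq> U" using A.Fr_rank_mono[OF V U] r by auto
      moreover have "\<not> f V \<subseteq> f U" using B.Fr_rank_mono[OF side(2)[OF V] side(1)[OF U]] r by auto
      ultimately show ?thesis using D(4)[of U V] U V by blast
    qed
  qed (use r in auto)
  obtain F G where F: "order_iso_on F G (A.Fr_range 0 d) (B.Fr_range 0 d')"
      "\<forall>W\<in>A.Fr_range m n. F W = I.lift W"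
    using extend_full[OF I.lift_order_iso r] by blast
  have "F W = f W" if "W \<in> ?S" for W
    using that F(2) I.lift_low I.lift_high A.Fr_rangeI[of W m m n] A.Fr_rangeI[of W n m n] r by auto
  then show ?thesis using F(1) by blast
qed

text \<open>Distinct comparable images cannot have equal rank, so along an edge the image of one end
  determines the side of the other. Two members of rank m with free sum have a common neighbour of
  rank n, which spreads the choice by connectedness.\<close>

lemma sides:
  assumes f: "comparability_map f (A.Fr m \<union> A.Fr n) (B.Fr m' \<union> B.Fr n')"
    and r: "0 < m" "m < n" "n < d" "0 < m'" "m' < n'" "n' < d'"
  shows "(\<forall>U\<in>A.Fr m. f U \<in> B.Fr m') \<and> (\<forall>V\<in>A.Fr n. f V \<in> B.Fr n') \<or>
    (\<forall>U\<in>A.Fr m. f U \<in> B.Fr n') \<and> (\<forall>V\<in>A.Fr n. f V \<in> B.Fr m')"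
proof -
  let ?S = "A.Fr m \<union> A.Fr n"
  note D = comparability_mapD[OF f]
  have cases: "f W \<in> B.Fr m' \<or> f W \<in> B.Fr n'" if "W \<in> ?S" for W using D(3)[OF that] by blast
  have disj: "W \<in> B.Fr m' \<Longrightarrow> W \<notin> B.Fr n'" for W using B.Fr_rank_unique r by blast
  have flip: "f U \<in> B.Fr m' \<longleftrightarrow> f V \<in> B.Fr n'" if UV: "U \<in> A.Fr m" "V \<in> A.Fr n" "U \<subseteq> V" for U V
  proof -
    have S: "U \<in> ?S" "V \<in> ?S" using UV by blast+
    have "U \<noteq> V" using UV A.Fr_rank_unique r by blast
    then have ne: "f U \<noteq> f V" using D(2) S by (metis inj_onD)
    have "f U \<subseteq> f V \<or> f V \<subseteq> f U" using D(4)[OF S] UV(3) by blast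
    then have "\<not> (f U \<in> B.Fr k \<and> f V \<in> B.Fr k)" for k using B.Fr_eq ne by metis
    then show ?thesis using cases[OF S(1)] cases[OF S(2)] disj by blast
  qed
  have md: "m < d" using r by simp
  have step: "f U' \<in> B.Fr m'" if U: "U \<in> A.Fr m" "U' \<in> A.Fr m" "A.vsum U U' \<in> A.Fr (Suc m)" "f U \<in> B.Fr m'" for U U'
  proof -
    obtain V where V: "V \<in> A.Fr n" "A.vsum U U' \<subseteq> V" using A.Fr_above[OF U(3), of n] r by auto
    then have "U \<subseteq> V" "U' \<subseteq> V"
      using A.vsum_upper1[OF A.Fr_sub A.Fr_sub] A.vsum_upper2[OF A.Fr_sub A.Fr_sub] U(1,2) by blast+
    then show ?thesis using flip U V by blast
  qed
  have below: "\<exists>U\<in>A.Fr m. U \<subseteq> V" if "V \<in> A.Fr n" for V using A.Fr_below[OF that, of m] r by simp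
  show ?thesis
  proof (cases "\<exists>U\<in>A.Fr m. f U \<in> B.Fr m'")
    case True
    then obtain U0 where U0: "U0 \<in> A.Fr m" "f U0 \<in> B.Fr m'" by blast
    have 1: "f U \<in> B.Fr m'" if "U \<in> A.Fr m" for U
      by (rule A.Fr_connected[where m = m and U = U0 and Q = "\<lambda>U. f U \<in> B.Fr m'"]) (fact md step U0 that)+
    then have "f V \<in> B.Fr n'" if "V \<in> A.Fr n" for V using below[OF that] flip that by blast
    then show ?thesis using 1 by blast
  next
    case False
    then have 1: "f U \<in> B.Fr n'" if "U \<in> A.Fr m" for U using cases that by blast
    have "f V \<in> B.Fr m'" if V: "V \<in> A.Fr n" for V
    proof -
      obtain U where "U \<in> A.Fr m" "U \<subseteq> V" using below V by blast
      then have "f V \<notin> B.Fr n'" using flip V False by blast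
      then show ?thesis using cases V by blast
    qed
    then show ?thesis using 1 by blast
  qed
qed

lemma extend_graph:
  assumes f: "comparability_map f (A.Fr m \<union> A.Fr n) (B.Fr m' \<union> B.Fr n')"
    and r: "0 < m" "m < n" "n < d" "0 < m'" "m' < n'" "n' < d'"
  shows "\<exists>F G. order_iso_on F G (A.Fr_range 0 d) (B.Fr_range 0 d') \<and>
    ((\<forall>W\<in>A.Fr m \<union> A.Fr n. f W = F W) \<or> (\<forall>W\<in>A.Fr m \<union> A.Fr n. f W = B.perp (F W)))"
  using sides[OF f r]
proof
  assume "(\<forall>U\<in>A.Fr m. f U \<in> B.Fr m') \<and> (\<forall>V\<in>A.Fr n. f V \<in> B.Fr n')"
  then show ?thesis using extend_oriented[OF f r] by metis
next
  assume flip: "(\<forall>U\<in>A.Fr m. f U \<in> B.Fr n') \<and> (\<forall>V\<in>A.Fr n. f V \<in> B.Fr m')"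
  have bij: "bij_betw B.perp (B.Fr m' \<union> B.Fr n') (B.Fr (d' - n') \<union> B.Fr (d' - m'))"
    unfolding bij_betw_def
  proof
    show "inj_on B.perp (B.Fr m' \<union> B.Fr n')"
      using B.perp_perp B.Fr_sub by (intro inj_on_inverseI[of _ B.perp]) auto
    show "B.perp ` (B.Fr m' \<union> B.Fr n') = B.Fr (d' - n') \<union> B.Fr (d' - m')"
      using B.perp_bij_Fr[of m'] B.perp_bij_Fr[of n'] r by (auto simp: image_Un bij_betw_def)
  qed
  have c: "comparability_map (B.perp \<circ> f) (A.Fr m \<union> A.Fr n) (B.Fr (d' - n') \<union> B.Fr (d' - m'))"
    by (rule comparability_perp[OF f _ bij]) (auto dest: B.Fr_sub)
  have "0 < d' - n'" "d' - n' < d' - m'" "d' - m' < d'" using r by auto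
  note r' = r(1-3) this
  have "(B.perp \<circ> f) U \<in> B.Fr (d' - n')" if "U \<in> A.Fr m" for U using flip B.perp_Fr that by simp
  moreover have "(B.perp \<circ> f) U \<in> B.Fr (d' - m')" if "U \<in> A.Fr n" for U using flip B.perp_Fr that by simp
  ultimately obtain F G where F: "order_iso_on F G (A.Fr_range 0 d) (B.Fr_range 0 d')"
      "\<forall>W\<in>A.Fr m \<union> A.Fr n. F W = B.perp (f W)"
    using extend_oriented[OF c r'] by auto
  have "f W = B.perp (F W)" if "W \<in> A.Fr m \<union> A.Fr n" for W
    using F(2) that comparability_mapD(3)[OF f that] B.perp_perp B.Fr_sub by auto
  then show ?thesis using F(1) by blast
qed

lemma iso_proper_range:
  assumes F: "order_iso_on F G (A.Fr_range 0 d) (B.Fr_range 0 d')"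
  shows "order_iso_on F G (A.Fr_range 1 (d - 1)) (B.Fr_range 1 (d' - 1))"
proof -
  interpret swap: two_spaces K' \<pi>' s' M' d' form' K \<pi> s M d form by (rule swap)
  have A: "V \<in> A.Fr_range 0 d" if "V \<in> A.Fr_range 1 (d - 1)" for V
    using that by (auto elim!: A.Fr_rangeE intro: A.Fr_rangeI)
  have B: "V \<in> B.Fr_range 0 d'" if "V \<in> B.Fr_range 1 (d' - 1)" for V
    using that by (auto elim!: B.Fr_rangeE intro: B.Fr_rangeI)
  note D = order_iso_onD[OF F] and dd = full_rank(1)[OF F]
  have FB: "F V \<in> B.Fr_range 1 (d' - 1)" if "V \<in> A.Fr_range 1 (d - 1)" for V
    using that full_rank(2)[OF F] dd by (metis A.Fr_rangeE B.Fr_rangeI)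
  have GA: "G V \<in> A.Fr_range 1 (d - 1)" if "V \<in> B.Fr_range 1 (d' - 1)" for V
    using that swap.full_rank(2)[OF order_iso_on_sym[OF F]] dd by (metis B.Fr_rangeE A.Fr_rangeI)
  show ?thesis
    unfolding order_iso_on_def using FB GA A B D by simp
qed

text \<open>If V has rank at least m, then F1 V is spanned by the images of the submodules of rank m
  below V, where both maps agree. Otherwise F2 V is the intersection of the images of those of rank
  n above V. The reverse inclusion comes from exchanging F1 and F2.\<close>

lemma iso_agree_unique:
  assumes F1: "order_iso_on F1 G1 (A.Fr_range 1 (d - 1)) (B.Fr_range 1 (d' - 1))"
    and F2: "order_iso_on F2 G2 (A.Fr_range 1 (d - 1)) (B.Fr_range 1 (d' - 1))"
    and agree: "\<And>W. W \<in> A.Fr m \<union> A.Fr n \<Longrightarrow> F1 W = F2 W"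
    and r: "0 < m" "m < n" "n < d"
    and V: "V \<in> A.Fr_range 1 (d - 1)"
  shows "F1 V \<subseteq> F2 V"
proof -
  interpret R1: range_iso K \<pi> s M d form K' \<pi>' s' M' d' form' F1 G1 1 "d - 1" 1 "d' - 1"
    using F1 by unfold_locales
  interpret R2: range_iso K \<pi> s M d form K' \<pi>' s' M' d' form' F2 G2 1 "d - 1" 1 "d' - 1"
    using F2 by unfold_locales
  interpret rev: range_iso K' \<pi>' s' M' d' form' K \<pi> s M d form G1 F1 1 "d' - 1" 1 "d - 1" by (rule R1.reverse)
  have rk: "F1 W \<in> B.Fr k" "k \<le> d' - 1" "W \<in> A.Fr_range 1 (d - 1)" if "W \<in> A.Fr k" "1 \<le> k" "k \<le> d - 1" for W k
    using R1.rank_eq[of W "k - 1"] A.Fr_rangeI[OF that] that by auto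
  have rk': "G1 W \<in> A.Fr k" "k \<le> d - 1" "W \<in> B.Fr_range 1 (d' - 1)" if "W \<in> B.Fr k" "1 \<le> k" "k \<le> d' - 1" for W k
    using rev.rank_eq[of W "k - 1"] B.Fr_rangeI[OF that] that by auto
  have mn: "1 \<le> m" "m \<le> d - 1" "1 \<le> n" "n \<le> d - 1" using r by auto
  obtain k where k: "V \<in> A.Fr k" "1 \<le> k" "k \<le> d - 1" using V by (rule A.Fr_rangeE)
  have s: "B.sub (F1 V)" "B.sub (F2 V)" using R1.isoD(1)[OF V] R2.isoD(1)[OF V] B.Fr_range_sub by blast+
  show ?thesis
  proof (cases "m \<le> k")
    case True
    obtain U where U: "U \<in> A.Fr m" "U \<subseteq> V" using A.Fr_below[OF k(1) True] by blast
    note m' = rk[OF U(1) mn(1,2)]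
    have "F1 U \<subseteq> F1 V" using R1.isoD(5)[OF m'(3) V] U(2) by blast
    then show ?thesis
    proof (rule B.spanned_by_Fr[OF m'(1) r(1) _ s])
      fix U' assume U': "U' \<in> B.Fr m" "U' \<subseteq> F1 V"
      note g = rk'[OF U'(1) mn(1) m'(2)]
      have "F1 (G1 U') = U'" using R1.isoD(4)[OF g(3)] .
      moreover from this have "G1 U' \<subseteq> V"
        using R1.isoD(5)[OF _ V] rk(3)[OF g(1) mn(1,2)] U'(2) by metis
      then have "F2 (G1 U') \<subseteq> F2 V"
        using R2.isoD(5)[OF _ V] rk(3)[OF g(1) mn(1,2)] by blast
      ultimately show "U' \<subseteq> F2 V" using agree[of "G1 U'"] g(1) by simp
    qed
  next
    case False
    then have kn: "k \<le> n" using r by simp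
    interpret rev2: range_iso K' \<pi>' s' M' d' form' K \<pi> s M d form G2 F2 1 "d' - 1" 1 "d - 1" by (rule R2.reverse)
    have rk2: "F2 W \<in> B.Fr k" "k \<le> d' - 1" if "W \<in> A.Fr k" "1 \<le> k" "k \<le> d - 1" for W k
      using R2.rank_eq[of W "k - 1"] that by auto
    have rk2': "G2 W \<in> A.Fr k" "W \<in> B.Fr_range 1 (d' - 1)" if "W \<in> B.Fr k" "1 \<le> k" "k \<le> d' - 1" for W k
      using rev2.rank_eq[of W "k - 1"] B.Fr_rangeI[OF that] that by auto
    obtain U where U: "U \<in> A.Fr n" "V \<subseteq> U" using A.Fr_above[OF k(1) kn] r by auto
    note n' = rk2[OF U(1) mn(3,4)]
    have nd: "n < d'" using n'(2) mn(3) by simp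
    have "F2 V \<subseteq> F2 U" using R2.isoD(5)[OF V rk(3)[OF U(1) mn(3,4)]] U(2) by blast
    then show ?thesis
    proof (rule B.cospanned_by_Fr[OF n'(1) nd _ s(2,1)])
      fix U' assume U': "U' \<in> B.Fr n" "F2 V \<subseteq> U'"
      note g = rk2'[OF U'(1) mn(3) n'(2)]
      have "F2 (G2 U') = U'" using R2.isoD(4)[OF g(2)] .
      moreover from this have "V \<subseteq> G2 U'"
        using R2.isoD(5)[OF V] rk(3)[OF g(1) mn(3,4)] U'(2) by metis
      then have "F1 V \<subseteq> F1 (G2 U')"
        using R1.isoD(5)[OF V] rk(3)[OF g(1) mn(3,4)] by blast
      ultimately show "F1 V \<subseteq> U'" using agree[of "G2 U'"] g(1) by simp
    qed
  qed
qed

text \<open>An order-reversing map becomes order-preserving after composition with the orthogonal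
  complement of the target.\<close>

lemma comparability_classify:
  assumes g: "comparability_map g (A.Fr_range 1 (d - 1)) (B.Fr_range 1 (d' - 1))" and d: "2 < d" "2 < d'"
  shows "(\<exists>G. order_iso_on g G (A.Fr_range 1 (d - 1)) (B.Fr_range 1 (d' - 1))) \<or>
    (\<exists>G. order_iso_on (B.perp \<circ> g) G (A.Fr_range 1 (d - 1)) (B.Fr_range 1 (d' - 1)))"
proof -
  note D = comparability_mapD[OF g]
  have "d' - (d' - 1) = 1" using d by simp
  then have bij: "bij_betw B.perp (B.Fr_range 1 (d' - 1)) (B.Fr_range 1 (d' - 1))"
    using B.perp_bij_range[of 1 "d' - 1"] d by simp
  have p: "comparability_map (B.perp \<circ> g) (A.Fr_range 1 (d - 1)) (B.Fr_range 1 (d' - 1))"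
    by (rule comparability_perp[OF g _ bij]) (rule B.Fr_range_sub)
  from A.comparability_orientation[OF d(1) D(2) D(4)]
  show ?thesis
  proof
    assume "\<forall>U\<in>A.Fr_range 1 (d - 1). \<forall>V\<in>A.Fr_range 1 (d - 1). U \<subseteq> V \<longrightarrow> g U \<subseteq> g V"
    then show ?thesis using monotone_comparability_map[OF g] by blast
  next
    assume "\<forall>U\<in>A.Fr_range 1 (d - 1). \<forall>V\<in>A.Fr_range 1 (d - 1). U \<subseteq> V \<longrightarrow> g V \<subseteq> g U"
    then have "(B.perp \<circ> g) U \<subseteq> (B.perp \<circ> g) V"
      if "U \<in> A.Fr_range 1 (d - 1)" "V \<in> A.Fr_range 1 (d - 1)" "U \<subseteq> V" for U V
      using that B.perp_anti by simp
    then show ?thesis using monotone_comparability_map[OF p] by blast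
  qed
qed

lemma comparability_extend:
  assumes f: "comparability_map f (A.Fr m \<union> A.Fr n) (B.Fr m' \<union> B.Fr n')"
    and r: "0 < m" "m < n" "n < d" "0 < m'" "m' < n'" "n' < d'"
  shows "\<exists>g. comparability_map g (A.Fr_range 1 (d - 1)) (B.Fr_range 1 (d' - 1)) \<and>
    (\<forall>W\<in>A.Fr m \<union> A.Fr n. g W = f W)"
proof -
  obtain F G where F: "order_iso_on F G (A.Fr_range 0 d) (B.Fr_range 0 d')"
    and agree: "(\<forall>W\<in>A.Fr m \<union> A.Fr n. f W = F W) \<or> (\<forall>W\<in>A.Fr m \<union> A.Fr n. f W = B.perp (F W))"
    using extend_graph[OF f r] by blast
  note c = order_iso_on_comparability_map[OF iso_proper_range[OF F]]
  have "d' - (d' - 1) = 1" using r by simp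
  then have bij: "bij_betw B.perp (B.Fr_range 1 (d' - 1)) (B.Fr_range 1 (d' - 1))"
    using B.perp_bij_range[of 1 "d' - 1"] r by simp
  have "comparability_map (B.perp \<circ> F) (A.Fr_range 1 (d - 1)) (B.Fr_range 1 (d' - 1))"
    by (rule comparability_perp[OF c _ bij]) (rule B.Fr_range_sub)
  then show ?thesis using agree c by (metis comp_apply)
qed

lemma comparability_rank:
  assumes g: "comparability_map g (A.Fr_range 1 (d - 1)) (B.Fr_range 1 (d' - 1))" and d: "2 < d" "2 < d'"
  shows "(\<forall>k V. V \<in> A.Fr k \<longrightarrow> 1 \<le> k \<longrightarrow> k \<le> d - 1 \<longrightarrow> g V \<in> B.Fr k) \<or>
    (\<forall>k V. V \<in> A.Fr k \<longrightarrow> 1 \<le> k \<longrightarrow> k \<le> d - 1 \<longrightarrow> g V \<in> B.Fr (d' - k))"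
  using comparability_classify[OF assms]
proof
  assume "\<exists>G. order_iso_on g G (A.Fr_range 1 (d - 1)) (B.Fr_range 1 (d' - 1))"
  then obtain G where G: "order_iso_on g G (A.Fr_range 1 (d - 1)) (B.Fr_range 1 (d' - 1))" by blast
  interpret R: range_iso K \<pi> s M d form K' \<pi>' s' M' d' form' g G 1 "d - 1" 1 "d' - 1"
    using G by unfold_locales
  have "g V \<in> B.Fr k" if "V \<in> A.Fr k" "1 \<le> k" "k \<le> d - 1" for k V
    using R.rank_eq(1)[of V "k - 1"] that by simp
  then show ?thesis by blast
next
  assume "\<exists>G. order_iso_on (B.perp \<circ> g) G (A.Fr_range 1 (d - 1)) (B.Fr_range 1 (d' - 1))"
  then obtain G where G: "order_iso_on (B.perp \<circ> g) G (A.Fr_range 1 (d - 1)) (B.Fr_range 1 (d' - 1))" by blast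
  interpret R: range_iso K \<pi> s M d form K' \<pi>' s' M' d' form' "B.perp \<circ> g" G 1 "d - 1" 1 "d' - 1"
    using G by unfold_locales
  have "g V \<in> B.Fr (d' - k)" if V: "V \<in> A.Fr k" "1 \<le> k" "k \<le> d - 1" for k V
  proof -
    have "B.perp (g V) \<in> B.Fr k" using R.rank_eq(1)[of V "k - 1"] V by simp
    moreover have "B.sub (g V)"
      using comparability_mapD(3)[OF g A.Fr_rangeI[OF V]] B.Fr_range_sub by blast
    ultimately show ?thesis using B.perp_Fr B.perp_perp by metis
  qed
  then show ?thesis by blast
qed

text \<open>Two maps of opposite orientation cannot agree on an inclusion of a U0 of rank m in a V0
  of rank n, which one keeps and the other reverses. For equal orientations, after complements if
  necessary, the order isomorphisms agree.\<close>

lemma comparability_unique: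
  assumes g: "comparability_map g (A.Fr_range 1 (d - 1)) (B.Fr_range 1 (d' - 1))"
    and h: "comparability_map h (A.Fr_range 1 (d - 1)) (B.Fr_range 1 (d' - 1))"
    and agree: "\<And>W. W \<in> A.Fr m \<union> A.Fr n \<Longrightarrow> g W = h W"
    and r: "0 < m" "m < n" "n < d" and d': "2 < d'"
    and V: "V \<in> A.Fr_range 1 (d - 1)"
  shows "g V = h V"
proof -
  let ?P = "A.Fr_range 1 (d - 1)" and ?P' = "B.Fr_range 1 (d' - 1)"
  have d: "2 < d" using r by simp
  have uniq: "F1 V = F2 V"
    if "order_iso_on F1 G1 ?P ?P'" "order_iso_on F2 G2 ?P ?P'" "\<And>W. W \<in> A.Fr m \<union> A.Fr n \<Longrightarrow> F1 W = F2 W"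
    for F1 F2 G1 G2
    using iso_agree_unique[OF that r V] iso_agree_unique[OF that(2,1) that(3)[symmetric] r V] by blast
  obtain V0 where V0: "V0 \<in> A.Fr n" using A.Fr_below[OF A.carrier_in_Fr, of n] r by auto
  obtain U0 where U0: "U0 \<in> A.Fr m" "U0 \<subseteq> V0" using A.Fr_below[OF V0, of m] r by auto
  have UV: "U0 \<in> ?P" "V0 \<in> ?P" using A.Fr_rangeI[OF U0(1)] A.Fr_rangeI[OF V0] r by auto
  have not_both: False if k: "comparability_map k ?P ?P'" and l: "comparability_map l ?P ?P'"
    and kl: "\<And>W. W \<in> A.Fr m \<union> A.Fr n \<Longrightarrow> k W = l W"
    and "order_iso_on k G1 ?P ?P'" "order_iso_on (B.perp \<circ> l) G2 ?P ?P'" for k l G1 G2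
  proof -
    have "k U0 \<subseteq> k V0" using order_iso_onD(5)[OF that(4) UV] U0(2) by blast
    then have "l U0 \<subseteq> l V0" using kl U0(1) V0 by auto
    then have "(B.perp \<circ> l) V0 \<subseteq> (B.perp \<circ> l) U0" using B.perp_anti by simp
    then have "V0 \<subseteq> U0" using order_iso_onD(5)[OF that(5) UV(2,1)] by blast
    then show False using A.Fr_rank_mono[OF V0 U0(1)] r by simp
  qed
  consider
      G1 G2 where "order_iso_on g G1 ?P ?P'" "order_iso_on h G2 ?P ?P'"
    | G1 G2 where "order_iso_on g G1 ?P ?P'" "order_iso_on (B.perp \<circ> h) G2 ?P ?P'"
    | G1 G2 where "order_iso_on (B.perp \<circ> g) G1 ?P ?P'" "order_iso_on h G2 ?P ?P'"
    | G1 G2 where "order_iso_on (B.perp \<circ> g) G1 ?P ?P'" "order_iso_on (B.perp \<circ> h) G2 ?P ?P'"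
    using comparability_classify[OF g d d'] comparability_classify[OF h d d'] by blast
  then show ?thesis
  proof cases
    case 1
    then show ?thesis using uniq[OF 1 agree] by blast
  next
    case 2
    then show ?thesis using not_both[OF g h agree 2] by blast
  next
    case 3
    then show ?thesis using not_both[OF h g agree[symmetric] 3(2,1)] by blast
  next
    case 4
    have "(B.perp \<circ> g) V = (B.perp \<circ> h) V" using uniq[OF 4] agree by simp
    moreover have "B.sub (g V)" "B.sub (h V)"
      using comparability_mapD(3)[OF g V] comparability_mapD(3)[OF h V] B.Fr_range_sub by blast+
    ultimately show ?thesis using B.perp_perp by (metis comp_apply)
  qed
qed

end

context free_space
begin

section \<open>Bases\<close>

lemma sub_finsum:
  assumes N: "sub N" and "finite B" "\<And>b. b \<in> B \<Longrightarrow> f b \<in> N"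
  shows "(\<Oplus>\<^bsub>M\<^esub>b\<in>B. f b) \<in> N"
  using assms(2,3)
proof (induction B rule: finite_induct)
  case empty
  then show ?case using sub_zero[OF N] by simp
next
  case (insert x F)
  then have "f x \<in> carrier M" "f \<in> F \<rightarrow> carrier M" using sub_carrier[OF N] by auto
  then have "(\<Oplus>\<^bsub>M\<^esub>b\<in>insert x F. f b) = f x \<oplus>\<^bsub>M\<^esub> (\<Oplus>\<^bsub>M\<^esub>b\<in>F. f b)"
    using insert.hyps by (simp add: M.finsum_insert)
  then show ?case using insert sub_add[OF N] by simp
qed

text \<open>A basis gives uniqueness among functions extensional on B; restriction makes it
  available for arbitrary coefficient functions.\<close>

lemma module_basis_unique:
  assumes B: "module_basis K M N B" and N: "sub N"
    and c: "\<And>b. b \<in> B \<Longrightarrow> c b \<in> carrier K" "\<And>b. b \<in> B \<Longrightarrow> e b \<in> carrier K"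
    and eq: "(\<Oplus>\<^bsub>M\<^esub>b\<in>B. c b \<odot>\<^bsub>M\<^esub> b) = (\<Oplus>\<^bsub>M\<^esub>b\<in>B. e b \<odot>\<^bsub>M\<^esub> b)" and b: "b \<in> B"
  shows "c b = e b"
proof -
  have BN: "finite B" "B \<subseteq> N" using B by (auto simp: module_basis_def)
  have bc: "b \<in> carrier M" if "b \<in> B" for b using sub_carrier[OF N] BN(2) that by blast
  have r: "(\<Oplus>\<^bsub>M\<^esub>b\<in>B. (restrict h B) b \<odot>\<^bsub>M\<^esub> b) = (\<Oplus>\<^bsub>M\<^esub>b\<in>B. h b \<odot>\<^bsub>M\<^esub> b)"
    if "\<And>b. b \<in> B \<Longrightarrow> h b \<in> carrier K" for h
    by (rule M.finsum_cong') (use that bc in auto)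
  have "(\<Oplus>\<^bsub>M\<^esub>b\<in>B. c b \<odot>\<^bsub>M\<^esub> b) \<in> N"
    by (rule sub_finsum[OF N BN(1)]) (use sub_smult[OF N] c(1) BN(2) in auto)
  then have ex1: "\<exists>!h. h \<in> B \<rightarrow>\<^sub>E carrier K \<and> (\<Oplus>\<^bsub>M\<^esub>b\<in>B. c b \<odot>\<^bsub>M\<^esub> b) = (\<Oplus>\<^bsub>M\<^esub>b\<in>B. h b \<odot>\<^bsub>M\<^esub> b)"
    using B unfolding module_basis_def by blast
  have mem: "restrict c B \<in> B \<rightarrow>\<^sub>E carrier K" "restrict e B \<in> B \<rightarrow>\<^sub>E carrier K" using c by auto
  have eqs: "(\<Oplus>\<^bsub>M\<^esub>b\<in>B. c b \<odot>\<^bsub>M\<^esub> b) = (\<Oplus>\<^bsub>M\<^esub>b\<in>B. (restrict c B) b \<odot>\<^bsub>M\<^esub> b)"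
    "(\<Oplus>\<^bsub>M\<^esub>b\<in>B. c b \<odot>\<^bsub>M\<^esub> b) = (\<Oplus>\<^bsub>M\<^esub>b\<in>B. (restrict e B) b \<odot>\<^bsub>M\<^esub> b)"
    using r[of c] r[of e] c eq by auto
  have "restrict c B = restrict e B" using ex1 mem eqs by blast
  then show ?thesis using b by (metis restrict_apply')
qed

text \<open>Multiplying the expansion of \<pi>z by \<pi>^(s-1) gives zero, so \<pi>^(s-1) kills
  every coefficient. Each coefficient is then a multiple of \<pi>, and division by \<pi> gives the
  required vector of N.\<close>

lemma basis_pure:
  assumes N: "sub N" and B: "module_basis K M N B"
  shows "pure N"
  unfolding pure_def
proof (intro conjI N ballI impI)
  fix z assume z: "z \<in> carrier M" "\<pi> \<odot>\<^bsub>M\<^esub> z \<in> N"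
  have BN: "finite B" "B \<subseteq> N" using B by (auto simp: module_basis_def)
  have bc: "b \<in> carrier M" if "b \<in> B" for b using sub_carrier[OF N] BN(2) that by blast
  obtain c where c: "c \<in> B \<rightarrow>\<^sub>E carrier K" "\<pi> \<odot>\<^bsub>M\<^esub> z = (\<Oplus>\<^bsub>M\<^esub>b\<in>B. c b \<odot>\<^bsub>M\<^esub> b)"
    using B z(2) unfolding module_basis_def by blast
  have cK: "c b \<in> carrier K" if "b \<in> B" for b using c(1) that by blast
  have "\<pi> [^] (s - 1) \<otimes> c b = \<zero>" if b: "b \<in> B" for b
  proof (rule module_basis_unique[OF B N _ _ _ b])
    have "(\<Oplus>\<^bsub>M\<^esub>b\<in>B. (\<pi> [^] (s - 1) \<otimes> c b) \<odot>\<^bsub>M\<^esub> b)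
        = (\<Oplus>\<^bsub>M\<^esub>b\<in>B. (\<pi> [^] (s - 1)) \<odot>\<^bsub>M\<^esub> (c b \<odot>\<^bsub>M\<^esub> b))"
      by (rule M.finsum_cong') (auto simp: smult_assoc1 cK bc)
    also have "\<dots> = (\<pi> [^] (s - 1)) \<odot>\<^bsub>M\<^esub> (\<pi> \<odot>\<^bsub>M\<^esub> z)"
      unfolding c(2) by (rule finsum_smult_ldistr[symmetric]) (auto simp: BN cK bc)
    also have "\<dots> = (\<pi> [^] Suc (s - 1)) \<odot>\<^bsub>M\<^esub> z"
      using z(1) by (simp add: smult_assoc1)
    also have "\<dots> = \<zero>\<^bsub>M\<^esub>" using z(1) s_pos unif_pow_eq by (simp del: nat_pow_Suc)
    also have "\<dots> = (\<Oplus>\<^bsub>M\<^esub>b\<in>B. \<zero> \<odot>\<^bsub>M\<^esub> b)"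
      using bc by (simp add: M.add.finprod_one_eqI)
    finally show "(\<Oplus>\<^bsub>M\<^esub>b\<in>B. (\<pi> [^] (s - 1) \<otimes> c b) \<odot>\<^bsub>M\<^esub> b) = (\<Oplus>\<^bsub>M\<^esub>b\<in>B. \<zero> \<odot>\<^bsub>M\<^esub> b)" .
  qed (auto simp: cK)
  then have "\<forall>b\<in>B. \<exists>e\<in>carrier K. c b = \<pi> \<otimes> e" using unif_pow_pred_mult_zero cK by blast
  then obtain e where e: "\<And>b. b \<in> B \<Longrightarrow> e b \<in> carrier K" "\<And>b. b \<in> B \<Longrightarrow> c b = \<pi> \<otimes> e b" by metis
  have "\<pi> \<odot>\<^bsub>M\<^esub> z = (\<Oplus>\<^bsub>M\<^esub>b\<in>B. \<pi> \<odot>\<^bsub>M\<^esub> (e b \<odot>\<^bsub>M\<^esub> b))"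
    unfolding c(2) by (rule M.finsum_cong') (auto simp: e smult_assoc1 bc)
  also have "\<dots> = \<pi> \<odot>\<^bsub>M\<^esub> (\<Oplus>\<^bsub>M\<^esub>b\<in>B. e b \<odot>\<^bsub>M\<^esub> b)"
    by (rule finsum_smult_ldistr[symmetric]) (auto simp: BN e bc)
  finally show "\<exists>v\<in>N. \<pi> \<odot>\<^bsub>M\<^esub> z = \<pi> \<odot>\<^bsub>M\<^esub> v"
  proof (rule bexI)
    show "(\<Oplus>\<^bsub>M\<^esub>b\<in>B. e b \<odot>\<^bsub>M\<^esub> b) \<in> N"
      by (rule sub_finsum[OF N BN(1)]) (use sub_smult[OF N] e(1) BN(2) in auto)
  qed
qed

lemma module_basis_ext:
  assumes N: "pure N" and B: "module_basis K M N B" and x: "x \<in> carrier M" "x \<notin> nbhd N"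
  shows "module_basis K M (ext N x) (insert x B)"
  unfolding module_basis_def
proof (intro conjI ballI)
  note sN = pure_sub[OF N]
  have BN: "finite B" "B \<subseteq> N" using B by (auto simp: module_basis_def)
  show "finite (insert x B)" using BN by simp
  show "insert x B \<subseteq> ext N x" using BN ext_upper[OF sN x(1)] ext_self[OF sN x(1)] by blast
  have bc: "b \<in> carrier M" if "b \<in> B" for b using sub_carrier[OF sN] BN(2) that by blast
  have xB: "x \<notin> B" using x(2) BN(2) nbhd_upper[OF sN] by blast
  have split: "(\<Oplus>\<^bsub>M\<^esub>b\<in>insert x B. c b \<odot>\<^bsub>M\<^esub> b) = (\<Oplus>\<^bsub>M\<^esub>b\<in>B. c b \<odot>\<^bsub>M\<^esub> b) \<oplus>\<^bsub>M\<^esub> c x \<odot>\<^bsub>M\<^esub> x"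
    if c: "\<And>b. b \<in> insert x B \<Longrightarrow> c b \<in> carrier K" for c
  proof -
    have 1: "(\<lambda>b. c b \<odot>\<^bsub>M\<^esub> b) \<in> B \<rightarrow> carrier M" using c bc by auto
    have 2: "c x \<odot>\<^bsub>M\<^esub> x \<in> carrier M" using c x by auto
    show ?thesis
      using M.finsum_insert[OF BN(1) xB 1 2] M.a_comm[OF 2 M.finsum_closed[OF 1]] by simp
  qed
  have in_N: "(\<Oplus>\<^bsub>M\<^esub>b\<in>B. c b \<odot>\<^bsub>M\<^esub> b) \<in> N" if "\<And>b. b \<in> B \<Longrightarrow> c b \<in> carrier K" for c
    by (rule sub_finsum[OF sN BN(1)]) (use sub_smult[OF sN] that BN(2) in auto)
  fix y assume "y \<in> ext N x"
  then obtain v a where v: "v \<in> N" "a \<in> carrier K" "y = v \<oplus>\<^bsub>M\<^esub> a \<odot>\<^bsub>M\<^esub> x" by (rule extE)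
  obtain e where e: "e \<in> B \<rightarrow>\<^sub>E carrier K" "v = (\<Oplus>\<^bsub>M\<^esub>b\<in>B. e b \<odot>\<^bsub>M\<^esub> b)"
    using B v(1) unfolding module_basis_def by blast
  have eK: "e b \<in> carrier K" if "b \<in> B" for b using e(1) that by blast
  show "\<exists>!c. c \<in> insert x B \<rightarrow>\<^sub>E carrier K \<and> y = (\<Oplus>\<^bsub>M\<^esub>b\<in>insert x B. c b \<odot>\<^bsub>M\<^esub> b)"
  proof (rule ex1I[of _ "e(x := a)"])
    have "(\<Oplus>\<^bsub>M\<^esub>b\<in>B. (e(x := a)) b \<odot>\<^bsub>M\<^esub> b) = v"
      unfolding e(2) by (rule M.finsum_cong') (use eK bc xB in auto)
    then show "e(x := a) \<in> insert x B \<rightarrow>\<^sub>E carrier K \<and> y = (\<Oplus>\<^bsub>M\<^esub>b\<in>insert x B. (e(x := a)) b \<odot>\<^bsub>M\<^esub> b)"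
    proof -
      assume eq: "(\<Oplus>\<^bsub>M\<^esub>b\<in>B. (e(x := a)) b \<odot>\<^bsub>M\<^esub> b) = v"
      have "(e(x := a)) b \<in> carrier K" if "b \<in> insert x B" for b using eK v(2) that by auto
      then have "(\<Oplus>\<^bsub>M\<^esub>b\<in>insert x B. (e(x := a)) b \<odot>\<^bsub>M\<^esub> b) = y"
        using split[of "e(x := a)"] eq v(3) by simp
      moreover have "e(x := a) \<in> insert x B \<rightarrow>\<^sub>E carrier K"
        using e(1) v(2) by (auto simp: PiE_iff extensional_def)
      ultimately show ?thesis by blast
    qed
    fix c assume c: "c \<in> insert x B \<rightarrow>\<^sub>E carrier K \<and> y = (\<Oplus>\<^bsub>M\<^esub>b\<in>insert x B. c b \<odot>\<^bsub>M\<^esub> b)"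
    then have cK: "c b \<in> carrier K" if "b \<in> insert x B" for b using that by blast
    have "v \<oplus>\<^bsub>M\<^esub> a \<odot>\<^bsub>M\<^esub> x = (\<Oplus>\<^bsub>M\<^esub>b\<in>B. c b \<odot>\<^bsub>M\<^esub> b) \<oplus>\<^bsub>M\<^esub> c x \<odot>\<^bsub>M\<^esub> x"
      using split[OF cK] c v(3) by simp
    then have *: "v = (\<Oplus>\<^bsub>M\<^esub>b\<in>B. c b \<odot>\<^bsub>M\<^esub> b)" "a = c x"
      using ext_unique[OF N x v(1) in_N v(2), of c "c x"] cK by auto
    show "c = e(x := a)"
    proof
      fix b
      show "c b = (e(x := a)) b"
      proof (cases "b \<in> B")
        case True
        then have "c b = e b"
          using module_basis_unique[OF B sN, of c e, OF _ eK _ True] cK *(1) e(2) by simp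
        then show ?thesis using True xB by auto
      next
        case False
        then show ?thesis using *(2) c e(1) by (auto simp: PiE_iff extensional_def)
      qed
    qed
  qed
qed

lemma Fr_basis: "N \<in> Fr k \<Longrightarrow> \<exists>B. module_basis K M N B"
proof (induction k arbitrary: N)
  case 0
  then have "N = {\<zero>\<^bsub>M\<^esub>}" by (rule Fr_zero)
  then have "module_basis K M N {}" by (auto simp: module_basis_def)
  then show ?case by blast
next
  case (Suc k)
  obtain U where U: "U \<in> Fr k" "U \<subseteq> N" using Fr_below[OF Suc.prems, of k] by auto
  obtain x where x: "x \<in> N" "x \<notin> nbhd U" "N = ext U x" using Fr_Suc_ext[OF U(1) Suc.prems U(2)] by blast
  obtain B where "module_basis K M U B" using Suc.IH[OF U(1)] by blast
  then show ?case using module_basis_ext[OF Fr_pure[OF U(1)] _ _ x(2)] x Fr_subset[OF Suc.prems] by blast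
qed

end

text \<open>The form is the dot product, and pairing with unit vectors shows that it is
  nondegenerate. The socle condition holds in each coordinate.\<close>

lemma (in chain_ring) free_module_space:
  "free_space K \<pi> s (free_module K d) d (\<lambda>x y. \<Oplus>i\<in>{..<d}. x i \<otimes> y i)"
proof -
  let ?M = "free_module K d"
  let ?form = "\<lambda>x y. \<Oplus>i\<in>{..<d}. x i \<otimes> y i"
  have abel: "abelian_group ?M"
  proof (rule abelian_groupI)
    fix x assume "x \<in> carrier ?M"
    then show "\<exists>y\<in>carrier ?M. y \<oplus>\<^bsub>?M\<^esub> x = \<zero>\<^bsub>?M\<^esub>"
      by (intro bexI[of _ "\<lambda>i\<in>{..<d}. \<ominus> x i"])
         (auto simp: free_module_def PiE_iff l_neg intro!: restrict_ext)
  qed (auto simp: free_module_def PiE_iff a_ac extensional_def fun_eq_iff)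
  have mod: "module K ?M"
    by (rule moduleI[OF is_cring abel])
       (auto simp: free_module_def PiE_iff l_distr r_distr m_assoc extensional_def fun_eq_iff)
  have comp: "x i \<in> carrier K" if "x \<in> carrier ?M" "i < d" for x i
    using that by (auto simp: free_module_def)
  show ?thesis
  proof (intro free_space.intro free_space_axioms.intro)
    show "module K ?M" by (rule mod)
    show "chain_ring K \<pi> s" by (rule chain_ring_axioms)
  next
    show "card (carrier ?M) = card (carrier K) ^ d"
      by (simp add: free_module_def card_PiE)
  next
    fix x assume x: "x \<in> carrier ?M" "\<pi> \<odot>\<^bsub>?M\<^esub> x = \<zero>\<^bsub>?M\<^esub>"
    have "\<pi> \<otimes> x i = \<zero>" if "i < d" for i
      using fun_cong[OF x(2), of i] that by (simp add: free_module_def)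
    then have "\<forall>i<d. \<exists>b\<in>carrier K. x i = \<pi> [^] (s - 1) \<otimes> b"
      using unif_mult_zero comp[OF x(1)] by blast
    then obtain b where b: "\<And>i. i < d \<Longrightarrow> b i \<in> carrier K" "\<And>i. i < d \<Longrightarrow> x i = \<pi> [^] (s - 1) \<otimes> b i"
      by metis
    show "\<exists>y\<in>carrier ?M. x = (\<pi> [^] (s - 1)) \<odot>\<^bsub>?M\<^esub> y"
    proof (rule bexI[of _ "\<lambda>i\<in>{..<d}. b i"])
      show "x = (\<pi> [^] (s - 1)) \<odot>\<^bsub>?M\<^esub> (\<lambda>i\<in>{..<d}. b i)"
        using x(1) b(2) by (auto simp: free_module_def PiE_iff extensional_def fun_eq_iff)
    qed (use b in \<open>auto simp: free_module_def\<close>)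
  next
    fix x y assume x: "x \<in> carrier ?M" and y: "y \<in> carrier ?M"
    show "?form x y \<in> carrier K" using comp[OF x] comp[OF y] by (intro finsum_closed) auto
    show "?form x y = ?form y x"
      using comp[OF x] comp[OF y] by (intro finsum_cong') (auto simp: m_comm)
  next
    fix x y z assume x: "x \<in> carrier ?M" and y: "y \<in> carrier ?M" and z: "z \<in> carrier ?M"
    have "?form (x \<oplus>\<^bsub>?M\<^esub> y) z = (\<Oplus>i\<in>{..<d}. x i \<otimes> z i \<oplus> y i \<otimes> z i)"
      using comp[OF x] comp[OF y] comp[OF z]
      by (intro finsum_cong') (auto simp: free_module_def l_distr)
    also have "\<dots> = ?form x z \<oplus> ?form y z"
      using comp[OF x] comp[OF y] comp[OF z] by (intro finsum_addf) auto
    finally show "?form (x \<oplus>\<^bsub>?M\<^esub> y) z = ?form x z \<oplus> ?form y z" .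
  next
    fix a x z assume a: "a \<in> carrier K" and x: "x \<in> carrier ?M" and z: "z \<in> carrier ?M"
    have "?form (a \<odot>\<^bsub>?M\<^esub> x) z = (\<Oplus>i\<in>{..<d}. a \<otimes> (x i \<otimes> z i))"
      using comp[OF x] comp[OF z] a
      by (intro finsum_cong') (auto simp: free_module_def m_assoc)
    also have "\<dots> = a \<otimes> ?form x z"
      using comp[OF x] comp[OF z] a by (intro finsum_rdistr[symmetric]) auto
    finally show "?form (a \<odot>\<^bsub>?M\<^esub> x) z = a \<otimes> ?form x z" .
  next
    fix x assume x: "x \<in> carrier ?M" and 0: "\<forall>y\<in>carrier ?M. ?form x y = \<zero>"
    have "x i = \<zero>" if i: "i < d" for i
    proof -
      let ?e = "\<lambda>j\<in>{..<d}. if j = i then \<one> else \<zero>"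
      have "?form x ?e = (\<Oplus>j\<in>{..<d}. if i = j then x j else \<zero>)"
        using comp[OF x] by (intro finsum_cong') auto
      also have "\<dots> = x i" using comp[OF x] i by (intro finsum_singleton) auto
      finally have "?form x ?e = x i" .
      moreover have "?e \<in> carrier ?M" by (auto simp: free_module_def)
      ultimately show ?thesis using 0 by metis
    qed
    then show "x = \<zero>\<^bsub>?M\<^esub>"
      using x by (auto simp: free_module_def PiE_iff extensional_def fun_eq_iff)
  qed
qed

section \<open>Residue rings of Dedekind domains\<close>

lemma (in domain) finite_domain_Units:
  assumes fin: "finite (carrier R)" and a: "a \<in> carrier R" "a \<noteq> \<zero>"
  shows "a \<in> Units R"
proof -
  have "inj_on (\<lambda>x. a \<otimes> x) (carrier R)"
    using a m_lcancel by (auto simp: inj_on_def)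
  moreover have "(\<lambda>x. a \<otimes> x) ` carrier R \<subseteq> carrier R" using a by auto
  ultimately have "(\<lambda>x. a \<otimes> x) ` carrier R = carrier R" using endo_inj_surj[OF fin] by blast
  then obtain b where b: "b \<in> carrier R" "a \<otimes> b = \<one>" by (metis imageE one_closed)
  then have "b \<otimes> a = \<one>" using m_comm a(1) by simp
  then show ?thesis using a b unfolding Units_def by blast
qed

text \<open>Elements are expanded in powers of p with digits from Y; since \<open>p [^] r\<close> =
  0, r digits suffice and there are finitely many expansions.\<close>

lemma (in cring) finite_of_nilpotent:
  assumes p: "p \<in> carrier R" "p [^] (r::nat) = \<zero>"
    and Y: "finite Y" "Y \<subseteq> carrier R"
    and rep: "\<And>a. a \<in> carrier R \<Longrightarrow> \<exists>y\<in>Y. \<exists>b\<in>carrier R. a = y \<oplus> p \<otimes> b"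
  shows "finite (carrier R)"
proof -
  have "\<exists>Z. finite Z \<and> Z \<subseteq> carrier R \<and> (\<forall>a\<in>carrier R. \<exists>z\<in>Z. \<exists>b\<in>carrier R. a = z \<oplus> p [^] j \<otimes> b)" for j :: nat
  proof (induction j)
    case 0
    then show ?case by (intro exI[of _ "{\<zero>}"]) auto
  next
    case (Suc j)
    then obtain Z where Z: "finite Z" "Z \<subseteq> carrier R"
      "\<forall>a\<in>carrier R. \<exists>z\<in>Z. \<exists>b\<in>carrier R. a = z \<oplus> p [^] j \<otimes> b" by blast
    let ?Z = "(\<lambda>(z, y). z \<oplus> p [^] j \<otimes> y) ` (Z \<times> Y)"
    have "\<exists>z\<in>?Z. \<exists>b\<in>carrier R. a = z \<oplus> p [^] Suc j \<otimes> b" if a: "a \<in> carrier R" for a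
    proof -
      obtain z b where zb: "z \<in> Z" "b \<in> carrier R" "a = z \<oplus> p [^] j \<otimes> b" using Z(3) a by blast
      obtain y c where yc: "y \<in> Y" "c \<in> carrier R" "b = y \<oplus> p \<otimes> c" using rep zb(2) by blast
      have carr: "z \<in> carrier R" "y \<in> carrier R" using zb yc Z(2) Y(2) by auto
      then have "a = (z \<oplus> p [^] j \<otimes> y) \<oplus> p [^] Suc j \<otimes> c"
        using zb yc p(1) by (simp add: r_distr a_assoc m_assoc)
      moreover have "z \<oplus> p [^] j \<otimes> y \<in> ?Z" using zb(1) yc(1) by force
      ultimately show ?thesis using yc(2) by blast
    qed
    moreover have "finite ?Z" using Z(1) Y(1) by simp
    moreover have "?Z \<subseteq> carrier R" using Z(2) Y(2) p(1) by auto
    ultimately show ?case by blast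
  qed
  from this[of r] obtain Z where Z: "finite Z" "Z \<subseteq> carrier R"
    "\<forall>a\<in>carrier R. \<exists>z\<in>Z. \<exists>b\<in>carrier R. a = z \<oplus> p [^] r \<otimes> b" by blast
  have "carrier R \<subseteq> Z"
  proof
    fix a assume "a \<in> carrier R"
    then obtain z b where "z \<in> Z" "b \<in> carrier R" "a = z \<oplus> p [^] r \<otimes> b" using Z(3) by blast
    then show "a \<in> Z" using Z(2) p(2) by (auto simp: subset_iff)
  qed
  then show ?thesis using Z(1) finite_subset by blast
qed

text \<open>The parameter s is the exact nilpotency index of p, of which the hypothesis only gives
  the bound r.\<close>

lemma (in cring) chain_ring_of_nilpotent:
  assumes "finite (carrier R)" "\<one> \<noteq> \<zero>" "p \<in> carrier R" "p [^] (r::nat) = \<zero>"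
    and "\<And>a. a \<in> carrier R \<Longrightarrow> a \<in> Units R \<or> (\<exists>b\<in>carrier R. a = p \<otimes> b)"
  shows "\<exists>s. chain_ring R p s"
proof -
  define s where "s = (LEAST k::nat. p [^] k = \<zero>)"
  have s: "p [^] s = \<zero>" unfolding s_def using assms(4) by (rule LeastI)
  then have pos: "0 < s" using assms(2) by (cases s) auto
  then have "p [^] (s - 1) \<noteq> \<zero>" using not_less_Least[of "s - 1" "\<lambda>k. p [^] k = \<zero>"] s_def by simp
  then have "chain_ring R p s" using assms s pos by unfold_locales auto
  then show ?thesis by blast
qed

section \<open>Ideals above a power of a prime\<close>

context dedekind_domain
begin

lemma ideal_prod_mono: "\<lbrakk>J \<subseteq> J'; x \<in> I \<cdot> J\<rbrakk> \<Longrightarrow> x \<in> I \<cdot> J'"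
  by (rotate_tac 1, induction x rule: ideal_prod.induct) (auto intro: ideal_prod.intros)

lemma ideal_foldr: "\<forall>P\<in>set Ps. ideal P R \<Longrightarrow> ideal (foldr (ideal_prod R) Ps (carrier R)) R"
  by (induction Ps) (auto simp: oneideal ideal_prod_is_ideal)

lemma foldr_subset:
  "\<lbrakk>\<forall>P\<in>set Ps. ideal P R; P \<in> set Ps\<rbrakk> \<Longrightarrow> foldr (ideal_prod R) Ps (carrier R) \<subseteq> P"
proof (induction Ps)
  case (Cons Q Ps)
  then show ?case
    using ideal_prod_inter[of Q "foldr (ideal_prod R) Ps (carrier R)"] ideal_foldr[of Ps] by auto
qed simp

lemma pow_ideal: "ideal P R \<Longrightarrow> ideal (P [^]\<^bsub>ideals_set R\<^esub> (k::nat)) R"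
  using monoid.nat_pow_closed[OF comm_monoid.axioms(1)[OF ideals_set_is_comm_monoid], of P k]
  by (simp add: ideals_set_def)

lemma pow_mem:
  assumes "ideal P R" "x \<in> P"
  shows "x [^] k \<in> P [^]\<^bsub>ideals_set R\<^esub> (k::nat)"
proof (induction k)
  case 0
  then show ?case by (simp add: ideals_set_def)
next
  case (Suc k)
  then show ?case using assms(2) ideal_prod.prod by (simp add: ideals_set_def)
qed

lemma pow_subset: "\<lbrakk>ideal P R; 0 < k\<rbrakk> \<Longrightarrow> P [^]\<^bsub>ideals_set R\<^esub> (k::nat) \<subseteq> P"
  using ideal_prod_inter[OF pow_ideal[of P "k - 1"], of P] by (cases k) (auto simp: ideals_set_def)

lemma prime_pow_mem:
  assumes "primeideal P R" "x \<in> carrier R" "x [^] (k::nat) \<in> P"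
  shows "x \<in> P"
  using assms(3)
proof (induction k)
  case 0
  interpret P: primeideal P R by fact
  show ?case using 0 P.one_imp_carrier P.I_notcarr by auto
next
  case (Suc k)
  interpret P: primeideal P R by fact
  show ?case using Suc P.I_prime[of "x [^] k" x] assms(2) by auto
qed

text \<open>By factorization, an ideal above \<open>\<pp>\<^sup>r\<close> is \<open>R\<close>, \<open>\<pp>\<close> or contained in \<open>\<pp>\<^sup>2\<close>.  Hence every element outside
  \<open>\<pp>\<close> is a unit modulo \<open>\<pp>\<^sup>r\<close>, and every element of \<open>\<pp> - \<pp>\<^sup>2\<close> generates \<open>\<pp>\<close> modulo \<open>\<pp>\<^sup>r\<close>.\<close>

theorem residue_ring_chain_ring:
  assumes \<pp>: "primeideal \<pp> R" and fin: "finite (carrier (R Quot \<pp>))" and r: "1 \<le> r"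
  shows "\<exists>\<pi> s. chain_ring (residue_ring_pow R \<pp> r) \<pi> s"
proof -
  define I where "I = \<pp> [^]\<^bsub>ideals_set R\<^esub> r"
  interpret P: primeideal \<pp> R by (rule \<pp>)
  have Pi: "ideal \<pp> R" by (rule P.is_ideal)
  have Ii: "ideal I R" unfolding I_def by (rule pow_ideal[OF Pi])
  interpret I: ideal I R by (rule Ii)
  have IP: "I \<subseteq> \<pp>" unfolding I_def using pow_subset[OF Pi] r by simp
  define K where "K = R Quot I"
  interpret K: cring K unfolding K_def by (rule I.quotient_is_cring[OF is_cring])
  interpret D: "domain" "R Quot \<pp>" by (rule P.quotient_is_domain)
  show ?thesis
  proof (cases "I = \<pp>")
    \<comment> \<open>This covers r = 1 and an idempotent \<pp>, such as the zero ideal. The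
      quotient is a finite domain, hence a field, and its uniformizer is 0.\<close>
    case True
    have "a \<in> Units (R Quot \<pp>) \<or> (\<exists>b\<in>carrier (R Quot \<pp>). a = \<zero>\<^bsub>R Quot \<pp>\<^esub> \<otimes>\<^bsub>R Quot \<pp>\<^esub> b)"
      if "a \<in> carrier (R Quot \<pp>)" for a
      using D.finite_domain_Units[OF fin that] by (cases "a = \<zero>\<^bsub>R Quot \<pp>\<^esub>") auto
    then have "\<exists>s. chain_ring (R Quot \<pp>) \<zero>\<^bsub>R Quot \<pp>\<^esub> s"
      using D.chain_ring_of_nilpotent[OF fin D.one_not_zero D.zero_closed, of 1] by auto
    then show ?thesis unfolding residue_ring_pow_def I_def[symmetric] True by blast
  next
    case False
    let ?h = "\<lambda>x. I +> x" and ?k = "\<lambda>x. \<pp> +> x"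
    have hh: "ring_hom_cring R K ?h" unfolding K_def by (rule I.rcos_ring_hom_cring[OF is_cring])
    have kk: "ring_hom_cring R (R Quot \<pp>) ?k" by (rule P.rcos_ring_hom_cring)
    interpret h: ring_hom_cring R K ?h by (rule hh)
    interpret k: ring_hom_cring R "R Quot \<pp>" ?k by (rule kk)
    have h0: "?h x = \<zero>\<^bsub>K\<^esub> \<longleftrightarrow> x \<in> I" if "x \<in> carrier R" for x
    proof -
      have "\<zero>\<^bsub>K\<^esub> = I" unfolding K_def FactRing_def by simp
      then show ?thesis using I.rcos_const_imp_mem[OF that] a_rcos_zero[OF Ii, of x] by blast
    qed
    have k0: "?k x = \<zero>\<^bsub>R Quot \<pp>\<^esub> \<longleftrightarrow> x \<in> \<pp>" if "x \<in> carrier R" for x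
    proof -
      have "\<zero>\<^bsub>R Quot \<pp>\<^esub> = \<pp>" unfolding FactRing_def by simp
      then show ?thesis using P.rcos_const_imp_mem[OF that] a_rcos_zero[OF Pi, of x] by blast
    qed
    have hsurj: "\<exists>x\<in>carrier R. a = ?h x" if "a \<in> carrier K" for a
      using that unfolding K_def FactRing_def A_RCOSETS_def' by auto
    have ksurj: "\<exists>x\<in>carrier R. a = ?k x" if "a \<in> carrier (R Quot \<pp>)" for a
      using that unfolding FactRing_def A_RCOSETS_def' by auto
    \<comment> \<open>The finite domain R/\<pp> is a field; lifting its inverses to R shows below
      that \<pp> is maximal.\<close>
    have inv_mod: "\<exists>y\<in>carrier R. x \<otimes> y \<ominus> \<one> \<in> \<pp>" if x: "x \<in> carrier R" "x \<notin> \<pp>" for x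
    proof -
      have "?k x \<in> Units (R Quot \<pp>)" using D.finite_domain_Units[OF fin] k0 x by simp
      then obtain c where c: "c \<in> carrier (R Quot \<pp>)" "?k x \<otimes>\<^bsub>R Quot \<pp>\<^esub> c = \<one>\<^bsub>R Quot \<pp>\<^esub>"
        by (auto simp: Units_def)
      then obtain y where y: "y \<in> carrier R" "c = ?k y" using ksurj by blast
      have "?k (x \<otimes> y) = ?k \<one>" using c y x by simp
      then show ?thesis using quotient_eq_iff_same_a_r_cos[OF Pi, of "x \<otimes> y" \<one>] x y by auto
    qed
    have maximal: "J = carrier R" if J: "ideal J R" "\<pp> \<subseteq> J" "J \<noteq> \<pp>" for J
    proof -
      interpret J: ideal J R by (rule J(1))
      obtain x where x: "x \<in> J" "x \<notin> \<pp>" using J by blast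
      then have xc: "x \<in> carrier R" using J.Icarr by blast
      obtain y where y: "y \<in> carrier R" "x \<otimes> y \<ominus> \<one> \<in> \<pp>" using inv_mod xc x by blast
      have "\<one> = x \<otimes> y \<ominus> (x \<otimes> y \<ominus> \<one>)"
        using xc y(1) by (simp add: a_minus_def minus_add a_assoc[symmetric] r_neg)
      moreover have "x \<otimes> y \<in> J" using x y J.I_r_closed by blast
      moreover have "x \<otimes> y \<ominus> \<one> \<in> J" using y J(2) by blast
      ultimately have "\<one> \<in> J" using J.a_closed J.a_inv_closed unfolding a_minus_def by metis
      then show ?thesis by (rule J.one_imp_carrier)
    qed
    \<comment> \<open>In a domain a vanishing power of \<pp> forces \<pp> = 0 and thus I = \<pp>,
      the case already treated. Ideals above I are therefore nonzero and can be factored.\<close>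
    have I0: "I \<noteq> {\<zero>}"
    proof
      assume I0: "I = {\<zero>}"
      have "x = \<zero>" if "x \<in> \<pp>" for x
        using pow_mem[OF Pi that, of r] I0 prime_pow_mem[OF zeroprimeideal, of x r] P.Icarr[OF that]
        by (auto simp: I_def)
      then have "\<pp> \<subseteq> {\<zero>}" by blast
      then show False using I0 IP False by blast
    qed
    have trichotomy: "J = carrier R \<or> J = \<pp> \<or> J \<subseteq> \<pp> \<cdot> \<pp>" if J: "ideal J R" "I \<subseteq> J" for J
    proof (cases "J = carrier R")
      case Jne: False
      have "J \<noteq> {\<zero>}" using I0 J(2) I.zero_closed by blast
      then obtain Ps where Ps: "\<forall>P\<in>set Ps. primeideal P R" "J = foldr (ideal_prod R) Ps (carrier R)"
        using ideal_factorization[OF J(1) _ Jne] by blast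
      have Psi: "\<forall>P\<in>set Ps. ideal P R" using Ps(1) primeideal.axioms(1) by blast
      \<comment> \<open>A prime factor P of J contains \<open>\<pp>\<^sup>r\<close>, hence \<pp>
        because P is prime, and equals \<pp> by maximality. So J is a power of \<pp>.\<close>
      have all: "P = \<pp>" if P: "P \<in> set Ps" for P
      proof -
        have "I \<subseteq> P" using foldr_subset[OF Psi P] Ps(2) J(2) by blast
        then have "\<pp> \<subseteq> P"
          using pow_mem[OF Pi, of _ r] prime_pow_mem[of P _ r] Ps(1) P P.Icarr unfolding I_def by blast
        moreover have "P \<noteq> carrier R" using Ps(1) P primeideal.I_notcarr by blast
        ultimately show ?thesis using maximal Psi P by blast
      qed
      show ?thesis
      proof (cases Ps)
        case Nil
        then show ?thesis using Ps(2) by simp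
      next
        case (Cons Q Qs)
        then have Q: "Q = \<pp>" using all by simp
        show ?thesis
        proof (cases Qs)
          case Nil
          then show ?thesis using Ps(2) Cons Q ideal_prod_one[OF Pi] by simp
        next
          case (Cons Q' Qs')
          then have "foldr (ideal_prod R) Qs (carrier R) \<subseteq> \<pp>"
            using foldr_subset[of Qs Q'] all Psi \<open>Ps = Q # Qs\<close> by auto
          then show ?thesis using Ps(2) \<open>Ps = Q # Qs\<close> Q ideal_prod_mono by auto
        qed
      qed
    qed simp
    have "\<pp> \<cdot> \<pp> \<noteq> \<pp>"
    proof
      assume e: "\<pp> \<cdot> \<pp> = \<pp>"
      have "\<pp> [^]\<^bsub>ideals_set R\<^esub> Suc k = \<pp>" for k
      proof (induction k)
        case 0
        then show ?case using ideal_prod_one[OF Pi] ideal_prod_commute[OF Pi oneideal]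
          by (simp add: ideals_set_def)
      next
        case (Suc k)
        then show ?case using e by (simp add: ideals_set_def)
      qed
      then show False using False r unfolding I_def by (metis Suc_le_D One_nat_def)
    qed
    then obtain t where t: "t \<in> \<pp>" "t \<notin> \<pp> \<cdot> \<pp>" using ideal_prod_inter[OF Pi Pi] by blast
    have tc: "t \<in> carrier R" using t P.Icarr by blast
    \<comment> \<open>The ideal (x) + I is the preimage in R of the principal ideal generated by the
      class of x. For x outside \<pp> the trichotomy makes it R, and for x = t it makes it
      \<pp>.\<close>
    define gen where "gen x = set_add R (PIdl x) I" for x
    have gen_iff: "y \<in> gen x \<longleftrightarrow> (\<exists>a\<in>carrier R. \<exists>i\<in>I. y = a \<otimes> x \<oplus> i)" for x y
      unfolding gen_def set_add_def' cgenideal_def by blast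
    have gen: "ideal (gen x) R" "I \<subseteq> gen x" "x \<in> gen x" if x: "x \<in> carrier R" for x
    proof -
      show "ideal (gen x) R" unfolding gen_def using add_ideals cgenideal_ideal[OF x] Ii by blast
      show "I \<subseteq> gen x"
      proof
        fix y assume y: "y \<in> I"
        then have "y = \<zero> \<otimes> x \<oplus> y" using I.Icarr x by simp
        then show "y \<in> gen x" unfolding gen_iff using y by blast
      qed
      have "x = \<one> \<otimes> x \<oplus> \<zero>" using x by simp
      then show "x \<in> gen x" unfolding gen_iff using I.zero_closed by blast
    qed
    have unit: "?h x \<in> Units K" if x: "x \<in> carrier R" "x \<notin> \<pp>" for x
    proof -
      have "gen x = carrier R"
        using trichotomy[OF gen(1,2)[OF x(1)]] gen(3)[OF x(1)] x(2) ideal_prod_inter[OF Pi Pi] by blast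
      then obtain a i where a: "a \<in> carrier R" "i \<in> I" "\<one> = a \<otimes> x \<oplus> i" using gen_iff[of \<one> x] by auto
      have ic: "i \<in> carrier R" using a I.Icarr by blast
      have "\<one>\<^bsub>K\<^esub> = ?h (a \<otimes> x \<oplus> i)" using a(3) h.hom_one by simp
      also have "\<dots> = ?h a \<otimes>\<^bsub>K\<^esub> ?h x"
        using a(1,2) ic x(1) h0[OF ic] by simp
      finally have "?h a \<otimes>\<^bsub>K\<^esub> ?h x = \<one>\<^bsub>K\<^esub>" by simp
      then show ?thesis using a(1) x(1) by (auto simp: Units_def K.m_comm)
    qed
    have mult: "\<exists>b\<in>carrier K. ?h x = ?h t \<otimes>\<^bsub>K\<^esub> b" if x: "x \<in> \<pp>" for x
    proof -
      have sub: "gen t \<subseteq> \<pp>"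
        using IP P.I_l_closed[OF t(1)] P.a_closed unfolding subset_iff gen_iff by auto
      then have "gen t = \<pp>"
        using trichotomy[OF gen(1,2)[OF tc]] gen(3)[OF tc] t(2) P.I_notcarr P.a_subset by blast
      then obtain a i where a: "a \<in> carrier R" "i \<in> I" "x = a \<otimes> t \<oplus> i" using gen_iff[of x t] x by blast
      have ic: "i \<in> carrier R" using a I.Icarr by blast
      have "?h x = ?h t \<otimes>\<^bsub>K\<^esub> ?h a"
        unfolding a(3) using a(1,2) ic tc h0[OF ic] by (simp add: K.m_comm)
      then show ?thesis using a(1) by auto
    qed
    have pow: "?h t [^]\<^bsub>K\<^esub> r = \<zero>\<^bsub>K\<^esub>"
    proof -
      have "?h (t [^] k) = ?h t [^]\<^bsub>K\<^esub> k" for k :: nat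
        by (induction k) (use tc in auto)
      moreover have "t [^] r \<in> I" unfolding I_def by (rule pow_mem[OF Pi t(1)])
      ultimately show ?thesis using h0[of "t [^] r"] tc by (metis nat_pow_closed)
    qed
    have finK: "finite (carrier K)"
    \<comment> \<open>The digits are the classes of representatives of R/\<pp>, since \<pp> is
      generated by t modulo I.\<close>
    proof (rule K.finite_of_nilpotent[OF _ pow])
      define rep where "rep C = (SOME x. x \<in> carrier R \<and> C = ?k x)" for C
      have rep: "rep C \<in> carrier R \<and> C = ?k (rep C)" if "C \<in> carrier (R Quot \<pp>)" for C
        unfolding rep_def by (rule someI_ex) (use ksurj[OF that] in blast)
      let ?Y = "(\<lambda>C. ?h (rep C)) ` carrier (R Quot \<pp>)"
      show "finite ?Y" using fin by simp
      show "?Y \<subseteq> carrier K" using rep by auto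
      fix a assume "a \<in> carrier K"
      then obtain x where x: "x \<in> carrier R" "a = ?h x" using hsurj by blast
      let ?x = "rep (?k x)"
      have rx: "?x \<in> carrier R" "?k x = ?k ?x" using rep[of "?k x"] x by auto
      then have "x \<ominus> ?x \<in> \<pp>" using quotient_eq_iff_same_a_r_cos[OF Pi x(1) rx(1)] by simp
      then obtain b where b: "b \<in> carrier K" "?h (x \<ominus> ?x) = ?h t \<otimes>\<^bsub>K\<^esub> b" using mult by blast
      have "x = ?x \<oplus> (x \<ominus> ?x)" using x rx by (simp add: a_minus_def a_lcomm r_neg)
      then have "a = ?h ?x \<oplus>\<^bsub>K\<^esub> ?h (x \<ominus> ?x)" using x rx h.hom_add by (metis minus_closed)
      then show "\<exists>y\<in>?Y. \<exists>b\<in>carrier K. a = y \<oplus>\<^bsub>K\<^esub> ?h t \<otimes>\<^bsub>K\<^esub> b" using b x by auto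
    qed (use tc in simp)
    have "\<one> \<notin> I" using IP P.one_imp_carrier P.I_notcarr by blast
    then have one: "\<one>\<^bsub>K\<^esub> \<noteq> \<zero>\<^bsub>K\<^esub>" using h0[of \<one>] h.hom_one by simp
    have "a \<in> Units K \<or> (\<exists>b\<in>carrier K. a = ?h t \<otimes>\<^bsub>K\<^esub> b)" if "a \<in> carrier K" for a
      using hsurj[OF that] unit mult by blast
    then have "\<exists>s. chain_ring K (?h t) s"
      using K.chain_ring_of_nilpotent[OF finK one _ pow] tc by simp
    then show ?thesis unfolding residue_ring_pow_def K_def I_def by blast
  qed
qed

end

section \<open>Complexes and automorphism groups\<close>

text \<open>The common form of both complexes. With only two ranks a chain has at most two members,
  so that the graph is a flag complex too.\<close>

definition flags :: "'v set set \<Rightarrow> 'v set set set" where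
  "flags S = {T. T \<noteq> {} \<and> finite T \<and> T \<subseteq> S \<and> (\<forall>U\<in>T. \<forall>V\<in>T. U \<subseteq> V \<or> V \<subseteq> U)}"

lemma Union_flags: "\<Union>(flags S) = S"
proof
  show "S \<subseteq> \<Union>(flags S)"
  proof
    fix U assume "U \<in> S"
    then have "{U} \<in> flags S" by (simp add: flags_def)
    then show "U \<in> \<Union>(flags S)" by blast
  qed
qed (auto simp: flags_def)

lemma edge_flag: "\<lbrakk>U \<in> S; V \<in> S\<rbrakk> \<Longrightarrow> {U, V} \<in> flags S \<longleftrightarrow> U \<subseteq> V \<or> V \<subseteq> U"
  by (auto simp: flags_def)

text \<open>A flag complex is determined by its edges: the two-element cells express comparability,
  and a finite set is a cell as soon as its members are pairwise comparable.\<close>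

lemma simplicial_isos_flags:
  "simplicial_isos (flags S) (flags T) = {f \<in> extensional S. comparability_map f S T}"
proof (intro equalityI subsetI)
  fix f assume f: "f \<in> simplicial_isos (flags S) (flags T)"
  then have b: "bij_betw f S T" and cells: "\<And>Q. Q \<subseteq> S \<Longrightarrow> Q \<in> flags S \<longleftrightarrow> f ` Q \<in> flags T"
    by (auto simp: simplicial_isos_def Union_flags)
  have "(f U \<subseteq> f V \<or> f V \<subseteq> f U) \<longleftrightarrow> (U \<subseteq> V \<or> V \<subseteq> U)" if "U \<in> S" "V \<in> S" for U V
    using cells[of "{U, V}"] that edge_flag[OF that] edge_flag[of "f U" T "f V"] bij_betwE[OF b] by simp
  then show "f \<in> {f \<in> extensional S. comparability_map f S T}"
    using f b by (simp add: comparability_map_def simplicial_isos_def Union_flags)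
next
  fix f assume f: "f \<in> {f \<in> extensional S. comparability_map f S T}"
  then have c: "comparability_map f S T" by simp
  note D = comparability_mapD[OF c]
  have "Q \<in> flags S \<longleftrightarrow> f ` Q \<in> flags T" if Q: "Q \<subseteq> S" for Q
  proof -
    have "finite (f ` Q) \<longleftrightarrow> finite Q" using finite_image_iff inj_on_subset[OF D(2) Q] by blast
    moreover have "f ` Q \<subseteq> T" using D(3) Q by blast
    moreover have "(\<forall>U\<in>Q. \<forall>V\<in>Q. f U \<subseteq> f V \<or> f V \<subseteq> f U) \<longleftrightarrow> (\<forall>U\<in>Q. \<forall>V\<in>Q. U \<subseteq> V \<or> V \<subseteq> U)"
      using D(4) Q by (meson subsetD)
    ultimately show ?thesis using Q by (simp add: flags_def)
  qed
  then show "f \<in> simplicial_isos (flags S) (flags T)"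
    using f D(1) by (simp add: simplicial_isos_def Union_flags)
qed

lemma comparability_map_cong:
  assumes "comparability_map f S T" "\<And>V. V \<in> S \<Longrightarrow> g V = f V"
  shows "comparability_map g S T"
  using assms bij_betw_cong[of S g f T] by (simp add: comparability_map_def)

lemma comparability_map_subset:
  assumes "comparability_map f P Q" "S \<subseteq> P" "bij_betw f S S'"
  shows "comparability_map f S S'"
  using assms by (auto simp: comparability_map_def subset_iff)

text \<open>Composition in these groups is cut off at the vertex set, so restriction is
  multiplicative because every member of H maps S into itself.\<close>

lemma restrict_iso:
  assumes SP: "S \<subseteq> P" and H: "H \<subseteq> Bij P" and H': "H' \<subseteq> Bij S"
    and bij: "bij_betw (\<lambda>g. restrict g S) H H'"
  shows "(\<lambda>g. restrict g S) \<in> iso (BijGroup P\<lparr>carrier := H\<rparr>) (BijGroup S\<lparr>carrier := H'\<rparr>)"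
proof -
  have "restrict (compose P g h) S = compose S (restrict g S) (restrict h S)" if "g \<in> H" "h \<in> H" for g h
  proof -
    have "restrict h S \<in> Bij S" using bij_betwE[OF bij] H' that by blast
    then have "h V \<in> S" if "V \<in> S" for V
      using funcset_mem[OF Bij_imp_funcset, of "restrict h S" S V] that by simp
    then show ?thesis using SP by (auto simp: fun_eq_iff compose_def)
  qed
  moreover have "g \<in> Bij P" "restrict g S \<in> Bij S" "restrict g S \<in> H'" if "g \<in> H" for g
    using bij_betwE[OF bij] H H' that by blast+
  ultimately show ?thesis
    using bij by (simp add: iso_def hom_def BijGroup_def)
qed

section \<open>Vertices, colors and cells in terms of \<open>Fr\<close>\<close>

locale free_module_space = chain_ring K \<pi> s for K (structure) and \<pi> s +
  fixes d :: nat
begin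

sublocale V: free_space K \<pi> s "free_module K d" d "\<lambda>x y. \<Oplus>i\<in>{..<d}. x i \<otimes> y i"
  by (rule free_module_space)

lemma basis_card:
  assumes N: "N \<in> V.Fr k" and B: "module_basis K (free_module K d) N B"
  shows "card B = k"
proof -
  have "card N = card (carrier K) ^ card B"
    by (rule card_module_basis[OF is_cring finite_ring V.Fr_sub[OF N] B])
  then show ?thesis using V.Fr_card[OF N] q_gt_1 by (simp add: q_def)
qed

lemma color_eq:
  assumes N: "N \<in> V.Fr k"
  shows "color K d N = k"
proof -
  obtain B where B: "module_basis K (free_module K d) N B" using V.Fr_basis[OF N] by blast
  show ?thesis
    unfolding color_def module_rank_def
    by (rule the_equality) (use B basis_card[OF N] in blast)+
qed

lemma proper_free_submodules_eq: "proper_free_submodules K d = V.Fr_range 1 (d - 1)"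
proof (intro equalityI subsetI)
  fix N assume "N \<in> proper_free_submodules K d"
  then obtain B where N: "submodule N K (free_module K d)" "N \<noteq> {\<zero>\<^bsub>free_module K d\<^esub>}"
    "N \<noteq> carrier (free_module K d)" and B: "module_basis K (free_module K d) N B"
    by (auto simp: proper_free_submodules_def)
  obtain k where k: "N \<in> V.Fr k" using V.pure_in_Fr[OF V.basis_pure[OF N(1) B]] by blast
  have "k \<noteq> 0" using V.Fr_zero k N(2) by metis
  moreover have "k \<noteq> d" using V.Fr_full k N(3) by metis
  ultimately show "N \<in> V.Fr_range 1 (d - 1)" using V.Fr_le_dim[OF k] by (intro V.Fr_rangeI[OF k]) auto
next
  fix N assume "N \<in> V.Fr_range 1 (d - 1)"
  then obtain k where k: "N \<in> V.Fr k" "1 \<le> k" "k \<le> d - 1" by (rule V.Fr_rangeE)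
  have "N \<noteq> {\<zero>\<^bsub>free_module K d\<^esub>}" using V.Fr_rank_unique[OF k(1)] V.zero_in_Fr k(2) by force
  moreover have "N \<noteq> carrier (free_module K d)"
    using V.Fr_rank_unique[OF k(1)] V.carrier_in_Fr k(2,3) by force
  ultimately show "N \<in> proper_free_submodules K d"
    using V.Fr_sub[OF k(1)] V.Fr_basis[OF k(1)] by (simp add: proper_free_submodules_def)
qed

lemma color_vertices_eq: "\<lbrakk>1 \<le> k; k \<le> d - 1\<rbrakk> \<Longrightarrow> color_vertices K d k = V.Fr k"
  unfolding color_vertices_def proper_free_submodules_eq
  using color_eq V.Fr_rangeI by (auto elim: V.Fr_rangeE)

lemma free_projective_space_eq: "free_projective_space K d = flags (V.Fr_range 1 (d - 1))"
  by (simp add: free_projective_space_def flags_def proper_free_submodules_eq)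

lemma color_graph_eq:
  assumes "1 \<le> m" "m < n" "n \<le> d - 1"
  shows "color_graph K d m n = flags (V.Fr m \<union> V.Fr n)"
proof -
  have c: "color_vertices K d m = V.Fr m" "color_vertices K d n = V.Fr n"
    using color_vertices_eq assms by auto
  have sub: "V.Fr m \<union> V.Fr n \<subseteq> V.Fr_range 1 (d - 1)"
    using V.Fr_rangeI assms by auto
  have e: "color_graph K d m n = {S \<in> free_projective_space K d. S \<subseteq> V.Fr m \<union> V.Fr n}"
    using color_graph_induced[OF is_cring finite_ring one_neq_zero assms(2), of d] unfolding c .
  show ?thesis
    unfolding e free_projective_space_eq flags_def using sub by blast
qed

lemma finite_Fr: "finite (V.Fr k)"
proof (rule finite_subset)
  show "V.Fr k \<subseteq> Pow (carrier (free_module K d))" using V.Fr_subset by blast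
qed (simp add: V.finite_space)

end

locale free_module_pair = A: free_module_space K \<pi> s d + B: free_module_space K' \<pi>' s' d'
  for K \<pi> s d K' \<pi>' s' d'
begin

sublocale two_spaces K \<pi> s "free_module K d" d "\<lambda>x y. \<Oplus>\<^bsub>K\<^esub>i\<in>{..<d}. x i \<otimes>\<^bsub>K\<^esub> y i"
  K' \<pi>' s' "free_module K' d'" d' "\<lambda>x y. \<Oplus>\<^bsub>K'\<^esub>i\<in>{..<d'}. x i \<otimes>\<^bsub>K'\<^esub> y i"
  by unfold_locales

lemma extend_simplicial_iso:
  assumes r: "1 \<le> m" "m < n" "n \<le> d - 1" and r': "1 \<le> m'" "m' < n'" "n' \<le> d' - 1"
    and f: "f \<in> simplicial_isos (color_graph K d m n) (color_graph K' d' m' n')"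
  shows "\<exists>g\<in>simplicial_isos (free_projective_space K d) (free_projective_space K' d').
    restrict g (\<Union>(color_graph K d m n)) = f"
proof -
  let ?S = "A.V.Fr m \<union> A.V.Fr n" and ?P = "A.V.Fr_range 1 (d - 1)"
  note eqs = A.color_graph_eq[OF r] B.color_graph_eq[OF r'] A.free_projective_space_eq
    B.free_projective_space_eq simplicial_isos_flags Union_flags
  have f': "f \<in> extensional ?S" "comparability_map f ?S (B.V.Fr m' \<union> B.V.Fr n')"
    using f by (simp_all add: eqs)
  have "0 < m" "n < d" "0 < m'" "n' < d'" using r r' by auto
  then obtain g where g: "comparability_map g ?P (B.V.Fr_range 1 (d' - 1))" "\<forall>W\<in>?S. g W = f W"
    using comparability_extend[OF f'(2)] r(2) r'(2) by blast
  have SP: "?S \<subseteq> ?P" using A.V.Fr_rangeI r by auto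
  have "restrict g ?P \<in> {g \<in> extensional ?P. comparability_map g ?P (B.V.Fr_range 1 (d' - 1))}"
    using comparability_map_cong[OF g(1), of "restrict g ?P"] by simp
  moreover have "restrict (restrict g ?P) ?S = f"
    using f'(1) g(2) SP by (auto simp: fun_eq_iff extensional_def)
  ultimately show ?thesis unfolding eqs by blast
qed

lemma simplicial_iso_unique:
  assumes r: "1 \<le> m" "m < n" "n \<le> d - 1" and d': "2 < d'"
    and g: "g \<in> simplicial_isos (free_projective_space K d) (free_projective_space K' d')"
    and h: "h \<in> simplicial_isos (free_projective_space K d) (free_projective_space K' d')"
    and eq: "restrict g (\<Union>(color_graph K d m n)) = restrict h (\<Union>(color_graph K d m n))"
  shows "g = h"
proof -
  let ?S = "A.V.Fr m \<union> A.V.Fr n" and ?P = "A.V.Fr_range 1 (d - 1)"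
  note eqs = A.color_graph_eq[OF r] A.free_projective_space_eq
    B.free_projective_space_eq simplicial_isos_flags Union_flags
  have ext: "g \<in> extensional ?P" "h \<in> extensional ?P"
    and c: "comparability_map g ?P (B.V.Fr_range 1 (d' - 1))" "comparability_map h ?P (B.V.Fr_range 1 (d' - 1))"
    using g h by (simp_all add: eqs)
  have agree: "g W = h W" if "W \<in> ?S" for W
    using fun_cong[OF eq[unfolded eqs], of W] that by simp
  have "0 < m" "n < d" using r by auto
  then have "g V = h V" if "V \<in> ?P" for V
    using comparability_unique[OF c agree _ r(2) _ d' that] by blast
  then show ?thesis using extensionalityI[OF ext] by blast
qed

end

section \<open>Restriction of automorphisms\<close>

context free_module_space
begin

sublocale self: free_module_pair K \<pi> s d K \<pi> s d
  by unfold_locales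

lemma Aut_color:
  assumes d: "2 < d" and g: "g \<in> carrier (Aut (free_projective_space K d))"
  shows "(\<forall>k V. V \<in> V.Fr k \<longrightarrow> 1 \<le> k \<longrightarrow> k \<le> d - 1 \<longrightarrow> g V \<in> V.Fr k) \<or>
    (\<forall>k V. V \<in> V.Fr k \<longrightarrow> 1 \<le> k \<longrightarrow> k \<le> d - 1 \<longrightarrow> g V \<in> V.Fr (d - k))"
proof -
  have "comparability_map g (V.Fr_range 1 (d - 1)) (V.Fr_range 1 (d - 1))"
    using g by (simp add: Aut_def free_projective_space_eq simplicial_isos_flags)
  then show ?thesis using self.comparability_rank d by blast
qed

text \<open>There are finitely many vertices, so an injective map of the two ranks into themselves
  is onto.\<close>

lemma Aut_restrict:
  assumes r: "1 \<le> m" "m < n" "n \<le> d - 1" and g: "g \<in> carrier (Aut (free_projective_space K d))"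
    and stable: "\<And>W. W \<in> V.Fr m \<union> V.Fr n \<Longrightarrow> g W \<in> V.Fr m \<union> V.Fr n"
  shows "restrict g (\<Union>(color_graph K d m n)) \<in> carrier (Aut (color_graph K d m n))"
proof -
  let ?S = "V.Fr m \<union> V.Fr n" and ?P = "V.Fr_range 1 (d - 1)"
  note eqs = color_graph_eq[OF r] free_projective_space_eq simplicial_isos_flags Union_flags Aut_def
  have c: "comparability_map g ?P ?P" using g by (simp add: eqs)
  have SP: "?S \<subseteq> ?P" using V.Fr_rangeI r by auto
  have inj: "inj_on g ?S" using comparability_mapD(2)[OF c] SP inj_on_subset by blast
  have "g ` ?S \<subseteq> ?S" using stable by blast
  then have "g ` ?S = ?S" using endo_inj_surj[OF _ _ inj] finite_Fr by blast
  then have "comparability_map g ?S ?S"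
    using comparability_map_subset[OF c SP] inj by (simp add: bij_betw_def)
  then have "comparability_map (restrict g ?S) ?S ?S"
    by (rule comparability_map_cong) simp
  then show ?thesis by (simp add: eqs)
qed

text \<open>Injectivity is uniqueness of extensions and surjectivity is their existence. It remains
  to see which automorphisms of the complex act on the graph: those that do not keep colors send k
  to d - k, and they keep the set of the two colors exactly when m + n = d.\<close>

theorem restriction_isos:
  assumes r: "1 \<le> m" "m < n" "n \<le> d - 1"
  defines "S \<equiv> \<Union>(color_graph K d m n)"
  shows "(\<lambda>g. restrict g S) \<in> iso (Aut0 (color K d) (free_projective_space K d)) (Aut0 (color K d) (color_graph K d m n))"
    and "m + n = d \<Longrightarrow> (\<lambda>g. restrict g S) \<in> iso (Aut (free_projective_space K d)) (Aut (color_graph K d m n))"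
    and "m + n \<noteq> d \<Longrightarrow>
      (\<lambda>g. restrict g S) \<in> iso (Aut0 (color K d) (free_projective_space K d)) (Aut (color_graph K d m n))"
proof -
  let ?C = "free_projective_space K d" and ?G = "color_graph K d m n"
  let ?P = "V.Fr_range 1 (d - 1)"
  have d: "2 < d" using r by auto
  have S: "S = V.Fr m \<union> V.Fr n" unfolding S_def color_graph_eq[OF r] Union_flags ..
  have P: "\<Union>?C = ?P" unfolding free_projective_space_eq Union_flags ..
  have SP: "S \<subseteq> ?P" unfolding S using V.Fr_rangeI r by auto
  have ranks: "1 \<le> m" "m \<le> d - 1" "1 \<le> n" "n \<le> d - 1" using r by auto
  have AutC: "carrier (Aut ?C) = simplicial_isos ?C ?C" and AutG: "carrier (Aut ?G) = simplicial_isos ?G ?G"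
    by (simp_all add: Aut_def)
  let ?H = "carrier (Aut0 (color K d) ?C)" and ?L = "carrier (Aut0 (color K d) ?G)"
  have C0: "?H = {g \<in> carrier (Aut ?C). \<forall>V\<in>?P. color K d (g V) = color K d V}"
    and G0: "?L = {g \<in> carrier (Aut ?G). \<forall>V\<in>S. color K d (g V) = color K d V}"
    by (simp_all add: Aut0_def Aut_def P S_def)
  have BijC: "carrier (Aut ?C) \<subseteq> Bij ?P"
  proof -
    have "carrier (Aut ?C) = {g \<in> extensional ?P. comparability_map g ?P ?P}"
      unfolding AutC by (simp add: free_projective_space_eq simplicial_isos_flags)
    then show ?thesis using comparability_mapD(1) by (auto simp: Bij_def)
  qed
  have BijG: "carrier (Aut ?G) \<subseteq> Bij S"
  proof -
    have "carrier (Aut ?G) = {g \<in> extensional S. comparability_map g S S}"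
      unfolding AutG by (simp add: color_graph_eq[OF r] S simplicial_isos_flags)
    then show ?thesis using comparability_mapD(1) by (auto simp: Bij_def)
  qed
  have inj: "inj_on (\<lambda>g. restrict g S) (carrier (Aut ?C))"
    using self.simplicial_iso_unique[OF r d] unfolding AutC S_def by (intro inj_onI) blast
  have ext: "\<exists>g\<in>carrier (Aut ?C). restrict g S = f" if "f \<in> carrier (Aut ?G)" for f
    using self.extend_simplicial_iso[OF r r] that unfolding AutC AutG S_def by blast
  have mem: "g W \<in> S" if "restrict g S \<in> carrier (Aut ?G)" "W \<in> S" for g W
    using funcset_mem[OF Bij_imp_funcset, of "restrict g S" S W] that BijG by auto
  have preserving: "g \<in> ?H \<longleftrightarrow> (\<forall>k V. V \<in> V.Fr k \<longrightarrow> 1 \<le> k \<longrightarrow> k \<le> d - 1 \<longrightarrow> g V \<in> V.Fr k)"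
    if g: "g \<in> carrier (Aut ?C)" for g
  proof
    assume g0: "g \<in> ?H"
    show "\<forall>k V. V \<in> V.Fr k \<longrightarrow> 1 \<le> k \<longrightarrow> k \<le> d - 1 \<longrightarrow> g V \<in> V.Fr k"
    proof (intro allI impI)
      fix k V assume V: "V \<in> V.Fr k" "1 \<le> k" "k \<le> d - 1"
      have VP: "V \<in> ?P" by (rule V.Fr_rangeI[OF V])
      then have "g V \<in> ?P" using g BijC Bij_imp_funcset by blast
      then obtain j where j: "g V \<in> V.Fr j" by (rule V.Fr_rangeE)
      have "color K d (g V) = color K d V" using g0 VP unfolding C0 by blast
      then show "g V \<in> V.Fr k" using color_eq[OF j] color_eq[OF V(1)] j by simp
    qed
  next
    assume p: "\<forall>k V. V \<in> V.Fr k \<longrightarrow> 1 \<le> k \<longrightarrow> k \<le> d - 1 \<longrightarrow> g V \<in> V.Fr k"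
    have "color K d (g V) = color K d V" if V: "V \<in> ?P" for V
    proof -
      obtain k where "V \<in> V.Fr k" "1 \<le> k" "k \<le> d - 1" using V by (rule V.Fr_rangeE)
      then show ?thesis using p color_eq by metis
    qed
    then show "g \<in> ?H" unfolding C0 using g by blast
  qed
  have stable: "restrict g S \<in> ?L" if "g \<in> ?H" for g
  proof -
    have g: "g \<in> carrier (Aut ?C)" using that C0 by blast
    then have "g W \<in> V.Fr m \<union> V.Fr n" if "W \<in> V.Fr m \<union> V.Fr n" for W
      using preserving[OF g] \<open>g \<in> ?H\<close> ranks that by blast
    then have "restrict g S \<in> carrier (Aut ?G)" unfolding S_def using Aut_restrict[OF r g] by blast
    then show ?thesis unfolding G0 using \<open>g \<in> ?H\<close> SP unfolding C0 by (auto simp: subset_iff)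
  qed
  have "n \<le> d" "m \<le> n" using r by auto
  then obtain V0 where V0: "V0 \<in> V.Fr n" using V.Fr_below[OF V.carrier_in_Fr] by blast
  obtain U0 where U0: "U0 \<in> V.Fr m" using V.Fr_below[OF V0 \<open>m \<le> n\<close>] by blast
  have swaps: "g U0 \<in> V.Fr (d - m) \<and> g V0 \<in> V.Fr (d - n)"
    if g: "g \<in> carrier (Aut ?C)" "g \<notin> ?H" for g
    using Aut_color[OF d g(1)] preserving[OF g(1)] g(2) U0 V0 ranks by blast
  \<comment> \<open>If colors were reversed, both d - m and d - n would be among m and n; as m < n,
    this leaves only m + n = d.\<close>
  have in_C0: "g \<in> ?H" if g: "g \<in> carrier (Aut ?C)" and f: "restrict g S \<in> carrier (Aut ?G)" and mn: "m + n \<noteq> d" for g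
  proof (rule ccontr)
    assume "g \<notin> ?H"
    then have sw: "g U0 \<in> V.Fr (d - m)" "g V0 \<in> V.Fr (d - n)" using swaps g by blast+
    have "g U0 \<in> V.Fr m \<union> V.Fr n" "g V0 \<in> V.Fr m \<union> V.Fr n"
      using mem[OF f] U0 V0 unfolding S by blast+
    then have "d - m = m \<or> d - m = n" "d - n = m \<or> d - n = n"
      using V.Fr_rank_unique[OF sw(1)] V.Fr_rank_unique[OF sw(2)] by blast+
    then show False using mn r by auto
  qed
  \<comment> \<open>A reversal that keeps the colors on the graph would give d = 2m = 2n, against m
    < n.\<close>
  have col0: "g \<in> ?H" if g: "g \<in> carrier (Aut ?C)" and f: "restrict g S \<in> ?L" for g
  proof (rule ccontr)
    assume "g \<notin> ?H"
    then have sw: "g U0 \<in> V.Fr (d - m)" "g V0 \<in> V.Fr (d - n)" using swaps g by blast+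
    have "color K d (g U0) = color K d U0" "color K d (g V0) = color K d V0"
      using f U0 V0 unfolding G0 S by auto
    then have "d - m = m" "d - n = n"
      using color_eq[OF sw(1)] color_eq[OF sw(2)] color_eq[OF U0] color_eq[OF V0] by auto
    then show False using r by auto
  qed
  have "bij_betw (\<lambda>g. restrict g S) ?H ?L"
    unfolding bij_betw_def
  proof
    show "inj_on (\<lambda>g. restrict g S) ?H" using inj_on_subset[OF inj] C0 by blast
    show "(\<lambda>g. restrict g S) ` ?H = ?L"
    proof
      show "?L \<subseteq> (\<lambda>g. restrict g S) ` ?H"
      proof
        fix f assume f: "f \<in> ?L"
        then obtain g where "g \<in> carrier (Aut ?C)" "restrict g S = f" using ext G0 by blast
        then show "f \<in> (\<lambda>g. restrict g S) ` ?H" using col0 f by blast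
      qed
    qed (use stable in blast)
  qed
  moreover have "?H \<subseteq> Bij ?P" "?L \<subseteq> Bij S" using BijC BijG C0 G0 by blast+
  ultimately have "(\<lambda>g. restrict g S) \<in> iso (BijGroup ?P\<lparr>carrier := ?H\<rparr>) (BijGroup S\<lparr>carrier := ?L\<rparr>)"
    using restrict_iso[OF SP] by blast
  then show "(\<lambda>g. restrict g S) \<in> iso (Aut0 (color K d) ?C) (Aut0 (color K d) ?G)"
    by (simp add: Aut0_def P S_def)
  show "(\<lambda>g. restrict g S) \<in> iso (Aut ?C) (Aut ?G)" if mn: "m + n = d"
  proof -
    have "restrict g S \<in> carrier (Aut ?G)" if g: "g \<in> carrier (Aut ?C)" for g
    proof -
      have dual: "d - m = n" "d - n = m" using mn by auto
      \<comment> \<open>Both kinds of automorphism are covered at once; for m + n = d the two ranks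
        are exchanged by k \<mapsto> d - k.\<close>
      have "g W \<in> V.Fr k \<union> V.Fr (d - k)" if "W \<in> V.Fr k" "1 \<le> k" "k \<le> d - 1" for W k
        using Aut_color[OF d g] that by blast
      from this[of _ m] this[of _ n] have "g W \<in> V.Fr m \<union> V.Fr n" if "W \<in> V.Fr m \<union> V.Fr n" for W
        unfolding dual using ranks that by blast
      then show ?thesis unfolding S_def using Aut_restrict[OF r g] by blast
    qed
    then have "bij_betw (\<lambda>g. restrict g S) (carrier (Aut ?C)) (carrier (Aut ?G))"
      using inj ext unfolding bij_betw_def by blast
    then have "(\<lambda>g. restrict g S)
        \<in> iso (BijGroup ?P\<lparr>carrier := carrier (Aut ?C)\<rparr>) (BijGroup S\<lparr>carrier := carrier (Aut ?G)\<rparr>)"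
      using restrict_iso[OF SP BijC BijG] by blast
    then show ?thesis by (simp add: Aut_def P S_def)
  qed
  show "(\<lambda>g. restrict g S) \<in> iso (Aut0 (color K d) ?C) (Aut ?G)" if mn: "m + n \<noteq> d"
  proof -
    have "bij_betw (\<lambda>g. restrict g S) ?H (carrier (Aut ?G))"
      unfolding bij_betw_def
    proof
      show "inj_on (\<lambda>g. restrict g S) ?H" using inj_on_subset[OF inj] C0 by blast
      show "(\<lambda>g. restrict g S) ` ?H = carrier (Aut ?G)"
      proof
        show "carrier (Aut ?G) \<subseteq> (\<lambda>g. restrict g S) ` ?H"
        proof
          fix f assume f: "f \<in> carrier (Aut ?G)"
          then obtain g where "g \<in> carrier (Aut ?C)" "restrict g S = f" using ext by blast
          then show "f \<in> (\<lambda>g. restrict g S) ` ?H" using in_C0 f mn by blast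
        qed
      qed (use stable G0 in blast)
    qed
    then have "(\<lambda>g. restrict g S)
        \<in> iso (BijGroup ?P\<lparr>carrier := ?H\<rparr>) (BijGroup S\<lparr>carrier := carrier (Aut ?G)\<rparr>)"
      using restrict_iso[OF SP _ BijG] C0 BijC by blast
    then show ?thesis by (simp add: Aut_def Aut0_def P S_def)
  qed
qed

end

text \<open>Reconstruction takes the form that isomorphisms of graphs come from isomorphisms of
  complexes, for any second ring, dimension and pair of colors; so the graph alone determines the
  complex. The equalities of groups are isomorphisms given by restriction.\<close>

theorem theorem4p1:
  fixes R :: "'a ring" and \<pp> :: "'a set" and r d m n :: nat
  defines "K \<equiv> residue_ring_pow R \<pp> r"
  assumes "dedekind_domain R" and "primeideal \<pp> R" and "finite (carrier (R Quot \<pp>))"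
    and "1 \<le> r" and "1 \<le> m" and "m < n" and "n \<le> d - 1"
  shows
    "(\<forall>(R' :: 'b ring) \<pp>' r' d' m' n'.
        dedekind_domain R' \<and> primeideal \<pp>' R' \<and> finite (carrier (R' Quot \<pp>')) \<and>
        1 \<le> r' \<and> 1 \<le> m' \<and> m' < n' \<and> n' \<le> d' - 1 \<longrightarrow>
        (let K' = residue_ring_pow R' \<pp>' r' in
          \<forall>f \<in> simplicial_isos (color_graph K d m n) (color_graph K' d' m' n').
            \<exists>g \<in> simplicial_isos (free_projective_space K d) (free_projective_space K' d').
              restrict g (\<Union>(color_graph K d m n)) = f))
     \<and>
     (\<forall>f \<in> carrier (Aut (color_graph K d m n)).
        \<exists>!g. g \<in> carrier (Aut (free_projective_space K d)) \<and>
          restrict g (\<Union>(color_graph K d m n)) = f)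
     \<and>
     (\<lambda>g. restrict g (\<Union>(color_graph K d m n)))
        \<in> iso (Aut0 (color K d) (free_projective_space K d))
              (Aut0 (color K d) (color_graph K d m n))
     \<and>
     (m + n = d \<longrightarrow>
        (\<lambda>g. restrict g (\<Union>(color_graph K d m n)))
          \<in> iso (Aut (free_projective_space K d)) (Aut (color_graph K d m n)))
     \<and>
     (m + n \<noteq> d \<longrightarrow>
        (\<lambda>g. restrict g (\<Union>(color_graph K d m n)))
          \<in> iso (Aut0 (color K d) (free_projective_space K d)) (Aut (color_graph K d m n)))"
proof -
  note rs = \<open>1 \<le> m\<close> \<open>m < n\<close> \<open>n \<le> d - 1\<close>
  have d: "2 < d" using rs by auto
  obtain \<pi> s where "chain_ring K \<pi> s"
    using dedekind_domain.residue_ring_chain_ring assms unfolding K_def by blast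
  then interpret A: free_module_space K \<pi> s d by (simp add: free_module_space_def)
  have part1: "\<exists>g \<in> simplicial_isos (free_projective_space K d) (free_projective_space K' d').
      restrict g (\<Union>(color_graph K d m n)) = f"
    if R': "dedekind_domain R'" "primeideal \<pp>' R'" "finite (carrier (R' Quot \<pp>'))" "1 \<le> r'"
      and r': "1 \<le> m'" "m' < n'" "n' \<le> d' - 1" and K': "K' = residue_ring_pow R' \<pp>' r'"
      and f: "f \<in> simplicial_isos (color_graph K d m n) (color_graph K' d' m' n')"
    for R' :: "'b ring" and \<pp>' r' d' m' n' K' f
  proof -
    obtain \<pi>' s' where "chain_ring K' \<pi>' s'"
      using dedekind_domain.residue_ring_chain_ring[OF R'] unfolding K' by blast
    then interpret B: free_module_space K' \<pi>' s' d' by (simp add: free_module_space_def)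
    interpret free_module_pair K \<pi> s d K' \<pi>' s' d' by unfold_locales
    show ?thesis using extend_simplicial_iso[OF rs r' f] .
  qed
  have "\<exists>!g. g \<in> carrier (Aut (free_projective_space K d)) \<and> restrict g (\<Union>(color_graph K d m n)) = f"
    if "f \<in> carrier (Aut (color_graph K d m n))" for f
    using A.self.extend_simplicial_iso[OF rs rs] A.self.simplicial_iso_unique[OF rs d] that
    unfolding Aut_def by (simp; metis)
  then show ?thesis using A.restriction_isos[OF rs] part1 unfolding Let_def by blast
qed

end
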